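(* Let $H$ be a complex Hilbert space and $A$ a self-adjoint positive definite operator on $H$ possessing a sequence of eigenvalues $\mu_n\to\infty$. Let $a,k>0$, $b\in\mathbb R\setminus\{0\}$, and let the operator $\mathcal A_{\alpha,\beta,\gamma}$ and the regions $R_j(\gamma)$, $\tilde R_j$ be as in the context. (a) Suppose $(a,\gamma)\ne(1,1)$, $\frac12\le\gamma\le2$, and $(\alpha,\beta,\gamma)\in R_j(\gamma)$ for some $j\in\{2,3,4,5\}$. Put $\mu=\frac{2(2\alpha-\beta)}{\gamma}$ if $j=2$; $\mu=\frac{2(2\alpha+\beta-\max\{\gamma,2-\gamma\})}{\gamma}$ if $j=3$; $\mu=\frac\beta\alpha$ if $j=4$; $\mu=\frac{2(-2\alpha+\beta+\gamma)}{-2\alpha+\gamma+1}$ if $j=5$. Then for every $\varepsilon>0$ the semigroup $e^{\mathcal A_{\alpha,\beta,\gamma}t}$ is not of Gevrey class of order $\frac1{\mu+\varepsilon}$. (b) Suppose $a=\gamma=1$ and $(\alpha,\beta)\in\tilde R_j$ for some $j\in\{2,3,4\}$. Put $\mu=2(2\alpha-\beta)$ if $j=2$; $\mu=2\beta$ if $j=3$; $\mu=\frac{-2\alpha+\beta+1}{1-\alpha}$ if $j=4$. Then for every $\varepsilon>0$ the semigroup $e^{\mathcal A_{\alpha,\beta,1}t}$ is not of Gevrey class of order $\frac1{\mu+\varepsilon}$.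
   Context: System: $u_{tt}=-aA^\gamma u+bA^\alpha y_t$, $y_{tt}=-Ay-bA^\alpha u_t-kA^\beta y_t$, with $(\alpha,\beta,\gamma)\in E=\{0\le\alpha\le\frac{\gamma+1}2,\ 0\le\beta\le1,\ \frac12\le\gamma\le2\}$. On $\mathcal H=\mathcal D(A^{\gamma/2})\times H\times\mathcal D(A^{1/2})\times H$ use the norm $\|(u,v,y,w)\|_{\mathcal H}^2=a\|A^{\gamma/2}u\|^2+\|v\|^2+\|A^{1/2}y\|^2+\|w\|^2$. The operator is $$\mathcal A_{\alpha,\beta,\gamma}(u,v,y,w)^\top=\big(v,\ -aA^\gamma u+bA^\alpha w,\ w,\ -bA^\alpha v-Ay-kA^\beta w\big)^\top,$$ $\mathcal D(\mathcal A_{\alpha,\beta,\gamma})=\{U\in\mathcal H:\mathcal A_{\alpha,\beta,\gamma}U\in\mathcal H\}$ (powers of $A$ acting on the scale of spaces generated by $A$, so that only the total expression in each row has to lie in the corresponding component of $\mathcal H$). It is known that it generates a $C_0$-semigroup of contractions on $\mathcal H$. A $C_0$-semigroup $e^{\mathcal At}$ is of Gevrey class (of order) $\delta$ if it is infinitely differentiable and for every compact $\mathcal K\subseteq(0,\infty)$ and every $r>0$ there is a constant $C=C(\mathcal K,r)$ with $\|\mathcal A^ne^{\mathcal At}\|\le Cr^n(n!)^\delta$ for all $t\in\mathcal K$, $n\ge0$. Regions ($x\vee y=\max\{x,y\}$). For $1<\gamma\le2$: $R(\gamma)=\{(\alpha,\beta,\gamma)\in E: 0<2\alpha-\beta<\gamma,\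 2\alpha+\beta-\gamma>0,\ 0<\beta\le1\}$. For $\frac12\le\gamma\le1$: $R(\gamma)=\{(\alpha,\beta,\gamma)\in E: 0<2\alpha-\beta<\gamma,\ 2\alpha+\beta+\gamma>2,\ 0<\beta\le1\}\cup\{(\frac{\gamma+1}2,1,\gamma)\}$. $R_2(\gamma)=\{(\alpha,\beta,\gamma)\in R(\gamma): 2\alpha-\beta>0,\ 4\alpha-2\beta-\gamma<0,\ \beta\ge(1-\frac\gamma2)\vee\frac\gamma2\}$, $\frac12\le\gamma\le2$. $R_3(\gamma)=\{(\alpha,\beta,\gamma)\in R(\gamma): 2\alpha+\beta-(\gamma\vee(2-\gamma))>0,\ \alpha\le\frac{1\vee\gamma}2,\ \beta<(1-\frac\gamma2)\vee\frac\gamma2\}$, $\frac12\le\gamma\le2$. $R_4(\gamma)=\{(\alpha,\beta,\gamma)\in R(\gamma): \alpha>\beta,\ \alpha>\frac\gamma2,\ \beta>\frac{4\alpha^2-2\alpha\gamma}{4\alpha-\gamma-1}\}$ for $1<\gamma\le2$ (empty for $\gamma\le 1$). $R_5(\gamma)=\{(\alpha,\beta,\gamma)\in R(\gamma): 2\alpha-\beta-\gamma<0,\ \frac12<\alpha<\frac{\gamma+1}2,\ 2\alpha-2\beta-\gamma+1>0\}$ for $\frac12\le\gamma\le1$; $R_5(\gamma)=\{(\alpha,\beta,\gamma)\in R(\gamma): 2\alpha-\beta-\gamma<0,\ \alpha>\frac\gamma2,\ \beta\le\frac{4\alpha^2-2\gamma\alpha}{4\alpha-\gamma-1}\}$ for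 $1<\gamma\le2$. $\tilde R=\{(\alpha,\beta)\in[0,1]^2: 0<2\alpha-\beta<1,\ 0<\beta\le1\}\cup\{(1,1)\}$; $\tilde R_2=\{(\alpha,\beta)\in\tilde R:\alpha\le\beta,\ 0<2\alpha-\beta<\frac12\}$; $\tilde R_3=\{(\alpha,\beta)\in\tilde R:\alpha>\beta,\ \alpha\le\frac12\}$; $\tilde R_4=\{(\alpha,\beta)\in\tilde R:\alpha>\beta,\ \alpha>\frac12,\ 2\alpha-\beta<1\}$. *)

theory Defs
  imports "HOL-Analysis.Analysis"
begin

class scaleC =
  fixes scaleC :: "complex \<Rightarrow> 'a \<Rightarrow> 'a" (infixr \<open>*\<^sub>C\<close> 75)

class complex_vector = real_vector + scaleC +
  assumes scaleC_add_right: "c *\<^sub>C (x + y) = c *\<^sub>C x + c *\<^sub>C y"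
    and scaleC_add_left: "(c + d) *\<^sub>C x = c *\<^sub>C x + d *\<^sub>C x"
    and scaleC_scaleC: "c *\<^sub>C d *\<^sub>C x = (c * d) *\<^sub>C x"
    and scaleC_of_real: "complex_of_real r *\<^sub>C x = r *\<^sub>R x"

text \<open>The complex inner product is linear in its first argument. The norm and the topology
  are those of the underlying real inner product space; \<open>cinner_commute\<close> makes
  \<open>cinner x x\<close> real, so by \<open>Re_cinner\<close> it equals \<open>(norm x)\<^sup>2\<close>.\<close>

class complex_inner = complex_vector + real_inner +
  fixes cinner :: "'a \<Rightarrow> 'a \<Rightarrow> complex"
  assumes cinner_commute: "cinner x y = cnj (cinner y x)"
    and cinner_add_left: "cinner (x + y) z = cinner x z + cinner y z"
    and cinner_scaleC_left: "cinner (c *\<^sub>C x) y = c * cinner x y"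
    and Re_cinner: "Re (cinner x y) = inner x y"

class complex_hilbert = complex_inner + complete_space

instantiation prod :: (complex_vector, complex_vector) complex_vector
begin

definition scaleC_prod_def: "c *\<^sub>C p = (c *\<^sub>C fst p, c *\<^sub>C snd p)"

instance
  by standard
    (simp_all add: scaleC_prod_def scaleR_prod_def prod_eq_iff
      scaleC_add_right scaleC_add_left scaleC_scaleC scaleC_of_real)

end

text \<open>An unbounded operator is represented by its graph: \<open>(x, y) \<in> A\<close> means that \<open>x\<close> is in the
  domain of \<open>A\<close> and \<open>A x = y\<close>. The relational power \<open>A ^^ n\<close> is then the graph of the n-th
  power of the operator on its natural domain.\<close>

definition linear_operator :: "('a::complex_vector \<times> 'a) set \<Rightarrow> bool" where
  "linear_operator A \<longleftrightarrow> single_valued A \<and> (0, 0) \<in> A \<and>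
     (\<forall>p\<in>A. \<forall>q\<in>A. p + q \<in> A) \<and> (\<forall>c. \<forall>p\<in>A. c *\<^sub>C p \<in> A)"

definition adjoint_graph :: "('h::complex_inner \<times> 'h) set \<Rightarrow> ('h \<times> 'h) set" where
  "adjoint_graph A = {(y, z). \<forall>(x, w)\<in>A. cinner w y = cinner x z}"

definition self_adjoint :: "('h::complex_inner \<times> 'h) set \<Rightarrow> bool" where
  "self_adjoint A \<longleftrightarrow>
     linear_operator A \<and> closure (Domain A) = UNIV \<and> A = adjoint_graph A"

definition positive_definite :: "('h::complex_inner \<times> 'h) set \<Rightarrow> bool" where
  "positive_definite A \<longleftrightarrow> (\<exists>c>0. \<forall>(x, y)\<in>A. c * (norm x)\<^sup>2 \<le> Re (cinner y x))"

definition eigenvalue :: "('h::complex_vector \<times> 'h) set \<Rightarrow> complex \<Rightarrow> bool" where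
  "eigenvalue A z \<longleftrightarrow> (\<exists>e. e \<noteq> 0 \<and> (e, z *\<^sub>C e) \<in> A)"

text \<open>\<open>shifted_inverse A l\<close> is \<open>(l + A)\<^sup>-\<^sup>1\<close>; it is everywhere defined for \<open>l \<ge> 0\<close> and a
  self-adjoint positive definite \<open>A\<close>.\<close>

definition shifted_inverse :: "('h::complex_vector \<times> 'h) set \<Rightarrow> real \<Rightarrow> 'h \<Rightarrow> 'h" where
  "shifted_inverse A l x = (THE z. (z, x - l *\<^sub>R z) \<in> A)"

text \<open>\<open>neg_power A s\<close> is the bounded operator \<open>A\<^sup>-\<^sup>s\<close>, for \<open>s \<ge> 0\<close>. For \<open>0 < s < 1\<close> it is given
  by Balakrishnan's formula
  \<open>A\<^sup>-\<^sup>s = sin (\<pi> s) / \<pi> * \<integral>\<^sub>0\<^sup>\<infinity> l\<^sup>-\<^sup>s (l + A)\<^sup>-\<^sup>1 dl\<close>; in general \<open>A\<^sup>-\<^sup>s = (A\<^sup>-\<^sup>1)\<^sup>m A\<^sup>-\<^sup>f\<close> with \<open>m\<close> the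
  integer part and \<open>f\<close> the fractional part of \<open>s\<close>. The integral is the gauge integral because
  the library's Bochner integral would require \<open>'h\<close> to be separable.\<close>

definition balakrishnan :: "('h::complex_inner \<times> 'h) set \<Rightarrow> real \<Rightarrow> 'h \<Rightarrow> 'h" where
  "balakrishnan A s x =
     (sin (pi * s) / pi) *\<^sub>R integral {0<..} (\<lambda>l. (l powr (- s)) *\<^sub>R shifted_inverse A l x)"

definition neg_power :: "('h::complex_inner \<times> 'h) set \<Rightarrow> real \<Rightarrow> 'h \<Rightarrow> 'h" where
  "neg_power A s x =
     (shifted_inverse A 0 ^^ nat \<lfloor>s\<rfloor>) (if frac s = 0 then x else balakrishnan A (frac s) x)"

text \<open>For \<open>s \<ge> 0\<close>, \<open>A\<^sup>s\<close> is the inverse of the injective operator \<open>A\<^sup>-\<^sup>s\<close>; its domain is the range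
  of \<open>A\<^sup>-\<^sup>s\<close>, and \<open>pos_power A s x\<close> is meaningful only on that domain.\<close>

definition power_domain :: "('h::complex_inner \<times> 'h) set \<Rightarrow> real \<Rightarrow> 'h set" where
  "power_domain A s = range (neg_power A s)"

definition pos_power :: "('h::complex_inner \<times> 'h) set \<Rightarrow> real \<Rightarrow> 'h \<Rightarrow> 'h" where
  "pos_power A s = inv (neg_power A s)"

type_synonym 'h state = "'h \<times> 'h \<times> 'h \<times> 'h"

definition energy_space :: "('h::complex_inner \<times> 'h) set \<Rightarrow> real \<Rightarrow> 'h state set" where
  "energy_space A \<gamma> = power_domain A (\<gamma> / 2) \<times> UNIV \<times> power_domain A (1 / 2) \<times> UNIV"

definition energy_norm :: "('h::complex_inner \<times> 'h) set \<Rightarrow> real \<Rightarrow> real \<Rightarrow> 'h state \<Rightarrow> real" where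
  "energy_norm A a \<gamma> = (\<lambda>(u, v, y, w).
     sqrt (a * (norm (pos_power A (\<gamma> / 2) u))\<^sup>2 + (norm v)\<^sup>2
           + (norm (pos_power A (1 / 2) y))\<^sup>2 + (norm w)\<^sup>2))"

text \<open>The graph of the system operator. The second and fourth rows are equations in the space
  \<open>H\<^sub>-\<^sub>2\<close> of the scale generated by \<open>A\<close>, that is, the completion of \<open>H\<close> under
  \<open>norm (neg_power A 2 x)\<close>. Since \<open>neg_power A 2\<close> extends to an isometric isomorphism of
  \<open>H\<^sub>-\<^sub>2\<close> onto \<open>H\<close>, such an equation is expressed by applying that operator to both sides: a term
  \<open>A\<^sup>s x\<close> becomes \<open>neg_power A (2 - s) x\<close>, which makes sense for every \<open>x\<close> in \<open>H\<close> and
  \<open>0 \<le> s \<le> 2\<close>. This covers all exponents in use, as \<open>\<alpha> \<le> 3/2\<close>, \<open>\<beta> \<le> 1\<close> and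
  \<open>\<gamma> \<le> 2\<close>. No individual term has to lie in \<open>H\<close>.\<close>

definition system_operator ::
  "('h::complex_inner \<times> 'h) set \<Rightarrow> real \<Rightarrow> real \<Rightarrow> real \<Rightarrow> real \<Rightarrow> real \<Rightarrow> real
    \<Rightarrow> ('h state \<times> 'h state) set" where
  "system_operator A a b k \<alpha> \<beta> \<gamma> =
     {((u, v, y, w), (u', v', y', w')).
        (u, v, y, w) \<in> energy_space A \<gamma> \<and> (u', v', y', w') \<in> energy_space A \<gamma> \<and>
        u' = v \<and>
        neg_power A 2 v' =
          - (a *\<^sub>R neg_power A (2 - \<gamma>) u) + b *\<^sub>R neg_power A (2 - \<alpha>) w \<and>
        y' = w \<and>
        neg_power A 2 w' =
          - (b *\<^sub>R neg_power A (2 - \<alpha>) v) - neg_power A (2 - 1) y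
          - k *\<^sub>R neg_power A (2 - \<beta>) w}"

text \<open>The underlying normed space is given by a carrier \<open>X\<close> (a complex subspace of the ambient
  type) and a norm \<open>N\<close> on it, because the energy space depends on \<open>A\<close> and \<open>\<gamma>\<close> and carries its own
  norm.\<close>

definition bounded_operator_on ::
  "'x::complex_vector set \<Rightarrow> ('x \<Rightarrow> real) \<Rightarrow> ('x \<Rightarrow> 'x) \<Rightarrow> bool" where
  "bounded_operator_on X N L \<longleftrightarrow>
     (\<forall>x\<in>X. L x \<in> X) \<and>
     (\<forall>x\<in>X. \<forall>y\<in>X. L (x + y) = L x + L y) \<and>
     (\<forall>c. \<forall>x\<in>X. L (c *\<^sub>C x) = c *\<^sub>C L x) \<and>
     (\<exists>M. \<forall>x\<in>X. N (L x) \<le> M * N x)"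

definition C0_semigroup ::
  "'x::complex_vector set \<Rightarrow> ('x \<Rightarrow> real) \<Rightarrow> (real \<Rightarrow> 'x \<Rightarrow> 'x) \<Rightarrow> bool" where
  "C0_semigroup X N T \<longleftrightarrow>
     (\<forall>t\<ge>0. bounded_operator_on X N (T t)) \<and>
     (\<forall>x\<in>X. T 0 x = x) \<and>
     (\<forall>s\<ge>0. \<forall>t\<ge>0. \<forall>x\<in>X. T (s + t) x = T s (T t x)) \<and>
     (\<forall>x\<in>X. ((\<lambda>t. N (T t x - x)) \<longlongrightarrow> 0) (at_right 0))"

definition generator ::
  "'x::complex_vector set \<Rightarrow> ('x \<Rightarrow> real) \<Rightarrow> (real \<Rightarrow> 'x \<Rightarrow> 'x) \<Rightarrow> ('x \<times> 'x) set" where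
  "generator X N T = {(x, y). x \<in> X \<and> y \<in> X \<and>
     ((\<lambda>t. N ((1 / t) *\<^sub>R (T t x - x) - y)) \<longlongrightarrow> 0) (at_right 0)}"

text \<open>Every orbit is infinitely differentiable on \<open>t > 0\<close> with respect to \<open>N\<close>; \<open>d n\<close> is the n-th
  derivative of the orbit of \<open>x\<close>.\<close>

definition infinitely_differentiable_semigroup ::
  "'x::complex_vector set \<Rightarrow> ('x \<Rightarrow> real) \<Rightarrow> (real \<Rightarrow> 'x \<Rightarrow> 'x) \<Rightarrow> bool" where
  "infinitely_differentiable_semigroup X N T \<longleftrightarrow>
     (\<forall>x\<in>X. \<exists>d :: nat \<Rightarrow> real \<Rightarrow> 'x.
        (\<forall>t>0. d 0 t = T t x) \<and>
        (\<forall>n. \<forall>t>0. d n t \<in> X \<and>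
           ((\<lambda>s. N ((1 / (s - t)) *\<^sub>R (d n s - d n t) - d (Suc n) t)) \<longlongrightarrow> 0) (at t)))"

text \<open>\<open>norm_power_semigroup_le X N T n t M\<close> states that \<open>G\<^sup>n T(t)\<close> is defined on all of \<open>X\<close> with
  operator norm at most \<open>M\<close>, where \<open>G\<close> is the generator of \<open>T\<close>.\<close>

definition norm_power_semigroup_le ::
  "'x::complex_vector set \<Rightarrow> ('x \<Rightarrow> real) \<Rightarrow> (real \<Rightarrow> 'x \<Rightarrow> 'x) \<Rightarrow> nat \<Rightarrow> real \<Rightarrow> real \<Rightarrow> bool"
  where
  "norm_power_semigroup_le X N T n t M \<longleftrightarrow>
     (\<forall>x\<in>X. \<exists>y. (T t x, y) \<in> generator X N T ^^ n \<and> N y \<le> M * N x)"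

definition gevrey_class ::
  "'x::complex_vector set \<Rightarrow> ('x \<Rightarrow> real) \<Rightarrow> (real \<Rightarrow> 'x \<Rightarrow> 'x) \<Rightarrow> real \<Rightarrow> bool" where
  "gevrey_class X N T \<delta> \<longleftrightarrow>
     infinitely_differentiable_semigroup X N T \<and>
     (\<forall>K r. compact K \<and> K \<subseteq> {0<..} \<and> r > 0 \<longrightarrow>
        (\<exists>C. \<forall>t\<in>K. \<forall>n. norm_power_semigroup_le X N T n t (C * r ^ n * fact n powr \<delta>)))"

definition region_E :: "(real \<times> real \<times> real) set" where
  "region_E = {(\<alpha>, \<beta>, \<gamma>). 0 \<le> \<alpha> \<and> \<alpha> \<le> (\<gamma> + 1) / 2 \<and> 0 \<le> \<beta> \<and> \<beta> \<le> 1 \<and> 1/2 \<le> \<gamma> \<and> \<gamma> \<le> 2}"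

definition region_R :: "real \<Rightarrow> (real \<times> real \<times> real) set" where
  "region_R \<gamma> =
     (if 1 < \<gamma> then
        {(\<alpha>, \<beta>, \<gamma>') \<in> region_E. \<gamma>' = \<gamma> \<and>
           0 < 2*\<alpha> - \<beta> \<and> 2*\<alpha> - \<beta> < \<gamma> \<and> 2*\<alpha> + \<beta> - \<gamma> > 0 \<and> 0 < \<beta> \<and> \<beta> \<le> 1}
      else
        {(\<alpha>, \<beta>, \<gamma>') \<in> region_E. \<gamma>' = \<gamma> \<and>
           0 < 2*\<alpha> - \<beta> \<and> 2*\<alpha> - \<beta> < \<gamma> \<and> 2*\<alpha> + \<beta> + \<gamma> > 2 \<and> 0 < \<beta> \<and> \<beta> \<le> 1}
        \<union> {((\<gamma> + 1) / 2, 1, \<gamma>)})"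

definition region_R2 :: "real \<Rightarrow> (real \<times> real \<times> real) set" where
  "region_R2 \<gamma> = {(\<alpha>, \<beta>, \<gamma>') \<in> region_R \<gamma>.
     2*\<alpha> - \<beta> > 0 \<and> 4*\<alpha> - 2*\<beta> - \<gamma> < 0 \<and> \<beta> \<ge> max (1 - \<gamma>/2) (\<gamma>/2)}"

definition region_R3 :: "real \<Rightarrow> (real \<times> real \<times> real) set" where
  "region_R3 \<gamma> = {(\<alpha>, \<beta>, \<gamma>') \<in> region_R \<gamma>.
     2*\<alpha> + \<beta> - max \<gamma> (2 - \<gamma>) > 0 \<and> \<alpha> \<le> max 1 \<gamma> / 2 \<and> \<beta> < max (1 - \<gamma>/2) (\<gamma>/2)}"

definition region_R4 :: "real \<Rightarrow> (real \<times> real \<times> real) set" where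
  "region_R4 \<gamma> =
     (if 1 < \<gamma> then
        {(\<alpha>, \<beta>, \<gamma>') \<in> region_R \<gamma>.
           \<alpha> > \<beta> \<and> \<alpha> > \<gamma>/2 \<and> \<beta> > (4*\<alpha>\<^sup>2 - 2*\<alpha>*\<gamma>) / (4*\<alpha> - \<gamma> - 1)}
      else {})"

definition region_R5 :: "real \<Rightarrow> (real \<times> real \<times> real) set" where
  "region_R5 \<gamma> =
     (if 1 < \<gamma> then
        {(\<alpha>, \<beta>, \<gamma>') \<in> region_R \<gamma>.
           2*\<alpha> - \<beta> - \<gamma> < 0 \<and> \<alpha> > \<gamma>/2 \<and> \<beta> \<le> (4*\<alpha>\<^sup>2 - 2*\<gamma>*\<alpha>) / (4*\<alpha> - \<gamma> - 1)}
      else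
        {(\<alpha>, \<beta>, \<gamma>') \<in> region_R \<gamma>.
           2*\<alpha> - \<beta> - \<gamma> < 0 \<and> 1/2 < \<alpha> \<and> \<alpha> < (\<gamma> + 1) / 2 \<and> 2*\<alpha> - 2*\<beta> - \<gamma> + 1 > 0})"

definition region_Rt :: "(real \<times> real) set" where
  "region_Rt =
     {(\<alpha>, \<beta>). 0 \<le> \<alpha> \<and> \<alpha> \<le> 1 \<and> 0 \<le> \<beta> \<and> \<beta> \<le> 1 \<and>
        0 < 2*\<alpha> - \<beta> \<and> 2*\<alpha> - \<beta> < 1 \<and> 0 < \<beta> \<and> \<beta> \<le> 1} \<union> {(1, 1)}"

definition region_Rt2 :: "(real \<times> real) set" where
  "region_Rt2 = {(\<alpha>, \<beta>) \<in> region_Rt. \<alpha> \<le> \<beta> \<and> 0 < 2*\<alpha> - \<beta> \<and> 2*\<alpha> - \<beta> < 1/2}"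

definition region_Rt3 :: "(real \<times> real) set" where
  "region_Rt3 = {(\<alpha>, \<beta>) \<in> region_Rt. \<alpha> > \<beta> \<and> \<alpha> \<le> 1/2}"

definition region_Rt4 :: "(real \<times> real) set" where
  "region_Rt4 = {(\<alpha>, \<beta>) \<in> region_Rt. \<alpha> > \<beta> \<and> \<alpha> > 1/2 \<and> 2*\<alpha> - \<beta> < 1}"

end

theory Submission
  imports Defs "HOL-Computational_Algebra.Fundamental_Theorem_Algebra" "HOL-Real_Asymp.Real_Asymp"
begin

text \<open>On the eigenspace of \<open>A\<close> for an eigenvalue \<open>m\<close> the system is a \<open>4 \<times> 4\<close> matrix, so every root \<open>z\<close>
  of its characteristic polynomial is an eigenvalue of the generator, with eigenvector \<open>U\<close> and
  \<open>T(t) U = e\<^bsup>z t\<^esup> U\<close>. Gevrey class \<open>1 / \<sigma>\<close> bounds \<open>\<bar>z\<bar>\<^sup>n e\<^bsup>Re z\<^esup>\<close> by \<open>(n!)\<^bsup>1/\<sigma>\<^esup>\<close> up to a power of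
  \<open>m\<close>; optimising over \<open>n\<close> forces \<open>\<bar>Re z\<bar>\<close> to grow at least like \<open>\<bar>z\<bar>\<^sup>\<sigma>\<close>. It therefore suffices to
  find roots with \<open>\<bar>z\<bar>\<close> of order at least \<open>m\<^sup>p\<close> and \<open>\<bar>Re z\<bar>\<close> of order at most \<open>m\<^sup>q\<close>, where
  \<open>q / p = \<mu>\<close>. A quartic \<open>P\<close> has a root within distance \<open>4 \<bar>P(z)\<bar> / \<bar>P'(z)\<bar>\<close> of any point \<open>z\<close>. For \<open>z\<close>
  on the imaginary axis this distance bounds \<open>\<bar>Re\<bar>\<close> of the root, and \<open>z\<close> is taken to be
  \<open>\<i> \<surd>(a m\<^sup>\<gamma>)\<close> when the damping is strong and a frequency of the undamped system otherwise.\<close>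

section \<open>Complex Hilbert spaces and resolvents\<close>

\<comment> \<open>No explicit formula for the roots works uniformly over the regions. It is replaced
  by the gap between the squared undamped frequencies \<open>X\<close> and \<open>Y\<close> with
  \<open>X \<le> Y\<close>: near \<open>\<i> * sqrt X\<close> a root is displaced by at most
  \<open>2 * \<kappa> * \<bar>g - X\<bar> / (Y - X)\<close>, and likewise near \<open>Y\<close>. The
  regions differ in how this quotient is bounded. It is at most \<open>2 * \<kappa>\<close> for
  \<open>Y\<close> (j = 4) and at most \<open>2 * \<kappa> * g / B\<close> for \<open>X\<close> (j =
  5). If \<open>g\<close> and \<open>m\<close> are separated by a constant factor, the numerator is
  controlled by the coupling \<open>B\<close> and the gap by the larger of \<open>g\<close> and
  \<open>m\<close> (j = 3). For a = \<gamma> = 1 the two numbers coincide, this gain is lost and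
  only \<open>2 * \<kappa>\<close> remains, which is why \<mu> becomes 2 \<beta> there. A second
  obstacle is that fractional powers are gauge integrals of resolvents. On an eigenvector they
  reduce to a scalar Beta integral, but \<open>pos_power\<close> is an inverse function and the
  system operator is read off after applying \<open>neg_power A 2\<close>, so injectivity of the
  negative powers is needed on the whole space. Hence the resolvent theory.\<close>
subclass (in complex_hilbert) banach ..

lemma cinner_scaleC_right: "cinner x (c *\<^sub>C y) = cnj c * cinner x y"
  by (metis cinner_scaleC_left cinner_commute complex_cnj_mult)

lemma scaleC_zero_right [simp]: "c *\<^sub>C (0::'a::complex_vector) = 0"
  using scaleC_add_right[of c 0 0] by simp

lemma scaleC_zero_left [simp]: "0 *\<^sub>C (x::'a::complex_vector) = 0"
  using scaleC_add_left[of 0 0 x] by simp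

lemma scaleC_one [simp]: "1 *\<^sub>C (x::'a::complex_vector) = x"
  using scaleC_of_real[of 1 x] by simp

lemma scaleC_minus_left: "(- c) *\<^sub>C (x::'a::complex_vector) = - (c *\<^sub>C x)"
  using scaleC_add_left[of "-c" c x] by (simp add: eq_neg_iff_add_eq_0)

lemma scaleC_minus_right: "c *\<^sub>C (- x::'a::complex_vector) = - (c *\<^sub>C x)"
  using scaleC_add_right[of c "-x" x] by (simp add: eq_neg_iff_add_eq_0)

lemma scaleC_diff_right: "c *\<^sub>C (x - y::'a::complex_vector) = c *\<^sub>C x - c *\<^sub>C y"
  using scaleC_add_right[of c x "-y"] by (simp add: scaleC_minus_right)

lemma scaleR_conv_scaleC: "r *\<^sub>R (x::'a::complex_vector) = complex_of_real r *\<^sub>C x"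
  by (simp add: scaleC_of_real)

lemma cinner_scaleR_left: "cinner (r *\<^sub>R x) y = complex_of_real r * cinner x y"
  by (simp add: scaleR_conv_scaleC cinner_scaleC_left)

lemma cinner_zero_left [simp]: "cinner 0 y = 0"
  using cinner_scaleR_left[of 0 0 y] by simp

lemma cinner_self: "cinner x x = complex_of_real ((norm x)\<^sup>2)"
proof (rule complex_eqI)
  show "Re (cinner x x) = Re (complex_of_real ((norm x)\<^sup>2))"
    by (simp add: Re_cinner dot_square_norm)
  have "Im (cinner x x) = - Im (cinner x x)"
    using arg_cong[OF cinner_commute[of x x], of Im] by simp
  then show "Im (cinner x x) = Im (complex_of_real ((norm x)\<^sup>2))" by simp
qed

lemma norm_scaleC: "norm (c *\<^sub>C (x::'a::complex_inner)) = cmod c * norm x"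
proof -
  have "complex_of_real ((norm (c *\<^sub>C x))\<^sup>2) = c * cnj c * complex_of_real ((norm x)\<^sup>2)"
    by (simp only: cinner_self[symmetric] cinner_scaleC_left cinner_scaleC_right mult_ac)
  also have "\<dots> = complex_of_real ((cmod c * norm x)\<^sup>2)"
    by (simp add: complex_norm_square[symmetric] power_mult_distrib)
  finally have "(norm (c *\<^sub>C x))\<^sup>2 = (cmod c * norm x)\<^sup>2"
    by (simp only: of_real_eq_iff)
  then show ?thesis by (simp add: power2_eq_iff_nonneg)
qed

text \<open>Multiplying \<open>x\<close> by the conjugate phase of \<open>cinner x y\<close> makes
  the product real and non-negative, which reduces the claim to the real Cauchy-Schwarz
  inequality.\<close>

lemma norm_cinner_le: "cmod (cinner x y) \<le> norm x * norm (y::'a::complex_inner)"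
proof (cases "cinner x y = 0")
  case False
  define c where "c = cnj (sgn (cinner x y))"
  have c: "cmod c = 1" using False by (simp add: c_def norm_sgn)
  have "c * cinner x y = complex_of_real (cmod (cinner x y))"
    using False unfolding c_def sgn_div_norm
    by (simp add: complex_norm_square[symmetric] power2_eq_square scaleR_conv_of_real field_simps)
  then have "cmod (cinner x y) = Re (cinner (c *\<^sub>C x) y)"
    by (simp add: cinner_scaleC_left)
  also have "\<dots> \<le> norm (c *\<^sub>C x) * norm y"
    by (simp add: Re_cinner norm_cauchy_schwarz)
  also have "\<dots> = norm x * norm y" by (simp add: norm_scaleC c)
  finally show ?thesis .
qed simp

lemma bounded_linear_scaleC_right: "bounded_linear (\<lambda>x::'a::complex_inner. c *\<^sub>C x)"
proof (rule bounded_linear_intro[where K = "cmod c"])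
  show "c *\<^sub>C (r *\<^sub>R x) = r *\<^sub>R (c *\<^sub>C x)" for r and x :: 'a
    by (simp add: scaleR_conv_scaleC scaleC_scaleC mult.commute)
qed (simp_all add: scaleC_add_right norm_scaleC)

lemma bounded_linear_cinner_left: "bounded_linear (\<lambda>x. cinner x (y::'a::complex_inner))"
  by (rule bounded_linear_intro[where K = "norm y"])
    (simp_all add: cinner_add_left cinner_scaleR_left scaleR_conv_of_real norm_cinner_le)

section \<open>Nearest points and orthogonal vectors\<close>

lemma parallelogram_law:
  fixes x y :: "'a::real_inner"
  shows "(norm (x + y))\<^sup>2 + (norm (x - y))\<^sup>2 = 2 * (norm x)\<^sup>2 + 2 * (norm y)\<^sup>2"
  by (simp add: power2_norm_eq_inner inner_add inner_diff inner_commute)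

text \<open>A minimising sequence for the distance to \<open>x\<close> is Cauchy by the parallelogram law.\<close>

lemma nearest_point_exists:
  fixes S :: "'a::{real_inner, complete_space} set"
  assumes "closed S" "convex S" "S \<noteq> {}"
  shows "\<exists>p\<in>S. \<forall>q\<in>S. norm (x - p) \<le> norm (x - q)"
proof -
  define d where "d = (INF q\<in>S. (norm (x - q))\<^sup>2)"
  have bdd: "bdd_below ((\<lambda>q. (norm (x - q))\<^sup>2) ` S)" by (rule bdd_belowI[of _ 0]) auto
  have d_le: "d \<le> (norm (x - q))\<^sup>2" if "q \<in> S" for q
    unfolding d_def by (rule cINF_lower[OF bdd that])
  have "\<exists>q\<in>S. (norm (x - q))\<^sup>2 < d + inverse (real (Suc n))" for n
    using cINF_less_iff[OF assms(3) bdd, of "d + inverse (real (Suc n))"] by (simp add: d_def)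
  then obtain p where pS: "\<And>n. p n \<in> S"
    and p: "\<And>n. (norm (x - p n))\<^sup>2 < d + inverse (real (Suc n))" by metis
  have close: "(norm (p m - p n))\<^sup>2 \<le> 2 * inverse (real (Suc m)) + 2 * inverse (real (Suc n))" for m n
  proof -
    have "(1/2) *\<^sub>R p m + (1/2) *\<^sub>R p n \<in> S"
      using assms(2) pS by (intro convexD) auto
    from d_le[OF this] have "4 * d \<le> 4 * (norm (x - ((1/2) *\<^sub>R p m + (1/2) *\<^sub>R p n)))\<^sup>2" by simp
    also have "\<dots> = (norm (2 *\<^sub>R (x - ((1/2) *\<^sub>R p m + (1/2) *\<^sub>R p n))))\<^sup>2"
      by (simp add: power_mult_distrib)
    also have "2 *\<^sub>R (x - ((1/2) *\<^sub>R p m + (1/2) *\<^sub>R p n)) = (x - p m) + (x - p n)"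
      by (simp add: algebra_simps scaleR_2)
    finally have "4 * d \<le> (norm ((x - p m) + (x - p n)))\<^sup>2" .
    moreover have "norm ((x - p m) - (x - p n)) = norm (p m - p n)"
      by (simp add: norm_minus_commute)
    ultimately show ?thesis
      using parallelogram_law[of "x - p m" "x - p n"] p[of m] p[of n] by simp
  qed
  have "Cauchy p"
  proof (rule metric_CauchyI)
    fix e :: real assume e: "0 < e"
    obtain N where N: "inverse (real (Suc N)) < e\<^sup>2 / 4"
      using reals_Archimedean[of "e\<^sup>2 / 4"] e by auto
    have "dist (p m) (p n) < e" if "m \<ge> N" "n \<ge> N" for m n
    proof -
      have "inverse (real (Suc m)) \<le> inverse (real (Suc N))"
        "inverse (real (Suc n)) \<le> inverse (real (Suc N))"
        using that by (auto intro!: le_imp_inverse_le)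
      then have "(norm (p m - p n))\<^sup>2 < e\<^sup>2" using close[of m n] N by linarith
      then show ?thesis using e by (simp add: dist_norm power_less_imp_less_base)
    qed
    then show "\<exists>N. \<forall>m\<ge>N. \<forall>n\<ge>N. dist (p m) (p n) < e" by blast
  qed
  then obtain l where l: "p \<longlonglongrightarrow> l" using Cauchy_convergent_iff convergent_def by blast
  have lS: "l \<in> S" using closed_sequentially[OF assms(1) _ l] pS by blast
  have "(norm (x - l))\<^sup>2 \<le> d"
  proof (rule LIMSEQ_le)
    show "(\<lambda>n. (norm (x - p n))\<^sup>2) \<longlonglongrightarrow> (norm (x - l))\<^sup>2" by (intro tendsto_intros l)
    show "(\<lambda>n. d + inverse (real (Suc n))) \<longlonglongrightarrow> d"
      using tendsto_add[OF tendsto_const LIMSEQ_inverse_real_of_nat, of d] by simp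
    show "\<exists>N. \<forall>n\<ge>N. (norm (x - p n))\<^sup>2 \<le> d + inverse (real (Suc n))"
      using p less_imp_le by blast
  qed
  then have "norm (x - l) \<le> norm (x - q)" if "q \<in> S" for q
    using d_le[OF that] by (meson norm_ge_zero order_trans power2_le_imp_le)
  with lS show ?thesis by blast
qed

text \<open>The vector is \<open>x - p\<close>, with \<open>p\<close> the point of \<open>S\<close>
  nearest to some \<open>x\<close> outside \<open>S\<close>: a non-zero component along a vector of
  \<open>S\<close> could be removed to come closer.\<close>

lemma closed_subspace_orthogonal_vector:
  fixes S :: "'a::{real_inner, complete_space} set"
  assumes "closed S" "subspace S" "S \<noteq> UNIV"
  shows "\<exists>z. z \<noteq> 0 \<and> (\<forall>q\<in>S. inner z q = 0)"
proof -
  obtain x where x: "x \<notin> S" using assms(3) by blast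
  have "S \<noteq> {}" using subspace_0[OF assms(2)] by blast
  from nearest_point_exists[OF assms(1) subspace_imp_convex[OF assms(2)] this, of x]
  obtain p where p: "p \<in> S" and min: "\<And>q. q \<in> S \<Longrightarrow> norm (x - p) \<le> norm (x - q)" by blast
  have "inner (x - p) q = 0" if q: "q \<in> S" for q
  proof (cases "q = 0")
    case False
    \<comment> \<open>The minimiser of the quadratic in \<open>t\<close> that compares
      \<open>p\<close> with \<open>p + t *\<^sub>R q\<close>.\<close>
    define t where "t = inner (x - p) q / inner q q"
    have qq: "inner q q > 0" using False by simp
    have "p + t *\<^sub>R q \<in> S" using p q assms(2) by (simp add: subspace_add subspace_scale)
    from min[OF this] have "(norm (x - p))\<^sup>2 \<le> (norm ((x - p) - t *\<^sub>R q))\<^sup>2"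
      by (simp add: power_mono diff_diff_eq)
    also have "\<dots> = (norm (x - p))\<^sup>2 - 2 * t * inner (x - p) q + t\<^sup>2 * inner q q"
      unfolding power2_norm_eq_inner
      by (simp add: inner_diff_left inner_diff_right inner_commute power2_eq_square algebra_simps)
    also have "\<dots> = (norm (x - p))\<^sup>2 - (inner (x - p) q)\<^sup>2 / inner q q"
      using qq by (simp add: t_def power2_eq_square field_simps)
    finally have "(inner (x - p) q)\<^sup>2 / inner q q \<le> 0" by simp
    then have "(inner (x - p) q)\<^sup>2 \<le> 0" using qq by (simp add: divide_le_0_iff)
    then show ?thesis by simp
  qed simp
  moreover have "x - p \<noteq> 0" using x p by auto
  ultimately show ?thesis by blast
qed

section \<open>Resolvents of a coercive self-adjoint operator\<close>

locale coercive_self_adjoint =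
  fixes A :: "('h::complex_hilbert \<times> 'h) set" and c :: real
  assumes sa: "self_adjoint A" and c_pos: "c > 0"
    and coercive: "\<And>x y. (x, y) \<in> A \<Longrightarrow> c * (norm x)\<^sup>2 \<le> Re (cinner y x)"
begin

lemma A_add: "(x, y) \<in> A \<Longrightarrow> (x', y') \<in> A \<Longrightarrow> (x + x', y + y') \<in> A"
  using sa unfolding self_adjoint_def linear_operator_def by fastforce

lemma A_scaleC: "(x, y) \<in> A \<Longrightarrow> (z *\<^sub>C x, z *\<^sub>C y) \<in> A"
  using sa unfolding self_adjoint_def linear_operator_def scaleC_prod_def by fastforce

lemma A_zero: "(0, 0) \<in> A"
  using sa unfolding self_adjoint_def linear_operator_def by blast

lemma A_minus: "(x, y) \<in> A \<Longrightarrow> (- x, - y) \<in> A"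
  using A_scaleC[of x y "-1"] by (simp add: scaleC_minus_left)

lemma A_symmetric: "(x, w) \<in> A \<Longrightarrow> (y, z) \<in> A \<Longrightarrow> cinner w y = cinner x z"
  using sa unfolding self_adjoint_def adjoint_graph_def by blast

lemma A_maximal: "(\<And>x w. (x, w) \<in> A \<Longrightarrow> cinner w y = cinner x z) \<Longrightarrow> (y, z) \<in> A"
  using sa unfolding self_adjoint_def adjoint_graph_def by blast

text \<open>The identity defining the adjoint graph passes to limits in both components, and
  \<open>A\<close> is its own adjoint.\<close>

lemma A_closed:
  assumes "\<And>n. (x n, w n) \<in> A" "x \<longlonglongrightarrow> x'" "w \<longlonglongrightarrow> w'"
  shows "(x', w') \<in> A"
proof (rule A_maximal)
  fix y z assume yz: "(y, z) \<in> A"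
  have "(\<lambda>n. cinner (x n) z) \<longlonglongrightarrow> cinner x' z"
    by (rule bounded_linear.tendsto[OF bounded_linear_cinner_left assms(2)])
  moreover have "(\<lambda>n. cinner (w n) y) \<longlonglongrightarrow> cinner w' y"
    by (rule bounded_linear.tendsto[OF bounded_linear_cinner_left assms(3)])
  moreover have "cinner (w n) y = cinner (x n) z" for n
    using A_symmetric[OF assms(1) yz] .
  ultimately have "cinner x' z = cinner w' y" using LIMSEQ_unique by simp
  then show "cinner z x' = cinner y w'" by (metis cinner_commute)
qed

lemma shifted_coercive:
  assumes "(z, x - l *\<^sub>R z) \<in> A"
  shows "(c + l) * (norm z)\<^sup>2 \<le> inner x z"
proof -
  have "c * (norm z)\<^sup>2 \<le> inner (x - l *\<^sub>R z) z"
    using coercive[OF assms] by (simp add: Re_cinner)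
  also have "\<dots> = inner x z - l * (norm z)\<^sup>2"
    by (simp add: inner_diff_left dot_square_norm)
  finally show ?thesis by (simp add: algebra_simps)
qed

lemma shifted_bound:
  assumes "(z, x - l *\<^sub>R z) \<in> A" "l \<ge> 0"
  shows "(c + l) * norm z \<le> norm x"
proof (cases "z = 0")
  case False
  have "(c + l) * norm z * norm z \<le> norm x * norm z"
    using shifted_coercive[OF assms(1)] norm_cauchy_schwarz[of x z]
    by (simp add: power2_eq_square mult.assoc)
  then show ?thesis using False by (simp add: mult_le_cancel_right)
qed simp

lemma shifted_unique:
  assumes "(z, x - l *\<^sub>R z) \<in> A" "(z', x - l *\<^sub>R z') \<in> A" "l \<ge> 0"
  shows "z = z'"
proof -
  have "(z - z', 0 - l *\<^sub>R (z - z')) \<in> A"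
    using A_add[OF assms(1) A_minus[OF assms(2)]] by (simp add: algebra_simps)
  from shifted_bound[OF this assms(3)] have "(c + l) * norm (z - z') \<le> 0" by simp
  then show ?thesis using c_pos assms(3) by (simp add: mult_le_0_iff)
qed

text \<open>Coercivity bounds preimages by images, so the preimages of a convergent sequence are
  Cauchy; closedness of the graph then supplies a preimage of the limit.\<close>

lemma shifted_range_closed:
  assumes l: "l \<ge> 0"
  shows "closed {x. \<exists>z. (z, x - l *\<^sub>R z) \<in> A}"
  unfolding closed_sequential_limits
proof (intro allI impI, elim conjE)
  fix X x assume "\<forall>n. X n \<in> {x. \<exists>z. (z, x - l *\<^sub>R z) \<in> A}" and X: "X \<longlonglongrightarrow> x"
  then obtain Z where Z: "\<And>n. (Z n, X n - l *\<^sub>R Z n) \<in> A" by (simp, metis)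
  have le: "c * norm (Z m - Z n) \<le> norm (X m - X n)" for m n
  proof -
    have "(Z m - Z n, (X m - X n) - l *\<^sub>R (Z m - Z n)) \<in> A"
      using A_add[OF Z[of m] A_minus[OF Z[of n]]] by (simp add: algebra_simps)
    from shifted_bound[OF this l] show ?thesis
      using mult_right_mono[of c "c + l" "norm (Z m - Z n)"] l by simp
  qed
  have "Cauchy Z"
  proof (rule metric_CauchyI)
    fix e :: real assume e: "0 < e"
    obtain N where N: "\<forall>m\<ge>N. \<forall>n\<ge>N. dist (X m) (X n) < c * e"
      using metric_CauchyD[OF LIMSEQ_imp_Cauchy[OF X], of "c * e"] e c_pos by auto
    have "dist (Z m) (Z n) < e" if "m \<ge> N" "n \<ge> N" for m n
    proof -
      have "c * norm (Z m - Z n) < c * e" using N that le[of m n] by (force simp: dist_norm)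
      then show ?thesis using c_pos by (simp add: dist_norm)
    qed
    then show "\<exists>N. \<forall>m\<ge>N. \<forall>n\<ge>N. dist (Z m) (Z n) < e" by blast
  qed
  then obtain z where z: "Z \<longlonglongrightarrow> z" using Cauchy_convergent_iff convergent_def by blast
  have "(z, x - l *\<^sub>R z) \<in> A"
    by (rule A_closed[OF Z z]) (intro tendsto_intros X z)
  then show "x \<in> {x. \<exists>z. (z, x - l *\<^sub>R z) \<in> A}" by blast
qed

text \<open>A vector \<open>y\<close> orthogonal to a proper closed range would, by
  self-adjointness, lie in the domain with \<open>A y = - l y\<close>, which coercivity forbids for
  \<open>l \<ge> 0\<close>.\<close>

lemma shifted_surj:
  assumes l: "l \<ge> 0"
  shows "\<exists>z. (z, x - l *\<^sub>R z) \<in> A"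
proof -
  let ?S = "{x. \<exists>z. (z, x - l *\<^sub>R z) \<in> A}"
  have scale: "z *\<^sub>C x \<in> ?S" if "x \<in> ?S" for z x
  proof -
    from that obtain u where "(u, x - l *\<^sub>R u) \<in> A" by blast
    from A_scaleC[OF this, of z] have "(z *\<^sub>C u, z *\<^sub>C x - l *\<^sub>R z *\<^sub>C u) \<in> A"
      by (simp add: scaleC_diff_right scaleR_conv_scaleC scaleC_scaleC mult.commute)
    then show ?thesis by blast
  qed
  have sub: "subspace ?S"
  proof (rule subspaceI)
    show "0 \<in> ?S" using A_zero by (intro CollectI exI[of _ 0]) simp
    show "x + y \<in> ?S" if "x \<in> ?S" "y \<in> ?S" for x y
    proof -
      from that obtain u v where "(u, x - l *\<^sub>R u) \<in> A" "(v, y - l *\<^sub>R v) \<in> A" by blast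
      from A_add[OF this] show ?thesis
        by (intro CollectI exI[of _ "u + v"]) (simp add: algebra_simps)
    qed
    show "r *\<^sub>R x \<in> ?S" if "x \<in> ?S" for r x
      using scale[OF that, of "complex_of_real r"] by (simp add: scaleC_of_real)
  qed
  have "?S = UNIV"
  proof (rule ccontr)
    assume "?S \<noteq> UNIV"
    from closed_subspace_orthogonal_vector[OF shifted_range_closed[OF l] sub this]
    obtain y where y: "y \<noteq> 0" and orth: "\<And>q. q \<in> ?S \<Longrightarrow> inner y q = 0" by blast
    \<comment> \<open>The orthogonal vector is obtained in the real sense only. The range is a
      complex subspace, so testing with \<open>\<i> *\<^sub>C q\<close> also removes the imaginary
      part.\<close>
    have corth: "cinner q y = 0" if q: "q \<in> ?S" for q
    proof (rule complex_eqI)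
      show "Re (cinner q y) = Re 0" using orth[OF q] by (simp add: Re_cinner inner_commute)
      have "Re (cinner (\<i> *\<^sub>C q) y) = 0"
        using orth[OF scale[OF q, of \<i>]] by (simp add: Re_cinner inner_commute)
      then show "Im (cinner q y) = Im 0" by (simp add: cinner_scaleC_left)
    qed
    have "(y, 0 - l *\<^sub>R y) \<in> A"
    proof (rule A_maximal)
      fix x w assume "(x, w) \<in> A"
      then have "w + l *\<^sub>R x \<in> ?S" by (intro CollectI exI[of _ x]) simp
      from corth[OF this] have "cinner w y = - (l * cinner x y)"
        by (simp add: cinner_add_left cinner_scaleR_left) (simp only: eq_neg_iff_add_eq_0)
      also have "\<dots> = cinner x (0 - l *\<^sub>R y)"
        using cinner_scaleC_right[of x "complex_of_real (- l)" y] by (simp add: scaleC_of_real scaleC_minus_left)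
      finally show "cinner w y = cinner x (0 - l *\<^sub>R y)" .
    qed
    from shifted_bound[OF this l] y c_pos l show False by (simp add: mult_le_0_iff)
  qed
  then show ?thesis by blast
qed

abbreviation R :: "real \<Rightarrow> 'h \<Rightarrow> 'h" where "R \<equiv> shifted_inverse A"

lemma R_graph: "l \<ge> 0 \<Longrightarrow> (R l x, x - l *\<^sub>R R l x) \<in> A"
  unfolding shifted_inverse_def
  using shifted_surj[of l x] shifted_unique[of _ x l] by (metis (mono_tags, lifting) theI)

lemma R_eqI: "(z, x - l *\<^sub>R z) \<in> A \<Longrightarrow> l \<ge> 0 \<Longrightarrow> R l x = z"
  using shifted_unique R_graph by blast

lemma R_add: "l \<ge> 0 \<Longrightarrow> R l (x + y) = R l x + R l y"
  using A_add[OF R_graph R_graph, of l l x y] by (intro R_eqI) (simp_all add: algebra_simps)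

lemma R_scaleC: "l \<ge> 0 \<Longrightarrow> R l (z *\<^sub>C x) = z *\<^sub>C R l x"
  using A_scaleC[OF R_graph, of l z x]
  by (intro R_eqI) (simp_all add: scaleC_diff_right scaleR_conv_scaleC scaleC_scaleC mult.commute)

lemma R_bound: "l \<ge> 0 \<Longrightarrow> (c + l) * norm (R l x) \<le> norm x"
  using shifted_bound[OF R_graph] .

lemma R_coercive: "l \<ge> 0 \<Longrightarrow> c * (norm (R l x))\<^sup>2 \<le> inner (R l x) x"
  using shifted_coercive[OF R_graph, of l x] mult_right_mono[of c "c + l" "(norm (R l x))\<^sup>2"]
  by (simp add: inner_commute)

lemma R_inj: "l \<ge> 0 \<Longrightarrow> R l x = 0 \<Longrightarrow> x = 0"
proof -
  assume l: "l \<ge> 0" and 0: "R l x = 0"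
  have "(0, x) \<in> A" using R_graph[OF l, of x] 0 by simp
  moreover have "single_valued A" using sa unfolding self_adjoint_def linear_operator_def by blast
  ultimately show ?thesis using A_zero by (meson single_valuedD)
qed

text \<open>This is the resolvent identity with each of the two resolvents bounded by
  \<open>1 / c\<close>. It gives the continuity in \<open>l\<close> that makes the Balakrishnan
  integrand integrable on compact intervals.\<close>

lemma R_lipschitz:
  assumes "l \<ge> 0" "l' \<ge> 0"
  shows "c\<^sup>2 * norm (R l x - R l' x) \<le> \<bar>l - l'\<bar> * norm x"
proof -
  let ?d = "R l x - R l' x"
  have "(?d, (l' - l) *\<^sub>R R l' x - l *\<^sub>R ?d) \<in> A"
    using A_add[OF R_graph[OF assms(1), of x] A_minus[OF R_graph[OF assms(2), of x]]]
    by (simp add: algebra_simps)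
  from shifted_bound[OF this assms(1)] have "(c + l) * norm ?d \<le> \<bar>l' - l\<bar> * norm (R l' x)" by simp
  moreover have "c * norm ?d \<le> (c + l) * norm ?d" using assms by (simp add: mult_right_mono)
  ultimately have "c * norm ?d \<le> \<bar>l' - l\<bar> * norm (R l' x)" by linarith
  then have "c * (c * norm ?d) \<le> c * (\<bar>l' - l\<bar> * norm (R l' x))"
    using c_pos by (simp add: mult_left_mono)
  also have "\<dots> = \<bar>l' - l\<bar> * (c * norm (R l' x))" by simp
  also have "\<dots> \<le> \<bar>l' - l\<bar> * norm x"
  proof (rule mult_left_mono)
    show "c * norm (R l' x) \<le> norm x"
      using R_bound[OF assms(2), of x] mult_right_mono[of c "c + l'" "norm (R l' x)"] assms by simp
  qed simp
  finally show ?thesis by (simp add: power2_eq_square abs_minus_commute mult.assoc)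
qed

lemma R_continuous: "continuous_on {0..} (\<lambda>l. R l x)"
proof (rule lipschitz_on_continuous_on[where L = "norm x / c\<^sup>2"], rule lipschitz_onI)
  show "dist (R l x) (R l' x) \<le> norm x / c\<^sup>2 * dist l l'" if "l \<in> {0..}" "l' \<in> {0..}" for l l'
    using R_lipschitz[of l l' x] that c_pos
    by (simp add: dist_norm field_simps)
qed (use c_pos in simp)

end

section \<open>Balakrishnan integrals and fractional powers\<close>

text \<open>The substitution \<open>u = l powr (1 - s)\<close> removes the singularity at 0:
  \<open>G\<close> is a primitive of the continuous function \<open>g\<close>, and the chain rule
  turns it into a primitive of the integrand on the open interval. One \<open>F\<close> serves all
  intervals, which allows its limit at infinity to be taken later.\<close>

lemma has_integral_powr_at_zero:
  fixes f :: "real \<Rightarrow> 'a::banach" and s :: real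
  assumes s: "0 < s" "s < 1" and f: "continuous_on {0..} f"
  shows "\<exists>F. \<forall>a b. 0 \<le> a \<longrightarrow> a \<le> b \<longrightarrow>
      ((\<lambda>l. l powr (- s) *\<^sub>R f l) has_integral (F b - F a)) {a..b}"
proof -
  define p where "p = 1 / (1 - s)"
  define g where "g = (\<lambda>t. f (t powr p))"
  define G where "G = (\<lambda>u. integral {0..u} g)"
  define F where "F = (\<lambda>l. p *\<^sub>R G (l powr (1 - s)))"
  have p: "p > 0" "p * (1 - s) = 1" using s by (simp_all add: p_def)
  have g: "continuous_on {0..} g"
    unfolding g_def
    by (rule continuous_on_compose2[OF f]) (use p in \<open>auto intro!: continuous_intros continuous_on_powr'\<close>)
  have G_deriv: "(G has_vector_derivative g u) (at u within {0..b})" if "0 \<le> u" "u \<le> b" for u b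
    unfolding G_def by (rule integral_has_vector_derivative)
      (use that in \<open>auto intro: continuous_on_subset[OF g]\<close>)
  have "((\<lambda>l. l powr (- s) *\<^sub>R f l) has_integral (F b - F a)) {a..b}" if ab: "0 \<le> a" "a \<le> b" for a b
  proof (rule fundamental_theorem_of_calculus_interior[OF ab(2)])
    have "continuous_on {0..b powr (1 - s)} G"
      unfolding continuous_on_eq_continuous_within
      by (auto intro!: has_vector_derivative_continuous[OF G_deriv])
    then show "continuous_on {a..b} F"
      unfolding F_def
      by (intro continuous_intros, elim continuous_on_compose2)
        (use s ab in \<open>auto intro!: continuous_intros continuous_on_powr' powr_mono2\<close>)
    fix l assume l: "l \<in> {a<..<b}"
    then have l0: "l > 0" using ab by simp
    have "(G has_vector_derivative g (l powr (1 - s))) (at (l powr (1 - s)) within {0..l powr (1 - s) + 1})"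
      by (rule G_deriv) auto
    moreover have "at (l powr (1 - s)) within {0..l powr (1 - s) + 1} = at (l powr (1 - s))"
      using l0 by (intro at_within_interior) auto
    ultimately have G': "(G has_vector_derivative g (l powr (1 - s))) (at (l powr (1 - s)))" by simp
    have "((\<lambda>l. l powr (1 - s)) has_real_derivative (1 - s) * l powr (- s)) (at l)"
      using has_real_derivative_powr[OF l0, of "1 - s"] by simp
    from vector_diff_chain_at[OF this[unfolded has_real_derivative_iff_has_vector_derivative] G']
    have "(F has_vector_derivative p *\<^sub>R ((1 - s) * l powr (- s)) *\<^sub>R g (l powr (1 - s))) (at l)"
      unfolding F_def o_def by (rule bounded_linear.has_vector_derivative[OF bounded_linear_scaleR_right])
    moreover have "g (l powr (1 - s)) = f l"
      using l0 p by (simp add: g_def powr_powr mult.commute)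
    ultimately show "(F has_vector_derivative l powr (- s) *\<^sub>R f l) (at l)"
      using p(2) by (simp add: mult.assoc[symmetric])
  qed
  then show ?thesis by blast
qed

text \<open>The integrand is dominated by \<open>B * l powr (- s - 1)\<close>, whose tails vanish,
  so the primitive \<open>F\<close> has a limit \<open>L\<close> at infinity and the integral is
  \<open>L - F 0\<close>.\<close>

lemma integrable_powr_half_line:
  fixes f :: "real \<Rightarrow> 'a::banach" and s :: real
  assumes s: "0 < s" "s < 1" and f: "continuous_on {0..} f"
    and B: "\<And>l. l > 0 \<Longrightarrow> l * norm (f l) \<le> B"
  shows "(\<lambda>l. l powr (- s) *\<^sub>R f l) integrable_on {0<..}"
proof -
  let ?h = "\<lambda>l. l powr (- s) *\<^sub>R f l"
  \<comment> \<open>Extension by zero, since the improper gauge integral is tested on arbitrary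
    intervals, including those reaching below 0.\<close>
  let ?h' = "\<lambda>l. if l \<in> {0<..} then ?h l else 0"
  obtain F where F: "\<And>a b. 0 \<le> a \<Longrightarrow> a \<le> b \<Longrightarrow> (?h has_integral (F b - F a)) {a..b}"
    using has_integral_powr_at_zero[OF s f] by blast
  have B0: "B \<ge> 0" using B[of 1] norm_ge_zero[of "f 1"] by linarith
  have tail: "norm (F b - F a) \<le> B * a powr (- s) / s" if ab: "0 < a" "a \<le> b" for a b
  proof -
    have "((\<lambda>l. B * l powr (- s - 1)) has_integral
        (- (B * b powr (- s) / s) - - (B * a powr (- s) / s))) {a..b}"
    proof (rule fundamental_theorem_of_calculus[OF ab(2)])
      fix l assume "l \<in> {a..b}"
      then have "l > 0" using ab by simp
      then have "((\<lambda>l. - (B * l powr (- s) / s)) has_real_derivative B * l powr (- s - 1)) (at l within {a..b})"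
        using s by (auto intro!: derivative_eq_intros)
      then show "((\<lambda>l. - (B * l powr (- s) / s)) has_vector_derivative B * l powr (- s - 1)) (at l within {a..b})"
        by (simp add: has_real_derivative_iff_has_vector_derivative)
    qed
    moreover have "norm (?h l) \<le> B * l powr (- s - 1)" if "l \<in> {a..b}" for l
    proof -
      have l: "l > 0" using that ab by simp
      have "l powr (- s) = l * l powr (- s - 1)" using l powr_mult_base[of l "-s-1"] by simp
      then have "norm (?h l) = l powr (- s - 1) * (l * norm (f l))" using l by simp
      also have "\<dots> \<le> l powr (- s - 1) * B" by (rule mult_left_mono[OF B[OF l]]) simp
      finally show ?thesis by (simp add: mult.commute)
    qed
    ultimately have "norm (integral {a..b} ?h) \<le> integral {a..b} (\<lambda>l. B * l powr (- s - 1))"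
      using F[of a b] ab by (intro integral_norm_bound_integral) (auto simp: has_integral_iff)
    also have "\<dots> = - (B * b powr (- s) / s) - - (B * a powr (- s) / s)"
      by (rule integral_unique) fact
    also have "\<dots> \<le> B * a powr (- s) / s" using B0 s by simp
    finally show ?thesis using F[of a b] ab by (simp add: has_integral_iff)
  qed
  have small: "\<exists>N::nat. N > 0 \<and> (\<forall>a\<ge>real N. B * a powr (- s) / s < e)" if e: "e > 0" for e
  proof -
    have "((\<lambda>a. B * a powr (- s) / s) \<longlongrightarrow> B * 0 / s) at_top"
      by (intro tendsto_intros tendsto_neg_powr filterlim_ident) (use s in auto)
    then have "\<forall>\<^sub>F a in at_top. B * a powr (- s) / s < e" using e by (simp add: order_tendsto_iff)
    then obtain a0 where a0: "\<And>a. a \<ge> a0 \<Longrightarrow> B * a powr (- s) / s < e"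
      by (auto simp: eventually_at_top_linorder)
    obtain N :: nat where "real N \<ge> max a0 1" using real_arch_simple by blast
    then show ?thesis using a0 by (intro exI[of _ N]) auto
  qed
  have "Cauchy (\<lambda>n. F (real n))"
  proof (rule CauchyI')
    fix e :: real assume "e > 0"
    from small[OF this] obtain N where N: "N > 0" "\<And>a. a \<ge> real N \<Longrightarrow> B * a powr (- s) / s < e" by blast
    have "dist (F (real m)) (F (real n)) < e" if "m \<ge> N" "n > m" for m n
      using tail[of "real m" "real n"] N(1) N(2)[of "real m"] that
      by (simp add: dist_norm norm_minus_commute)
    then show "\<exists>M. \<forall>m\<ge>M. \<forall>n>m. dist (F (real m)) (F (real n)) < e" by blast
  qed
  then obtain L where L: "(\<lambda>n. F (real n)) \<longlonglongrightarrow> L" using Cauchy_convergent_iff convergent_def by blast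
  have tail': "norm (F b - L) \<le> B * b powr (- s) / s" if b: "b > 0" for b
  proof (rule LIMSEQ_le_const2)
    show "(\<lambda>n. norm (F b - F (real n))) \<longlonglongrightarrow> norm (F b - L)" by (intro tendsto_intros L)
    obtain N :: nat where "real N \<ge> b" using real_arch_simple by blast
    then show "\<exists>N. \<forall>n\<ge>N. norm (F b - F (real n)) \<le> B * b powr (- s) / s"
      using tail[OF b] norm_minus_commute[of "F b"] by (intro exI[of _ N]) auto
  qed
  have h': "(?h' has_integral (F b - F 0)) {a..b}" if "a \<le> 0" "0 \<le> b" for a b
  proof -
    have "(?h' has_integral 0) {a..0}" by (rule has_integral_is_0) auto
    moreover have "(?h' has_integral (F b - F 0)) {0..b}"
      by (rule has_integral_eq[OF _ F]) (use that in auto)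
    ultimately show ?thesis
      using has_integral_combine[OF that] by fastforce
  qed
  have "(?h has_integral (L - F 0)) {0<..}"
    unfolding has_integral_alt'
  proof (intro conjI allI impI)
    fix a b :: real
    have "?h' integrable_on {min a 0..max b 0}"
      using h'[of "min a 0" "max b 0"] by (auto simp: integrable_on_def)
    then show "?h' integrable_on cbox a b"
      unfolding cbox_interval by (rule integrable_on_subinterval) auto
  next
    fix e :: real assume "e > 0"
    from small[OF this] obtain N where N: "N > 0" "\<And>a. a \<ge> real N \<Longrightarrow> B * a powr (- s) / s < e" by blast
    show "\<exists>Ba>0. \<forall>a b. ball 0 Ba \<subseteq> cbox a b \<longrightarrow> norm (integral (cbox a b) ?h' - (L - F 0)) < e"
    proof (intro exI conjI allI impI)
      show "0 < 2 * real N" using N by simp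
      fix a b :: real assume sub: "ball 0 (2 * real N) \<subseteq> cbox a b"
      have "real N \<in> ball 0 (2 * real N)" "0 \<in> ball 0 (2 * real N)" using N by auto
      with sub have "real N \<in> cbox a b" "0 \<in> cbox a b" by blast+
      then have ab: "a \<le> 0" "real N \<le> b" by auto
      then have "0 < b" using N by simp
      have "integral {a..b} ?h' = F b - F 0" using h'[of a b] ab \<open>0 < b\<close> by (intro integral_unique) simp
      then have "norm (integral (cbox a b) ?h' - (L - F 0)) = norm (F b - L)" by simp
      also have "\<dots> < e" using tail'[OF \<open>0 < b\<close>] N(2)[OF ab(2)] by linarith
      finally show "norm (integral (cbox a b) ?h' - (L - F 0)) < e" .
    qed
  qed
  then show ?thesis by (auto simp: integrable_on_def)
qed

lemma Gamma_reflection_real: "Gamma s * Gamma (1 - s) = pi / sin (pi * s)" for s :: real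
proof -
  have "complex_of_real (Gamma s * Gamma (1 - s)) = complex_of_real (pi / sin (pi * s))"
    using Gamma_reflection_complex[of "complex_of_real s"]
    by (simp add: Gamma_complex_of_real[symmetric] sin_of_real[symmetric])
  then show ?thesis by (simp only: of_real_eq_iff)
qed

text \<open>The substitution \<open>l = m t / (1 - t)\<close> turns the integral into \<open>Beta (1 - s) s\<close>.\<close>

lemma has_integral_powr_div_add:
  fixes m s :: real
  assumes m: "m > 0" and s: "0 < s" "s < 1"
  shows "((\<lambda>l. l powr (- s) / (l + m)) has_integral (pi / sin (pi * s) * m powr (- s))) {0<..}"
proof -
  define g where "g = (\<lambda>t. m * t / (1 - t))"
  define g' where "g' = (\<lambda>t. m / (1 - t)\<^sup>2)"
  let ?f = "\<lambda>l. l powr (- s) / (l + m)"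
  let ?k = "\<lambda>t. m powr (- s) * (t powr ((1 - s) - 1) * (1 - t) powr (s - 1))"
  have k: "(?k has_integral (m powr (- s) * Beta (1 - s) s)) {0<..<1}"
    using has_integral_mult_right[OF has_integral_Beta_real[of "1 - s" s]] s
    by (simp add: has_integral_Icc_iff_Ioo)
  have eq: "\<bar>g' t\<bar> * ?f (g t) = ?k t" if t: "t \<in> {0<..<1}" for t
  proof -
    have 1: "1 - t > 0" "t > 0" using t by auto
    have "g t + m = m / (1 - t)" using 1 by (simp add: g_def field_simps)
    moreover have "(g t) powr (- s) = m powr (- s) * t powr (- s) * (1 - t) powr s"
      using 1 m by (simp add: g_def powr_divide powr_mult powr_minus_divide)
    moreover have "(1 - t) powr s = (1 - t) * (1 - t) powr (s - 1)"
      using 1 powr_mult_base[of "1 - t" "s - 1"] by simp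
    ultimately show ?thesis
      using 1 m by (simp add: g'_def power2_eq_square)
  qed
  have "(\<lambda>t. \<bar>g' t\<bar> * ?f (g t)) absolutely_integrable_on {0<..<1} \<and>
      integral {0<..<1} (\<lambda>t. \<bar>g' t\<bar> * ?f (g t)) = m powr (- s) * Beta (1 - s) s"
  proof
    have k': "((\<lambda>t. \<bar>g' t\<bar> * ?f (g t)) has_integral (m powr (- s) * Beta (1 - s) s)) {0<..<1}"
      by (rule has_integral_eq[OF _ k]) (use eq in simp)
    then show "integral {0<..<1} (\<lambda>t. \<bar>g' t\<bar> * ?f (g t)) = m powr (- s) * Beta (1 - s) s"
      by (rule integral_unique)
    show "(\<lambda>t. \<bar>g' t\<bar> * ?f (g t)) absolutely_integrable_on {0<..<1}"
    proof (rule nonnegative_absolutely_integrable_1)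
      show "(\<lambda>t. \<bar>g' t\<bar> * ?f (g t)) integrable_on {0<..<1}" using k' by (auto simp: integrable_on_def)
      show "0 \<le> \<bar>g' t\<bar> * ?f (g t)" if "t \<in> {0<..<1}" for t using eq[OF that] by simp
    qed
  qed
  moreover have "(g has_field_derivative g' t) (at t within {0<..<1})" if "t \<in> {0<..<1}" for t
    unfolding g_def g'_def using that
    by (auto intro!: derivative_eq_intros simp: power2_eq_square field_simps)
  moreover have "inj_on g {0<..<1}"
    unfolding g_def using m by (intro inj_onI) (simp add: field_simps)
  ultimately have "?f absolutely_integrable_on (g ` {0<..<1}) \<and>
      integral (g ` {0<..<1}) ?f = m powr (- s) * Beta (1 - s) s"
    by (intro iffD1[OF has_absolute_integral_change_of_variables_1'[of "{0<..<1}" g g']]) simp_all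
  moreover have "g ` {0<..<1} = {0<..}"
  proof (intro equalityI subsetI)
    fix l :: real assume "l \<in> {0<..}"
    then have l: "l + m > 0" "l > 0" using m by auto
    have "1 - l / (l + m) = m / (l + m)" using l by (simp add: field_simps)
    then have "l = g (l / (l + m))" using l m by (simp add: g_def)
    moreover have "l / (l + m) \<in> {0<..<1}" using l m by simp
    ultimately show "l \<in> g ` {0<..<1}" by blast
  qed (use m in \<open>auto simp: g_def\<close>)
  ultimately have "(?f has_integral (m powr (- s) * Beta (1 - s) s)) {0<..}"
    using set_lebesgue_integral_eq_integral(1) has_integral_integral by metis
  moreover have "Beta (1 - s) s = pi / sin (pi * s)"
    using Gamma_reflection_real[of s] by (simp add: Beta_def mult.commute)
  ultimately show ?thesis by (simp add: mult.commute)
qed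

section \<open>Fractional powers: linearity, injectivity, action on eigenvectors\<close>

context coercive_self_adjoint
begin

lemma resolvent_integrable:
  assumes "0 < s" "s < 1"
  shows "(\<lambda>l. l powr (- s) *\<^sub>R R l x) integrable_on {0<..}"
proof (rule integrable_powr_half_line[OF assms R_continuous])
  show "l * norm (R l x) \<le> norm x" if "l > 0" for l
    using R_bound[of l x] that c_pos mult_right_mono[of l "c + l" "norm (R l x)"] by simp
qed

lemma balakrishnan_add:
  assumes "0 < s" "s < 1"
  shows "balakrishnan A s (x + y) = balakrishnan A s x + balakrishnan A s y"
proof -
  have "integral {0<..} (\<lambda>l. l powr (- s) *\<^sub>R R l (x + y)) =
      integral {0<..} (\<lambda>l. l powr (- s) *\<^sub>R R l x + l powr (- s) *\<^sub>R R l y)"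
    by (rule integral_cong) (simp add: R_add scaleR_add_right)
  then show ?thesis
    using integral_add[OF resolvent_integrable[OF assms] resolvent_integrable[OF assms], of x y]
    by (simp add: balakrishnan_def scaleR_add_right)
qed

lemma balakrishnan_scaleC:
  assumes "0 < s" "s < 1"
  shows "balakrishnan A s (z *\<^sub>C x) = z *\<^sub>C balakrishnan A s x"
proof -
  have "integral {0<..} (\<lambda>l. l powr (- s) *\<^sub>R R l (z *\<^sub>C x)) =
      integral {0<..} ((\<lambda>u. z *\<^sub>C u) \<circ> (\<lambda>l. l powr (- s) *\<^sub>R R l x))"
    by (rule integral_cong)
      (simp add: R_scaleC scaleR_conv_scaleC scaleC_scaleC mult.commute)
  then show ?thesis
    using integral_linear[OF resolvent_integrable[OF assms, of x] bounded_linear_scaleC_right[of z]]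
    by (simp add: balakrishnan_def scaleR_conv_scaleC scaleC_scaleC mult.commute)
qed

text \<open>Pairing the vanishing integral with \<open>x\<close> gives a non-negative continuous
  integrand of integral zero. It vanishes at \<open>l = 1\<close>, where coercivity yields
  \<open>R 1 x = 0\<close>.\<close>

lemma balakrishnan_eq_0:
  assumes s: "0 < s" "s < 1" and 0: "balakrishnan A s x = 0"
  shows "x = 0"
proof -
  let ?h = "\<lambda>l. l powr (- s) *\<^sub>R R l x"
  let ?q = "\<lambda>l. inner (?h l) x"
  have "sin (pi * s) > 0" using s by (intro sin_gt_zero) auto
  then have int0: "integral {0<..} ?h = 0" using 0 by (simp add: balakrishnan_def)
  have q: "(?q has_integral 0) {0<..}"
    using has_integral_linear[OF integrable_integral[OF resolvent_integrable[OF s, of x]]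
        bounded_linear_inner_left[of x]] int0 by (simp add: o_def)
  have q_cont: "continuous_on (cbox 1 2) ?q"
    using continuous_on_subset[OF R_continuous, of "cbox 1 2" x]
    by (auto intro!: continuous_intros)
  have q_nonneg: "0 \<le> ?q l" if "l > 0" for l
    using R_coercive[of l x] that c_pos by (simp add: order_trans[rotated])
  \<comment> \<open>The interval is merely a compact piece away from the singularity at 0, on which
    a continuous integrand with zero integral must vanish pointwise.\<close>
  have "integral (cbox 1 2) ?q \<le> integral {0<..} ?q"
    using q by (intro integral_subset_le integrable_continuous q_cont)
      (auto simp: integrable_on_def intro!: q_nonneg simp del: inner_scaleR_left)
  also have "\<dots> = 0" using q by (rule integral_unique)
  finally have "integral (cbox 1 2) ?q = 0"
    using integral_nonneg[OF integrable_continuous[OF q_cont]] q_nonneg by fastforce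
  then have "(?q has_integral 0) (cbox 1 2)"
    using integrable_integral[OF integrable_continuous[OF q_cont]] by simp
  then have "?q 1 = 0"
    by (rule has_integral_0_cbox_imp_0[OF q_cont, rotated, of 1]) (use q_nonneg in auto)
  then have "c * (norm (R 1 x))\<^sup>2 \<le> 0" using R_coercive[of 1 x] by simp
  then have "R 1 x = 0" using c_pos by (simp add: mult_le_0_iff)
  then show ?thesis using R_inj[of 1] by simp
qed

lemma eigenvector_in_graph: "(e, m *\<^sub>R e) \<in> A \<Longrightarrow> (z *\<^sub>C e, m *\<^sub>R z *\<^sub>C e) \<in> A"
  using A_scaleC[of e "m *\<^sub>R e" z] by (simp add: scaleR_conv_scaleC scaleC_scaleC mult.commute)

lemma R_eigenvector:
  assumes "(e, m *\<^sub>R e) \<in> A" "m > 0" "l \<ge> 0"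
  shows "R l e = (1 / (l + m)) *\<^sub>R e"
proof (rule R_eqI[OF _ assms(3)])
  have "e - l *\<^sub>R (1 / (l + m)) *\<^sub>R e = (1 - l / (l + m)) *\<^sub>R e"
    by (simp add: scaleR_diff_left)
  also have "1 - l / (l + m) = m / (l + m)" using assms by (simp add: field_simps)
  finally show "((1 / (l + m)) *\<^sub>R e, e - l *\<^sub>R (1 / (l + m)) *\<^sub>R e) \<in> A"
    using eigenvector_in_graph[OF assms(1), of "complex_of_real (1 / (l + m))"]
    by (simp add: scaleC_of_real del: of_real_divide)
qed

text \<open>The resolvent acts as the scalar \<open>1 / (l + m)\<close>, and the value of the scalar
  integral cancels the normalising factor \<open>sin (pi * s) / pi\<close>.\<close>

lemma balakrishnan_eigenvector:
  assumes e: "(e, m *\<^sub>R e) \<in> A" and m: "m > 0" and s: "0 < s" "s < 1"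
  shows "balakrishnan A s e = m powr (- s) *\<^sub>R e"
proof -
  have "((\<lambda>l. l powr (- s) *\<^sub>R R l e) has_integral (pi / sin (pi * s) * m powr (- s)) *\<^sub>R e) {0<..}"
    by (rule has_integral_eq[OF _ has_integral_scaleR_left[OF has_integral_powr_div_add[OF m s]]])
      (simp add: R_eigenvector[OF e m])
  moreover have "sin (pi * s) > 0" using s by (intro sin_gt_zero) auto
  ultimately show ?thesis by (simp add: balakrishnan_def integral_unique)
qed

lemma frac_cases: "frac s = 0 \<or> (0 < frac s \<and> frac s < (1::real))"
  using frac_ge_0[of s] frac_lt_1[of s] by linarith

lemma R0_funpow_add: "(R 0 ^^ n) (x + y) = (R 0 ^^ n) x + (R 0 ^^ n) y"
  by (induction n) (simp_all add: R_add)

lemma R0_funpow_scaleC: "(R 0 ^^ n) (z *\<^sub>C x) = z *\<^sub>C (R 0 ^^ n) x"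
  by (induction n) (simp_all add: R_scaleC)

lemma R0_funpow_eq_0: "(R 0 ^^ n) x = 0 \<Longrightarrow> x = 0"
  by (induction n) (auto dest: R_inj[rotated])

lemma neg_power_add: "neg_power A s (x + y) = neg_power A s x + neg_power A s y"
  using frac_cases[of s] by (auto simp: neg_power_def R0_funpow_add balakrishnan_add)

lemma neg_power_scaleC: "neg_power A s (z *\<^sub>C x) = z *\<^sub>C neg_power A s x"
  using frac_cases[of s] by (auto simp: neg_power_def R0_funpow_scaleC balakrishnan_scaleC)

lemma neg_power_eq_0: "neg_power A s x = 0 \<Longrightarrow> x = 0"
  using frac_cases[of s]
  by (auto simp: neg_power_def split: if_splits dest!: R0_funpow_eq_0 balakrishnan_eq_0[rotated 2])

text \<open>Makes \<open>inv (neg_power A s)\<close> a left inverse, and lets an equation stated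
  after applying \<open>neg_power A 2\<close> determine its unknown.\<close>

lemma neg_power_inj: "inj (neg_power A s)"
proof (rule injI)
  fix x y assume "neg_power A s x = neg_power A s y"
  then have "neg_power A s (x + (- 1) *\<^sub>C y) = 0"
    by (simp only: neg_power_add neg_power_scaleC) (simp add: scaleC_minus_left)
  from neg_power_eq_0[OF this] show "x = y" by (simp add: scaleC_minus_left)
qed

lemma neg_power_eigenvector:
  assumes e: "(e, m *\<^sub>R e) \<in> A" and m: "m > 0" and s: "s \<ge> 0"
  shows "neg_power A s (z *\<^sub>C e) = (z * complex_of_real (m powr (- s))) *\<^sub>C e"
proof -
  have pow: "(R 0 ^^ n) e = (1 / m ^ n) *\<^sub>R e" for n
  proof (induction n)
    case (Suc n)
    have "R 0 (complex_of_real (1 / m ^ n) *\<^sub>C e) = complex_of_real (1 / m ^ n) *\<^sub>C R 0 e"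
      by (simp only: R_scaleC)
    then show ?case using Suc R_eigenvector[OF e m, of 0]
      by (simp add: scaleC_of_real[symmetric] scaleC_scaleC mult.commute del: of_real_divide of_real_power)
        (simp add: mult.commute)
  qed simp
  define n where "n = nat \<lfloor>s\<rfloor>"
  have sn: "s = real n + frac s" using s by (simp add: n_def frac_def)
  have "(if frac s = 0 then e else balakrishnan A (frac s) e) = m powr (- frac s) *\<^sub>R e"
  proof (cases "frac s = 0")
    case True
    then show ?thesis using m by (simp only: True) simp
  next
    case False
    then show ?thesis using frac_cases[of s] balakrishnan_eigenvector[OF e m, of "frac s"] by simp
  qed
  then have "neg_power A s e = (R 0 ^^ n) (complex_of_real (m powr (- frac s)) *\<^sub>C e)"
    by (simp add: neg_power_def n_def scaleC_of_real)
  also have "\<dots> = complex_of_real (m powr (- frac s) / m ^ n) *\<^sub>C e"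
    by (simp add: R0_funpow_scaleC pow scaleR_conv_scaleC scaleC_scaleC)
  also have "m powr (- frac s) / m ^ n = m powr (- s)"
    proof -
    have "- s = - frac s - real n" using sn by simp
    then show ?thesis using m powr_diff[of m "- frac s" "real n"] by (simp only: powr_realpow)
  qed
  finally show ?thesis by (simp add: neg_power_scaleC scaleC_scaleC)
qed

end

section \<open>Roots of the characteristic polynomial\<close>

text \<open>The logarithmic derivative \<open>p' / p\<close> is the sum of \<open>1 / (z - r)\<close> over the roots \<open>r\<close>.\<close>

lemma root_near_point:
  fixes p :: "complex poly"
  assumes "degree p > 0"
  shows "\<exists>r. poly p r = 0 \<and> cmod (r - z) * cmod (poly (pderiv p) z) \<le> degree p * cmod (poly p z)"
  using assms
proof (induction "degree p" arbitrary: p)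
  case (Suc n)
  have "\<not> constant (poly p)" using Suc.prems by (simp add: constant_degree)
  then obtain c where c: "poly p c = 0" using fundamental_theorem_of_algebra by blast
  then obtain q where q: "p = [:- c, 1:] * q" using poly_eq_0_iff_dvd by blast
  have "q \<noteq> 0" using Suc.prems q by auto
  then have deg: "degree q = n" using Suc(2) degree_mult_eq[of "[:- c, 1:]" q] q by simp
  let ?q = "cmod (poly q z)" and ?q' = "cmod (poly (pderiv q) z)"
  have P: "cmod (poly p z) = cmod (c - z) * ?q"
    unfolding q norm_minus_commute[of c] norm_mult[symmetric] by (simp add: algebra_simps)
  have "poly (pderiv p) z = poly q z + (z - c) * poly (pderiv q) z"
    unfolding q pderiv_mult by (simp add: pderiv_pCons algebra_simps)
  then have P': "cmod (poly (pderiv p) z) \<le> ?q + cmod (c - z) * ?q'"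
    using norm_triangle_ineq[of "poly q z" "(z - c) * poly (pderiv q) z"]
    by (simp add: norm_mult norm_minus_commute)
  show ?case
  proof (cases "n = 0")
    case True
    then have "?q' = 0" using deg pderiv_eq_0_iff[of q] by simp
    then have "cmod (c - z) * cmod (poly (pderiv p) z) \<le> cmod (poly p z)"
      using P P' by (simp add: mult_left_mono)
    moreover have "degree p = 1" using Suc(2) True by simp
    ultimately show ?thesis using c by (intro exI[of _ c]) simp
  next
    case False
    from Suc(1)[of q] deg False obtain r where r: "poly q r = 0"
      and r_le: "cmod (r - z) * ?q' \<le> n * ?q" by auto
    \<comment> \<open>One root \<open>c\<close> is split off and the quotient supplies another,
      \<open>r\<close>; the nearer of the two works. Keeping the estimate free of division covers
      the cases where \<open>p\<close> or its derivative vanishes at \<open>z\<close>.\<close>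
    define d where "d = min (cmod (c - z)) (cmod (r - z))"
    have d: "0 \<le> d" "d \<le> cmod (c - z)" "d \<le> cmod (r - z)" by (simp_all add: d_def)
    have "d * cmod (poly (pderiv p) z) \<le> d * ?q + cmod (c - z) * (d * ?q')"
      using mult_left_mono[OF P' d(1)] by (simp add: algebra_simps)
    also have "\<dots> \<le> cmod (c - z) * ?q + cmod (c - z) * (n * ?q)"
      using d r_le by (intro add_mono mult_right_mono mult_left_mono)
        (auto intro: order_trans[OF mult_right_mono])
    also have "\<dots> = Suc n * cmod (poly p z)" using P by (simp add: algebra_simps)
    finally have "d * cmod (poly (pderiv p) z) \<le> degree p * cmod (poly p z)" using Suc(2) by simp
    moreover have "d = cmod (c - z) \<or> d = cmod (r - z)" by (auto simp: d_def)
    ultimately show ?thesis using c r q by auto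
  qed
qed simp

text \<open>Restricted to an eigenspace of \<open>A\<close> for the eigenvalue \<open>m\<close>, the system operator is a
  \<open>4 \<times> 4\<close> matrix whose characteristic polynomial is \<open>char_fun\<close>, where \<open>g = a m\<^sup>\<gamma>\<close>,
  \<open>\<kappa> = k m\<^sup>\<beta>\<close> and \<open>B = b\<^sup>2 m\<^sup>2\<^sup>\<alpha>\<close>.\<close>

definition char_fun :: "real \<Rightarrow> real \<Rightarrow> real \<Rightarrow> real \<Rightarrow> complex \<Rightarrow> complex" where
  "char_fun g m \<kappa> B z = (z\<^sup>2 + of_real g) * (z\<^sup>2 + of_real \<kappa> * z + of_real m) + of_real B * z\<^sup>2"

definition char_deriv :: "real \<Rightarrow> real \<Rightarrow> real \<Rightarrow> real \<Rightarrow> complex \<Rightarrow> complex" where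
  "char_deriv g m \<kappa> B z = 2 * z * (z\<^sup>2 + of_real \<kappa> * z + of_real m)
     + (z\<^sup>2 + of_real g) * (2 * z + of_real \<kappa>) + 2 * of_real B * z"

lemma char_fun_root_near:
  "\<exists>r. char_fun g m \<kappa> B r = 0 \<and>
    cmod (r - z) * cmod (char_deriv g m \<kappa> B z) \<le> 4 * cmod (char_fun g m \<kappa> B z)"
proof -
  define p :: "complex poly" where
    "p = [:of_real (g * m), of_real (g * \<kappa>), of_real (m + g + B), of_real \<kappa>, 1:]"
  have "poly p z = char_fun g m \<kappa> B z" for z
    by (simp add: p_def char_fun_def algebra_simps power2_eq_square)
  moreover have "poly (pderiv p) z = char_deriv g m \<kappa> B z" for z
    by (simp add: p_def char_deriv_def pderiv_pCons algebra_simps power2_eq_square)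
  moreover have "degree p = 4" by (simp add: p_def)
  ultimately show ?thesis using root_near_point[of p z] by simp
qed

text \<open>A Cauchy bound, one plus the sum of the lower coefficients: for
  \<open>cmod z > 1\<close> the equation is divided by the cube of the modulus. Only polynomial
  growth in \<open>m\<close> matters later.\<close>

lemma char_root_bound:
  assumes "char_fun g m \<kappa> B z = 0" "g \<ge> 0" "m \<ge> 0" "\<kappa> \<ge> 0" "B \<ge> 0"
  shows "cmod z \<le> 1 + \<kappa> + (m + g + B) + g * \<kappa> + g * m"
proof (cases "cmod z \<le> 1")
  case True
  then show ?thesis using assms by (smt (verit) mult_nonneg_nonneg)
next
  case False
  let ?r = "cmod z"
  have r: "?r > 1" using False by simp
  have "z ^ 4 = - (of_real \<kappa> * z ^ 3 + of_real (m + g + B) * z\<^sup>2 + of_real (g * \<kappa>) * z + of_real (g * m))"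
    using assms(1) unfolding char_fun_def by (simp add: algebra_simps eval_nat_numeral) algebra
  then have "?r ^ 4 = cmod (of_real \<kappa> * z ^ 3 + of_real (m + g + B) * z\<^sup>2 + of_real (g * \<kappa>) * z + of_real (g * m))"
    by (metis norm_minus_cancel norm_power)
  also have "\<dots> \<le> cmod (of_real \<kappa> * z ^ 3) + cmod (of_real (m + g + B) * z\<^sup>2)
      + cmod (of_real (g * \<kappa>) * z) + cmod (complex_of_real (g * m))"
    by (intro norm_triangle_le add_mono order_refl)
  also have "\<dots> = \<kappa> * ?r ^ 3 + (m + g + B) * ?r\<^sup>2 + (g * \<kappa>) * ?r + g * m"
    using assms by (simp only: norm_mult norm_power norm_of_real) simp
  also have "\<dots> \<le> \<kappa> * ?r ^ 3 + (m + g + B) * ?r ^ 3 + (g * \<kappa>) * ?r ^ 3 + (g * m) * ?r ^ 3"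
  proof -
    have "?r\<^sup>2 \<le> ?r ^ 3" "?r \<le> ?r ^ 3" "1 \<le> ?r ^ 3"
      using r power_increasing[of 2 3 ?r] power_increasing[of 1 3 ?r] one_le_power[of ?r 3] by auto
    moreover have "0 \<le> g * m" "0 \<le> g * \<kappa>" using assms by simp_all
    ultimately show ?thesis using assms mult_left_mono[of 1 "?r ^ 3" "g * m"]
      by (intro add_mono mult_left_mono) simp_all
  qed
  finally have "?r * ?r ^ 3 \<le> (\<kappa> + (m + g + B) + g * \<kappa> + g * m) * ?r ^ 3"
    by (simp add: algebra_simps eval_nat_numeral)
  then have "?r \<le> \<kappa> + (m + g + B) + g * \<kappa> + g * m"
    using r by (subst (asm) mult_le_cancel_right) auto
  then show ?thesis by simp
qed

text \<open>At \<open>\<i> * sqrt g\<close> the first factor vanishes and only the coupling term, of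
  modulus \<open>B * g\<close>, is left. The derivative is at least \<open>2 * g * \<kappa>\<close>
  because damping contributes the imaginary part of \<open>?w\<close>, which a cancellation between
  \<open>m + B\<close> and \<open>g\<close> cannot affect.\<close>

lemma char_root_near_damped:
  assumes "g > 0" "\<kappa> > 0" "B > 0"
  shows "\<exists>r. char_fun g m \<kappa> B r = 0 \<and> cmod (r - \<i> * of_real (sqrt g)) \<le> 2 * B / \<kappa>"
proof -
  let ?z = "\<i> * complex_of_real (sqrt g)"
  have z2: "?z\<^sup>2 = - of_real g"
    using assms by (simp add: power_mult_distrib of_real_power[symmetric] del: of_real_power)
  obtain r where r: "char_fun g m \<kappa> B r = 0"
    and le: "cmod (r - ?z) * cmod (char_deriv g m \<kappa> B ?z) \<le> 4 * cmod (char_fun g m \<kappa> B ?z)"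
    using char_fun_root_near by blast
  have 1: "cmod (char_fun g m \<kappa> B ?z) = B * g"
    unfolding char_fun_def z2 using assms by (simp add: norm_mult)
  let ?w = "of_real (m + B - g) + \<i> * complex_of_real (\<kappa> * sqrt g)"
  have "char_deriv g m \<kappa> B ?z = 2 * ?z * ?w"
    unfolding char_deriv_def z2 by (simp add: algebra_simps)
  moreover have "\<kappa> * sqrt g \<le> cmod ?w" using abs_Im_le_cmod[of ?w] assms by simp
  ultimately have le2: "2 * sqrt g * (\<kappa> * sqrt g) \<le> cmod (char_deriv g m \<kappa> B ?z)"
    using assms by (simp add: norm_mult mult_left_mono)
  have 2: "2 * g * \<kappa> \<le> cmod (char_deriv g m \<kappa> B ?z)"
  proof -
    have "2 * sqrt g * (\<kappa> * sqrt g) = 2 * (sqrt g * sqrt g) * \<kappa>" by (simp only: mult_ac)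
    also have "\<dots> = 2 * g * \<kappa>" using assms by simp
    finally show ?thesis using le2 by (simp only:)
  qed
  have "cmod (r - ?z) * (2 * g * \<kappa>) \<le> 4 * (B * g)"
    using order_trans[OF mult_left_mono[OF 2] le] 1 by simp
  then have "(2 * g) * (cmod (r - ?z) * \<kappa>) \<le> (2 * g) * (2 * B)" by (simp add: mult_ac)
  then have "cmod (r - ?z) * \<kappa> \<le> 2 * B" using assms by (subst (asm) mult_le_cancel_left) auto
  then show ?thesis using r assms by (auto simp: pos_le_divide_eq)
qed

text \<open>Here \<open>\<i> * sqrt X\<close> is a frequency of the undamped system \<open>\<kappa> = 0\<close>.\<close>

lemma char_root_near_undamped:
  assumes "X > 0" "\<kappa> > 0" and X: "X\<^sup>2 - (m + g + B) * X + g * m = 0"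
  shows "\<exists>r. char_fun g m \<kappa> B r = 0 \<and>
    cmod (r - \<i> * of_real (sqrt X)) * \<bar>m + g + B - 2 * X\<bar> \<le> 2 * \<kappa> * \<bar>g - X\<bar>"
proof -
  let ?s = "sqrt X"
  let ?z = "\<i> * complex_of_real ?s"
  have z2: "?z\<^sup>2 = - of_real X"
    using assms by (simp add: power_mult_distrib of_real_power[symmetric] del: of_real_power)
  obtain r where r: "char_fun g m \<kappa> B r = 0"
    and le: "cmod (r - ?z) * cmod (char_deriv g m \<kappa> B ?z) \<le> 4 * cmod (char_fun g m \<kappa> B ?z)"
    using char_fun_root_near by blast
  \<comment> \<open>The undamped part is the quadratic of which \<open>X\<close> is a root, so only
    the damping term survives.\<close>
  have "char_fun g m \<kappa> B ?z = of_real (X\<^sup>2 - (m + g + B) * X + g * m) + of_real (\<kappa> * (g - X)) * ?z"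
    unfolding char_fun_def z2 by (simp add: algebra_simps power2_eq_square)
  then have 1: "cmod (char_fun g m \<kappa> B ?z) = \<kappa> * \<bar>g - X\<bar> * ?s"
    using assms by (simp add: X norm_mult abs_mult flip: of_real_diff)
  have "char_deriv g m \<kappa> B ?z =
      of_real (\<kappa> * (g - 3 * X)) + \<i> * of_real (2 * ?s * (m + g + B - 2 * X))"
  proof -
    have "?z * ?z = - of_real X" using z2 by (simp add: power2_eq_square)
    then show ?thesis unfolding char_deriv_def z2 by (simp add: algebra_simps)
  qed
  \<comment> \<open>Keeping only the imaginary part of the derivative retains the gap:
    \<open>m + g + B - 2 * X\<close> is the other squared frequency minus \<open>X\<close>.\<close>
  then have 2: "2 * ?s * \<bar>m + g + B - 2 * X\<bar> \<le> cmod (char_deriv g m \<kappa> B ?z)"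
    using abs_Im_le_cmod[of "char_deriv g m \<kappa> B ?z"] assms by (simp add: abs_mult)
  have "cmod (r - ?z) * (2 * ?s * \<bar>m + g + B - 2 * X\<bar>) \<le> 4 * (\<kappa> * \<bar>g - X\<bar> * ?s)"
    using order_trans[OF mult_left_mono[OF 2] le] 1 by simp
  then have "(2 * ?s) * (cmod (r - ?z) * \<bar>m + g + B - 2 * X\<bar>) \<le> (2 * ?s) * (2 * \<kappa> * \<bar>g - X\<bar>)"
    by (simp add: mult_ac)
  then show ?thesis using r assms by (auto simp: mult_le_cancel_left)
qed

text \<open>With \<open>\<kappa> = 0\<close> the quartic is quadratic in \<open>z\<^sup>2\<close>;
  \<open>X\<close> and \<open>Y\<close> are the negatives of its roots. They enclose both uncoupled
  squared frequencies \<open>g\<close> and \<open>m\<close>: coupling pushes the frequencies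
  apart.\<close>

lemma undamped_frequencies:
  assumes "g > 0" "m > 0" "B > 0"
  obtains X Y :: real where "0 < X" "X \<le> g" "X \<le> m" "g \<le> Y" "m \<le> Y" "X + Y = m + g + B"
    "X * Y = g * m" "B \<le> Y - X" "\<bar>g - m\<bar> \<le> Y - X"
    "X\<^sup>2 - (m + g + B) * X + g * m = 0" "Y\<^sup>2 - (m + g + B) * Y + g * m = 0"
    "(Y - g) * (Y - m) = B * Y" "(g - X) * (m - X) = B * X"
proof -
  define S where "S = m + g + B"
  define D where "D = sqrt (S\<^sup>2 - 4 * (g * m))"
  define X where "X = (S - D) / 2"
  define Y where "Y = (S + D) / 2"
  have gm: "g * m > 0" using assms by simp
  \<comment> \<open>A sum of non-negative terms: this shows at once that the roots are real and that
    the gap is at least \<open>B\<close> and at least \<open>\<bar>g - m\<bar>\<close>.\<close>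
  have d1: "S\<^sup>2 - 4 * (g * m) = (g - m)\<^sup>2 + (B\<^sup>2 + 2 * B * (g + m))"
    by (simp add: S_def power2_eq_square algebra_simps)
  have pos: "0 \<le> 2 * B * (g + m)" using assms by simp
  have D2: "D\<^sup>2 = S\<^sup>2 - 4 * (g * m)" using d1 pos by (simp add: D_def)
  have D0: "D \<ge> 0" by (simp add: D_def d1 pos)
  have sum: "X + Y = S" and diff: "Y - X = D" by (simp_all add: X_def Y_def field_simps)
  have prod: "X * Y = g * m"
  proof -
    have "X * Y = (S\<^sup>2 - D\<^sup>2) / 4" by (simp add: X_def Y_def power2_eq_square field_simps)
    then show ?thesis using D2 by simp
  qed
  have B: "B \<le> D" by (rule power2_le_imp_le[OF _ D0]) (use D2 d1 pos in simp)
  have gm_le: "\<bar>g - m\<bar> \<le> D" by (rule power2_le_imp_le[OF _ D0]) (use D2 d1 pos in simp)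
  have Y0: "Y > 0" using D0 assms by (simp add: Y_def S_def)
  have X0: "X > 0" using prod gm Y0 by (metis zero_less_mult_pos2)
  have XY: "X < Y" using diff B assms by simp
  have sep: "X \<le> h \<and> h \<le> Y" if "(h - X) * (Y - h) \<ge> 0" for h
    using that XY by (smt (verit) mult_neg_pos mult_pos_neg)
  have "(g - X) * (Y - g) = g * (X + Y) - X * Y - g * g" by (simp add: algebra_simps)
  also have "\<dots> = g * B" by (simp add: sum prod) (simp add: S_def algebra_simps)
  finally have g: "X \<le> g \<and> g \<le> Y" using assms by (intro sep) simp
  have "(m - X) * (Y - m) = m * (X + Y) - X * Y - m * m" by (simp add: algebra_simps)
  also have "\<dots> = m * B" by (simp add: sum prod) (simp add: S_def algebra_simps)
  finally have m: "X \<le> m \<and> m \<le> Y" using assms by (intro sep) simp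
  have qX: "X\<^sup>2 - (m + g + B) * X + g * m = 0"
    using sum prod unfolding S_def[symmetric] by (simp add: power2_eq_square algebra_simps flip: sum prod)
  have qY: "Y\<^sup>2 - (m + g + B) * Y + g * m = 0"
    using sum prod unfolding S_def[symmetric] by (simp add: power2_eq_square algebra_simps flip: sum prod)
  show thesis
  proof (rule that[of X Y])
    show "(Y - g) * (Y - m) = B * Y" using qY by (simp add: power2_eq_square algebra_simps)
    show "(g - X) * (m - X) = B * X" using qX by (simp add: power2_eq_square algebra_simps)
  qed (use X0 g m sum prod diff B gm_le qX qY in \<open>simp_all add: S_def\<close>)
qed

text \<open>Since \<open>g\<close> lies between \<open>X\<close> and \<open>Y\<close>, the distance
  \<open>\<bar>g - Y\<bar>\<close> is at most the gap \<open>Y - X\<close>, so the displacement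
  quotient is at most \<open>2 * \<kappa>\<close> whatever the relative sizes of the parameters. The
  larger frequency is at least the mean of the two.\<close>

lemma char_root_high:
  assumes "g > 0" "m > 0" "\<kappa> > 0" "B > 0"
  shows "\<exists>r \<omega>. char_fun g m \<kappa> B r = 0 \<and> (m + g + B) / 2 \<le> \<omega>\<^sup>2 \<and> \<omega> \<ge> 0 \<and>
    cmod (r - \<i> * of_real \<omega>) \<le> 2 * \<kappa>"
proof -
  obtain X Y where XY: "0 < X" "X \<le> g" "g \<le> Y" "X + Y = m + g + B" "B \<le> Y - X"
      "Y\<^sup>2 - (m + g + B) * Y + g * m = 0"
    using undamped_frequencies[of g m B] assms by metis
  have Y0: "Y > 0" using XY assms by simp
  obtain r where r: "char_fun g m \<kappa> B r = 0"
    and le: "cmod (r - \<i> * of_real (sqrt Y)) * \<bar>m + g + B - 2 * Y\<bar> \<le> 2 * \<kappa> * \<bar>g - Y\<bar>"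
    using char_root_near_undamped[OF Y0 assms(3) XY(6)] by blast
  have "\<bar>m + g + B - 2 * Y\<bar> = Y - X" using XY assms by simp
  moreover have "2 * \<kappa> * \<bar>g - Y\<bar> \<le> 2 * \<kappa> * (Y - X)" using XY assms by (intro mult_left_mono) auto
  ultimately have "cmod (r - \<i> * of_real (sqrt Y)) * (Y - X) \<le> 2 * \<kappa> * (Y - X)" using le by simp
  then have "cmod (r - \<i> * of_real (sqrt Y)) \<le> 2 * \<kappa>"
    using XY assms by (subst (asm) mult_le_cancel_right) auto
  then show ?thesis using r XY Y0 assms by (intro exI[of _ r] exI[of _ "sqrt Y"]) auto
qed

text \<open>Here \<open>\<bar>g - X\<bar>\<close> is bounded by \<open>g\<close> and the gap by
  \<open>B\<close>; the lower bound for the frequency is \<open>X = g * m / Y\<close> with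
  \<open>Y\<close> at most the sum of the roots.\<close>

lemma char_root_low:
  assumes "g > 0" "m > 0" "\<kappa> > 0" "B > 0"
  shows "\<exists>r \<omega>. char_fun g m \<kappa> B r = 0 \<and> g * m / (m + g + B) \<le> \<omega>\<^sup>2 \<and> \<omega> \<ge> 0 \<and>
    cmod (r - \<i> * of_real \<omega>) \<le> 2 * \<kappa> * g / B"
proof -
  obtain X Y where XY: "0 < X" "X \<le> g" "g \<le> Y" "X + Y = m + g + B" "B \<le> Y - X"
      "X\<^sup>2 - (m + g + B) * X + g * m = 0" "X * Y = g * m"
    using undamped_frequencies[of g m B] assms by metis
  obtain r where r: "char_fun g m \<kappa> B r = 0"
    and le: "cmod (r - \<i> * of_real (sqrt X)) * \<bar>m + g + B - 2 * X\<bar> \<le> 2 * \<kappa> * \<bar>g - X\<bar>"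
    using char_root_near_undamped[OF XY(1) assms(3) XY(6)] by blast
  have "\<bar>m + g + B - 2 * X\<bar> = Y - X" using XY assms by simp
  then have "cmod (r - \<i> * of_real (sqrt X)) * B \<le> 2 * \<kappa> * \<bar>g - X\<bar>"
    using le mult_left_mono[OF XY(5), of "cmod (r - \<i> * of_real (sqrt X))"] by simp
  also have "\<dots> \<le> 2 * \<kappa> * g" using XY assms by (intro mult_left_mono) auto
  finally have "cmod (r - \<i> * of_real (sqrt X)) \<le> 2 * \<kappa> * g / B" using assms by (simp add: pos_le_divide_eq)
  moreover have "g * m \<le> X * (m + g + B)" using XY assms
    by (metis less_eq_real_def less_add_same_cancel2 mult_left_mono)
  then have "g * m / (m + g + B) \<le> X" using assms by (simp add: pos_divide_le_eq)
  ultimately show ?thesis using r XY assms by (intro exI[of _ r] exI[of _ "sqrt X"]) auto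
qed

text \<open>One factor \<open>1 - \<theta>\<close> comes from the gap, at least
  \<open>(1 - \<theta>) * g\<close>, the other from \<open>(Y - g) * (Y - m) = B * Y\<close>, which
  confines \<open>Y - g\<close> to \<open>B / (1 - \<theta>)\<close>.\<close>

lemma char_root_first_dominant:
  assumes "g > 0" "m > 0" "\<kappa> > 0" "B > 0" and \<theta>: "0 \<le> \<theta>" "\<theta> < 1" "m \<le> \<theta> * g"
  shows "\<exists>r \<omega>. char_fun g m \<kappa> B r = 0 \<and> g \<le> \<omega>\<^sup>2 \<and> \<omega> \<ge> 0 \<and>
    cmod (r - \<i> * of_real \<omega>) \<le> 2 * \<kappa> * B / ((1 - \<theta>)\<^sup>2 * g)"
proof -
  obtain X Y where XY: "0 < X" "g \<le> Y" "X + Y = m + g + B" "\<bar>g - m\<bar> \<le> Y - X"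
      "Y\<^sup>2 - (m + g + B) * Y + g * m = 0" "(Y - g) * (Y - m) = B * Y"
    using undamped_frequencies[of g m B] assms by metis
  have Y0: "Y > 0" using XY assms by simp
  obtain r where r: "char_fun g m \<kappa> B r = 0"
    and le: "cmod (r - \<i> * of_real (sqrt Y)) * \<bar>m + g + B - 2 * Y\<bar> \<le> 2 * \<kappa> * \<bar>g - Y\<bar>"
    using char_root_near_undamped[OF Y0 assms(3) XY(5)] by blast
  let ?d = "cmod (r - \<i> * of_real (sqrt Y))"
  have "\<bar>m + g + B - 2 * Y\<bar> = Y - X" using XY assms by simp
  moreover have "(1 - \<theta>) * g \<le> Y - X" using XY(4) \<theta> by (simp add: algebra_simps)
  ultimately have 1: "?d * ((1 - \<theta>) * g) \<le> 2 * \<kappa> * (Y - g)"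
    using le mult_left_mono[of "(1 - \<theta>) * g" "Y - X" ?d] XY(2) by simp
  have "m \<le> \<theta> * Y" using \<theta> mult_left_mono[OF XY(2) \<theta>(1)] by simp
  then have "(Y - g) * ((1 - \<theta>) * Y) \<le> (Y - g) * (Y - m)"
    using XY(2) by (intro mult_left_mono) (auto simp: algebra_simps)
  then have "((1 - \<theta>) * (Y - g)) * Y \<le> B * Y" using XY(6) by (simp add: mult_ac)
  then have 2: "(1 - \<theta>) * (Y - g) \<le> B" using Y0 by (subst (asm) mult_le_cancel_right) auto
  have "?d * ((1 - \<theta>)\<^sup>2 * g) = (1 - \<theta>) * (?d * ((1 - \<theta>) * g))" by (simp add: power2_eq_square mult_ac)
  also have "\<dots> \<le> (1 - \<theta>) * (2 * \<kappa> * (Y - g))" using 1 \<theta> by (intro mult_left_mono) auto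
  also have "\<dots> = 2 * \<kappa> * ((1 - \<theta>) * (Y - g))" by simp
  also have "\<dots> \<le> 2 * \<kappa> * B" using 2 assms by (intro mult_left_mono) auto
  finally have "?d \<le> 2 * \<kappa> * B / ((1 - \<theta>)\<^sup>2 * g)" using assms by (simp add: pos_le_divide_eq)
  then show ?thesis using r XY Y0 by (intro exI[of _ r] exI[of _ "sqrt Y"]) auto
qed

text \<open>The counterpart for the smaller frequency: the gap is at least
  \<open>(1 - \<theta>) * m\<close>, and \<open>(g - X) * (m - X) = B * X\<close> confines
  \<open>g - X\<close> to \<open>B * g / ((1 - \<theta>) * m)\<close>.\<close>

lemma char_root_second_dominant:
  assumes "g > 0" "m > 0" "\<kappa> > 0" "B > 0" and \<theta>: "\<theta> < 1" "g \<le> \<theta> * m"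
  shows "\<exists>r \<omega>. char_fun g m \<kappa> B r = 0 \<and> g * m / (m + g + B) \<le> \<omega>\<^sup>2 \<and> \<omega> \<ge> 0 \<and>
    cmod (r - \<i> * of_real \<omega>) \<le> 2 * \<kappa> * B * g / ((1 - \<theta>)\<^sup>2 * m\<^sup>2)"
proof -
  obtain X Y where XY: "0 < X" "X \<le> g" "g \<le> Y" "X + Y = m + g + B" "\<bar>g - m\<bar> \<le> Y - X"
      "X\<^sup>2 - (m + g + B) * X + g * m = 0" "(g - X) * (m - X) = B * X" "X * Y = g * m"
    using undamped_frequencies[of g m B] assms by metis
  obtain r where r: "char_fun g m \<kappa> B r = 0"
    and le: "cmod (r - \<i> * of_real (sqrt X)) * \<bar>m + g + B - 2 * X\<bar> \<le> 2 * \<kappa> * \<bar>g - X\<bar>"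
    using char_root_near_undamped[OF XY(1) assms(3) XY(6)] by blast
  let ?d = "cmod (r - \<i> * of_real (sqrt X))"
  have "\<bar>m + g + B - 2 * X\<bar> = Y - X" using XY assms by simp
  moreover have "(1 - \<theta>) * m \<le> Y - X" using XY(5) \<theta> by (simp add: algebra_simps)
  ultimately have 1: "?d * ((1 - \<theta>) * m) \<le> 2 * \<kappa> * (g - X)"
    using le mult_left_mono[of "(1 - \<theta>) * m" "Y - X" ?d] XY(2) by simp
  have "(g - X) * ((1 - \<theta>) * m) \<le> (g - X) * (m - X)"
    using XY(2) \<theta> by (intro mult_left_mono) (auto simp: algebra_simps)
  also have "\<dots> \<le> B * g" using XY assms by simp
  finally have 2: "(g - X) * ((1 - \<theta>) * m) \<le> B * g" .
  have "?d * ((1 - \<theta>)\<^sup>2 * m\<^sup>2) = ((1 - \<theta>) * m) * (?d * ((1 - \<theta>) * m))"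
    by (simp add: power2_eq_square mult_ac)
  also have "\<dots> \<le> ((1 - \<theta>) * m) * (2 * \<kappa> * (g - X))" using 1 \<theta> assms by (intro mult_left_mono) auto
  also have "\<dots> = 2 * \<kappa> * ((g - X) * ((1 - \<theta>) * m))" by simp
  also have "\<dots> \<le> 2 * \<kappa> * (B * g)" using 2 assms by (intro mult_left_mono) auto
  finally have "?d \<le> 2 * \<kappa> * B * g / ((1 - \<theta>)\<^sup>2 * m\<^sup>2)" using assms \<theta> by (simp add: pos_le_divide_eq mult_ac)
  moreover have "g * m \<le> X * (m + g + B)" using XY assms
    by (metis less_eq_real_def less_add_same_cancel2 mult_left_mono)
  then have "g * m / (m + g + B) \<le> X" using assms by (simp add: pos_divide_le_eq)
  ultimately show ?thesis using r XY by (intro exI[of _ r] exI[of _ "sqrt X"]) auto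
qed

section \<open>Eigenvectors of Gevrey semigroups\<close>

lemma eq_0_if_cinner_eq_0: "(\<And>e. cinner x e = 0) \<Longrightarrow> x = (0::'a::complex_inner)"
  using cinner_self[of x] by simp

text \<open>The bounded operator \<open>\<pi>\<close> (a coordinate of the state) transports the orbit to a genuine
  normed space, where the calculus library applies.\<close>

locale observed_semigroup =
  fixes X :: "'x::complex_vector set" and N :: "'x \<Rightarrow> real" and T :: "real \<Rightarrow> 'x \<Rightarrow> 'x"
    and \<pi> :: "'x \<Rightarrow> 'h::complex_inner"
  assumes C0: "C0_semigroup X N T"
    and smooth: "infinitely_differentiable_semigroup X N T"
    and X_add: "x \<in> X \<Longrightarrow> y \<in> X \<Longrightarrow> x + y \<in> X"
    and X_scaleC: "x \<in> X \<Longrightarrow> z *\<^sub>C x \<in> X"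
    and \<pi>_add: "\<pi> (x + y) = \<pi> x + \<pi> y"
    and \<pi>_scaleC: "\<pi> (z *\<^sub>C x) = z *\<^sub>C \<pi> x"
    and norm_\<pi>_le: "norm (\<pi> x) \<le> N x"
    and gen_single: "single_valued (generator X N T)"
    and gen_scaleC: "(x, y) \<in> generator X N T \<Longrightarrow> (z *\<^sub>C x, z *\<^sub>C y) \<in> generator X N T"
begin

lemma N_nonneg: "0 \<le> N x"
  using norm_\<pi>_le norm_ge_zero order_trans by blast

lemma T_bounded_operator: "t \<ge> 0 \<Longrightarrow> bounded_operator_on X N (T t)"
  using C0 by (simp add: C0_semigroup_def)

lemma T_add: "t \<ge> 0 \<Longrightarrow> x \<in> X \<Longrightarrow> y \<in> X \<Longrightarrow> T t (x + y) = T t x + T t y"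
  using T_bounded_operator[of t] by (simp add: bounded_operator_on_def)

lemma T_scaleC: "t \<ge> 0 \<Longrightarrow> x \<in> X \<Longrightarrow> T t (z *\<^sub>C x) = z *\<^sub>C T t x"
  using T_bounded_operator[of t] by (simp add: bounded_operator_on_def)

lemma T_mem: "t \<ge> 0 \<Longrightarrow> x \<in> X \<Longrightarrow> T t x \<in> X"
  using T_bounded_operator[of t] by (simp add: bounded_operator_on_def)

lemma T_bounded: "t \<ge> 0 \<Longrightarrow> \<exists>M. \<forall>x\<in>X. N (T t x) \<le> M * N x"
  using T_bounded_operator[of t] by (simp add: bounded_operator_on_def)

lemma T_plus: "s \<ge> 0 \<Longrightarrow> t \<ge> 0 \<Longrightarrow> x \<in> X \<Longrightarrow> T (s + t) x = T s (T t x)"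
  using C0 by (simp add: C0_semigroup_def)

lemma generator_orbit:
  assumes U: "(U, z *\<^sub>C U) \<in> generator X N T" and t: "t \<ge> 0"
  shows "(T t U, z *\<^sub>C T t U) \<in> generator X N T"
proof -
  have UX: "U \<in> X" using U by (simp add: generator_def)
  obtain M where M: "\<And>x. x \<in> X \<Longrightarrow> N (T t x) \<le> M * N x" using T_bounded[OF t] by blast
  let ?q = "\<lambda>h. (1 / h) *\<^sub>R (T h U - U) - z *\<^sub>C U"
  let ?q' = "\<lambda>h. (1 / h) *\<^sub>R (T h (T t U) - T t U) - z *\<^sub>C T t U"
  have "N (?q' h) \<le> M * N (?q h)" if h: "h > 0" for h
  proof -
    have ThU: "T h U \<in> X" using h UX by (simp add: T_mem)
    \<comment> \<open>Written without subtraction and real scaling, because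
      \<open>bounded_operator_on\<close> provides additivity and complex homogeneity on
      \<open>X\<close>.\<close>
    have q: "?q h = complex_of_real (1 / h) *\<^sub>C (T h U + (- 1) *\<^sub>C U) + (- z) *\<^sub>C U"
      by (simp add: scaleC_of_real scaleC_minus_left del: of_real_divide)
    have "T t (?q h) = complex_of_real (1 / h) *\<^sub>C (T t (T h U) + (- 1) *\<^sub>C T t U) + (- z) *\<^sub>C T t U"
      unfolding q by (simp only: T_add[OF t] T_scaleC[OF t] X_add X_scaleC UX ThU)
    also have "T t (T h U) = T (t + h) U" using t h UX by (simp add: T_plus)
    also have "\<dots> = T (h + t) U" by (simp only: add.commute)
    also have "\<dots> = T h (T t U)" using t h UX by (simp add: T_plus)
    finally have Tq: "T t (?q h) = ?q' h"
      by (simp add: scaleC_of_real scaleC_minus_left del: of_real_divide)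
    have "?q h \<in> X" unfolding q using UX ThU by (intro X_add X_scaleC)
    from M[OF this] show ?thesis unfolding Tq .
  qed
  then have upper: "\<forall>\<^sub>F h in at_right 0. N (?q' h) \<le> M * N (?q h)"
    by (auto simp: eventually_at_filter intro!: always_eventually)
  have lim: "((\<lambda>h. M * N (?q h)) \<longlongrightarrow> 0) (at_right 0)"
    using U unfolding generator_def by (intro tendsto_mult_right_zero) auto
  have "((\<lambda>h. N (?q' h)) \<longlongrightarrow> 0) (at_right 0)"
    by (rule tendsto_sandwich[OF _ upper tendsto_const lim]) (simp add: N_nonneg)
  then show ?thesis using UX t by (simp add: generator_def T_mem X_scaleC)
qed

text \<open>Identifies the otherwise unspecified \<open>y\<close> in
  \<open>norm_power_semigroup_le\<close>.\<close>

lemma generator_power_orbit: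
  assumes U: "(U, z *\<^sub>C U) \<in> generator X N T" and "t \<ge> 0"
    and "(T t U, y) \<in> generator X N T ^^ n"
  shows "y = z ^ n *\<^sub>C T t U"
  using assms(3)
proof (induction n arbitrary: y)
  case (Suc n)
  then obtain x where "(T t U, x) \<in> generator X N T ^^ n" and xy: "(x, y) \<in> generator X N T" by auto
  then have x: "x = z ^ n *\<^sub>C T t U" using Suc.IH by simp
  have "(x, z ^ n *\<^sub>C z *\<^sub>C T t U) \<in> generator X N T"
    unfolding x using gen_scaleC[OF generator_orbit[OF U assms(2)]] .
  with xy gen_single have "y = z ^ n *\<^sub>C z *\<^sub>C T t U" by (meson single_valuedD)
  then show ?case by (simp add: scaleC_scaleC mult.commute)
qed simp

lemma \<pi>_scaleR: "\<pi> (r *\<^sub>R x) = r *\<^sub>R \<pi> x"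
  by (simp add: scaleR_conv_scaleC \<pi>_scaleC)

lemma \<pi>_diff: "\<pi> (x - y) = \<pi> x - \<pi> y"
  using \<pi>_add[of x "(-1) *\<^sub>C y"] \<pi>_scaleC[of "-1" y] by (simp add: scaleC_minus_left)

text \<open>Smoothness supplies a two-sided derivative \<open>d 1 t\<close>, the generator only a
  right-hand one. Restricting the former to the right puts it in the generator graph, where
  single-valuedness fixes its value.\<close>

lemma orbit_derivative:
  assumes U: "(U, z *\<^sub>C U) \<in> generator X N T" and t: "t > 0"
  shows "((\<lambda>t. \<pi> (T t U)) has_vector_derivative z *\<^sub>C \<pi> (T t U)) (at t)"
proof -
  have UX: "U \<in> X" using U by (simp add: generator_def)
  from smooth UX obtain d where d_all: "(\<forall>t>0. d 0 t = T t U) \<and> (\<forall>n. \<forall>t>0. d n t \<in> X \<and>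
      ((\<lambda>s. N ((1 / (s - t)) *\<^sub>R (d n s - d n t) - d (Suc n) t)) \<longlongrightarrow> 0) (at t))"
    unfolding infinitely_differentiable_semigroup_def by blast
  have d0: "d 0 s = T s U" if "s > 0" for s using d_all that by blast
  have dX: "d n s \<in> X" if "s > 0" for n s using d_all that by blast
  have d: "((\<lambda>s. N ((1 / (s - t)) *\<^sub>R (d 0 s - d 0 t) - d (Suc 0) t)) \<longlongrightarrow> 0) (at t)"
    using d_all t by blast
  have "\<forall>\<^sub>F s in nhds t. s > 0" using t by (rule order_tendstoD[OF filterlim_ident])
  then have pos: "\<forall>\<^sub>F s in at t. s > 0" by (auto simp: eventually_at_filter elim: eventually_mono)
  have lim: "((\<lambda>s. N ((1 / (s - t)) *\<^sub>R (T s U - T t U) - d 1 t)) \<longlongrightarrow> 0) (at t)"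
    using d by (rule Lim_transform_eventually)
      (use pos in \<open>auto simp: d0 t elim: eventually_mono\<close>)
  \<comment> \<open>Passes from \<open>s\<close> near \<open>t\<close> to \<open>s = t + h\<close>
    with \<open>h\<close> decreasing to 0, the form in which the generator is defined.\<close>
  have shift: "filterlim (\<lambda>h. t + h) (at t) (at_right 0)"
    unfolding filterlim_at
    by (auto simp: eventually_at_filter intro!: always_eventually tendsto_eq_intros)
  have "((\<lambda>h. N ((1 / h) *\<^sub>R (T (t + h) U - T t U) - d 1 t)) \<longlongrightarrow> 0) (at_right 0)"
    using filterlim_compose[OF lim shift] by simp
  moreover have "\<forall>\<^sub>F h in at_right 0. N ((1 / h) *\<^sub>R (T (t + h) U - T t U) - d 1 t)
      = N ((1 / h) *\<^sub>R (T h (T t U) - T t U) - d 1 t)"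
    using T_plus[of _ t U] t UX
    by (auto simp: eventually_at_filter add.commute intro!: always_eventually)
  ultimately have "((\<lambda>h. N ((1 / h) *\<^sub>R (T h (T t U) - T t U) - d 1 t)) \<longlongrightarrow> 0) (at_right 0)"
    by (rule Lim_transform_eventually)
  then have "(T t U, d 1 t) \<in> generator X N T"
    using t UX dX by (simp add: generator_def T_mem)
  then have d1: "d 1 t = z *\<^sub>C T t U"
    using generator_orbit[OF U] t gen_single by (meson less_imp_le single_valuedD)
  have ev: "norm ((1 / (s - t)) *\<^sub>R (\<pi> (T s U) - \<pi> (T t U)) - z *\<^sub>C \<pi> (T t U))
      = norm ((\<pi> (T s U) - \<pi> (T t U)) - (s - t) *\<^sub>R z *\<^sub>C \<pi> (T t U)) / norm (s - t)"
    if "s \<noteq> t" for s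
  proof -
    have "(1 / (s - t)) *\<^sub>R (\<pi> (T s U) - \<pi> (T t U)) - z *\<^sub>C \<pi> (T t U)
      = (1 / (s - t)) *\<^sub>R ((\<pi> (T s U) - \<pi> (T t U)) - (s - t) *\<^sub>R z *\<^sub>C \<pi> (T t U))"
      using that by (simp add: scaleR_diff_right)
    then show ?thesis by (simp add: divide_inverse)
  qed
  have "((\<lambda>s. norm ((1 / (s - t)) *\<^sub>R (\<pi> (T s U) - \<pi> (T t U)) - z *\<^sub>C \<pi> (T t U))) \<longlongrightarrow> 0) (at t)"
  proof (rule tendsto_sandwich[OF _ _ tendsto_const lim])
    show "\<forall>\<^sub>F s in at t. norm ((1 / (s - t)) *\<^sub>R (\<pi> (T s U) - \<pi> (T t U)) - z *\<^sub>C \<pi> (T t U))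
        \<le> N ((1 / (s - t)) *\<^sub>R (T s U - T t U) - d 1 t)"
      using norm_\<pi>_le by (intro always_eventually allI) (metis \<pi>_diff \<pi>_scaleR \<pi>_scaleC d1)
  qed simp
  then have "((\<lambda>s. norm ((\<pi> (T s U) - \<pi> (T t U)) - (s - t) *\<^sub>R z *\<^sub>C \<pi> (T t U)) / norm (s - t))
      \<longlongrightarrow> 0) (at t)"
    by (elim Lim_transform_eventually) (simp add: eventually_at_filter ev)
  then show ?thesis
    unfolding has_vector_derivative_def has_derivative_iff_norm by (simp add: bounded_linear_scaleR_left)
qed

text \<open>The scalar function \<open>exp (- z * t) * cinner (\<pi> (T t U)) e\<close> has zero
  derivative for positive \<open>t\<close>; strong continuity at 0 determines the constant. Testing
  against every \<open>e\<close> recovers the vector identity.\<close>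

lemma orbit_eigenvector:
  assumes U: "(U, z *\<^sub>C U) \<in> generator X N T" and t: "t > 0"
  shows "\<pi> (T t U) = exp (z * of_real t) *\<^sub>C \<pi> U"
proof -
  have UX: "U \<in> X" using U by (simp add: generator_def)
  have "cinner (\<pi> (T t U) - exp (z * of_real t) *\<^sub>C \<pi> U) e = 0" for e
  proof -
    define f where "f = (\<lambda>t. cinner (\<pi> (T t U)) e)"
    define g where "g = (\<lambda>t. exp (- z * of_real t) * f t)"
    have f: "(f has_vector_derivative z * f t) (at t)" if "t > 0" for t
      using bounded_linear.has_vector_derivative[OF bounded_linear_cinner_left orbit_derivative[OF U that]]
      by (simp add: f_def cinner_scaleC_left)
    have E: "((\<lambda>t. exp (- z * of_real t)) has_vector_derivative - z * exp (- z * of_real t)) (at t)" for t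
      by (rule has_vector_derivative_real_field) (auto intro!: derivative_eq_intros)
    have "(g has_vector_derivative 0) (at t within {0<..})" if "t > 0" for t
    proof -
      have "(g has_vector_derivative
          (exp (- z * of_real t) * (z * f t) + (- z * exp (- z * of_real t)) * f t)) (at t)"
        unfolding g_def by (rule has_vector_derivative_mult[OF E f[OF that]])
      then show ?thesis by (simp add: has_vector_derivative_at_within mult_ac)
    qed
    then obtain c where c: "\<And>t. t > 0 \<Longrightarrow> g t = c"
      using has_vector_derivative_zero_constant[of "{0<..}" g] by (auto simp: greaterThan_iff)
    have "((\<lambda>t. N (T t U - U)) \<longlongrightarrow> 0) (at_right 0)"
      using C0 UX unfolding C0_semigroup_def by blast
    then have "((\<lambda>t. norm (\<pi> (T t U) - \<pi> U)) \<longlongrightarrow> 0) (at_right 0)"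
      by (rule tendsto_sandwich[OF _ _ tendsto_const, rotated 2])
        (simp_all add: norm_\<pi>_le flip: \<pi>_diff)
    then have "((\<lambda>t. \<pi> (T t U)) \<longlongrightarrow> \<pi> U) (at_right 0)"
      by (simp only: tendsto_norm_zero_iff LIM_zero_iff)
    then have "(f \<longlongrightarrow> cinner (\<pi> U) e) (at_right 0)"
      unfolding f_def by (rule bounded_linear.tendsto[OF bounded_linear_cinner_left])
    then have "(g \<longlongrightarrow> exp (- z * of_real 0) * cinner (\<pi> U) e) (at_right 0)"
      unfolding g_def by (intro tendsto_intros)
    moreover have "(g \<longlongrightarrow> c) (at_right 0)"
      by (rule tendsto_eventually) (auto simp: c eventually_at_filter intro!: always_eventually)
    ultimately have "c = cinner (\<pi> U) e"
      using tendsto_unique trivial_limit_at_right_real by fastforce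
    with c[OF t] have "exp (z * of_real t) * cinner (\<pi> U) e
        = exp (z * of_real t) * exp (- z * of_real t) * f t"
      by (simp add: g_def)
    also have "\<dots> = f t" by (simp flip: exp_add)
    finally have "f t = cinner (exp (z * of_real t) *\<^sub>C \<pi> U) e" by (simp add: cinner_scaleC_left)
    then show ?thesis
      using cinner_add_left[of "\<pi> (T t U) - exp (z * of_real t) *\<^sub>C \<pi> U" "exp (z * of_real t) *\<^sub>C \<pi> U" e]
      by (simp add: f_def)
  qed
  from eq_0_if_cinner_eq_0[OF this] show ?thesis by simp
qed

text \<open>The instance of the Gevrey estimate at time 1 with \<open>r = 1\<close> suffices. Its
  constant comes from an operator norm, so it is the same for all eigenvectors and all
  \<open>n\<close>.\<close>

lemma gevrey_eigenvalue_bound: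
  assumes "gevrey_class X N T \<delta>"
  shows "\<exists>C. \<forall>U z n. (U, z *\<^sub>C U) \<in> generator X N T \<longrightarrow>
    cmod z ^ n * exp (Re z) * norm (\<pi> U) \<le> C * fact n powr \<delta> * N U"
proof -
  have "\<exists>C. \<forall>t\<in>{1}. \<forall>n. norm_power_semigroup_le X N T n t (C * 1 ^ n * fact n powr \<delta>)"
    using conjunct2[OF assms[unfolded gevrey_class_def], rule_format, of "{1}" 1] by simp
  then obtain C where "\<forall>t\<in>{1}. \<forall>n. norm_power_semigroup_le X N T n t (C * 1 ^ n * fact n powr \<delta>)"
    by (rule exE)
  then have C: "norm_power_semigroup_le X N T n 1 (C * fact n powr \<delta>)" for n by simp
  have "cmod z ^ n * exp (Re z) * norm (\<pi> U) \<le> C * fact n powr \<delta> * N U"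
    if U: "(U, z *\<^sub>C U) \<in> generator X N T" for U z n
  proof -
    have "U \<in> X" using U by (simp add: generator_def)
    then obtain y where y: "(T 1 U, y) \<in> generator X N T ^^ n"
      and Ny: "N y \<le> C * fact n powr \<delta> * N U"
      using C[of n, unfolded norm_power_semigroup_le_def] by blast
    have "y = z ^ n *\<^sub>C T 1 U" using generator_power_orbit[OF U _ y] by simp
    then have "\<pi> y = z ^ n *\<^sub>C exp z *\<^sub>C \<pi> U"
      using orbit_eigenvector[OF U, of 1] by (simp add: \<pi>_scaleC)
    then have "norm (\<pi> y) = cmod z ^ n * exp (Re z) * norm (\<pi> U)"
      by (simp add: norm_scaleC norm_power)
    then show ?thesis using norm_\<pi>_le[of y] Ny by simp
  qed
  then show ?thesis by blast
qed

end

section \<open>The system operator and its observed coordinate\<close>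

context coercive_self_adjoint
begin

lemma power_domain_add: "x \<in> power_domain A s \<Longrightarrow> y \<in> power_domain A s \<Longrightarrow> x + y \<in> power_domain A s"
  unfolding power_domain_def by (auto simp: neg_power_add[symmetric])

lemma power_domain_scaleC: "x \<in> power_domain A s \<Longrightarrow> z *\<^sub>C x \<in> power_domain A s"
  unfolding power_domain_def by (auto simp: neg_power_scaleC[symmetric])

lemma system_operator_single_valued: "single_valued (system_operator A a b k \<alpha> \<beta> \<gamma>)"
  unfolding system_operator_def single_valued_def
  by clarsimp (metis injD[OF neg_power_inj[of 2]])

lemma system_operator_scaleC:
  assumes "(x, y) \<in> system_operator A a b k \<alpha> \<beta> \<gamma>"
  shows "(z *\<^sub>C x, z *\<^sub>C y) \<in> system_operator A a b k \<alpha> \<beta> \<gamma>"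
  using assms unfolding system_operator_def energy_space_def
  by (auto simp: scaleC_prod_def power_domain_scaleC neg_power_scaleC scaleC_add_right
      scaleC_diff_right scaleC_minus_right scaleR_conv_scaleC scaleC_scaleC mult.commute)

text \<open>The velocity \<open>v\<close> is observed because it enters the energy norm without a
  power of \<open>A\<close>, so the bound on the coordinate is immediate.\<close>

lemma system_observed_semigroup:
  assumes "a > 0"
    and "C0_semigroup (energy_space A \<gamma>) (energy_norm A a \<gamma>) T"
    and gen: "generator (energy_space A \<gamma>) (energy_norm A a \<gamma>) T = system_operator A a b k \<alpha> \<beta> \<gamma>"
    and "infinitely_differentiable_semigroup (energy_space A \<gamma>) (energy_norm A a \<gamma>) T"
  shows "observed_semigroup (energy_space A \<gamma>) (energy_norm A a \<gamma>) T (\<lambda>x. fst (snd x))"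
proof
  show "single_valued (generator (energy_space A \<gamma>) (energy_norm A a \<gamma>) T)"
    unfolding gen by (rule system_operator_single_valued)
  show "(z *\<^sub>C x, z *\<^sub>C y) \<in> generator (energy_space A \<gamma>) (energy_norm A a \<gamma>) T"
    if "(x, y) \<in> generator (energy_space A \<gamma>) (energy_norm A a \<gamma>) T" for x y z
    using that unfolding gen by (rule system_operator_scaleC)
  show "norm (fst (snd x)) \<le> energy_norm A a \<gamma> x" for x
    using assms(1) by (cases x) (auto simp: energy_norm_def intro!: real_le_rsqrt)
qed (use assms in \<open>auto simp: energy_space_def scaleC_prod_def power_domain_add power_domain_scaleC\<close>)

lemma pos_power_eigenvector:
  assumes "(e, m *\<^sub>R e) \<in> A" "m > 0" "s \<ge> 0"
  shows "pos_power A s (z *\<^sub>C e) = (z * complex_of_real (m powr s)) *\<^sub>C e"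
    and "z *\<^sub>C e \<in> power_domain A s"
proof -
  have "m powr s * m powr (- s) = 1" using assms by (simp flip: powr_add)
  then have eq: "neg_power A s ((z * complex_of_real (m powr s)) *\<^sub>C e) = z *\<^sub>C e"
    unfolding neg_power_eigenvector[OF assms] by (simp add: mult.assoc flip: of_real_mult)
  show "pos_power A s (z *\<^sub>C e) = (z * complex_of_real (m powr s)) *\<^sub>C e"
    unfolding pos_power_def by (rule inv_f_eq[OF neg_power_inj eq])
  show "z *\<^sub>C e \<in> power_domain A s" unfolding power_domain_def using eq by (metis rangeI)
qed

end

section \<open>Eigenvectors of the system and the growth argument\<close>

context coercive_self_adjoint
begin

text \<open>Rows one and three force \<open>v = z u\<close> and \<open>w = z y\<close>. Row two
  becomes \<open>(z^2 + g) u = b m^\<alpha> w\<close> in coefficients, solved by the chosen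
  \<open>u\<close> and \<open>w\<close>; row four times \<open>z\<close> is then the characteristic
  equation.\<close>

lemma system_eigenvector:
  fixes a b k \<alpha> \<beta> \<gamma> m :: real and z :: complex
  assumes e: "(e, m *\<^sub>R e) \<in> A" and m: "m > 0" and z: "z \<noteq> 0"
    and exps: "\<alpha> \<le> 2" "\<beta> \<le> 2" "0 \<le> \<gamma>" "\<gamma> \<le> 2"
    and char: "char_fun (a * m powr \<gamma>) m (k * m powr \<beta>) (b\<^sup>2 * m powr (2 * \<alpha>)) z = 0"
  defines "u \<equiv> complex_of_real (b * m powr \<alpha>)" and "w \<equiv> z\<^sup>2 + of_real (a * m powr \<gamma>)"
  defines "U \<equiv> (u *\<^sub>C e, (z * u) *\<^sub>C e, (w / z) *\<^sub>C e, w *\<^sub>C e)"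
  shows "(U, z *\<^sub>C U) \<in> system_operator A a b k \<alpha> \<beta> \<gamma>"
proof -
  \<comment> \<open>The common factor that every term carries because the rows are stated after
    applying \<open>neg_power A 2\<close>.\<close>
  define M :: complex where "M = of_real (m powr (- 2))"
  have shift: "complex_of_real (m powr (- (2 - s))) = of_real (m powr s) * M" for s
    unfolding M_def of_real_mult[symmetric] by (simp add: powr_add[symmetric])
  have sq: "m powr (2 * \<alpha>) = (m powr \<alpha>)\<^sup>2" by (simp add: power2_eq_square flip: powr_add)
  have np: "neg_power A s (x *\<^sub>C e) = (x * complex_of_real (m powr (- s))) *\<^sub>C e" if "s \<ge> 0" for s x
    by (rule neg_power_eigenvector[OF e m that])
  have neg: "- (x *\<^sub>C e) = (- x) *\<^sub>C e" for x by (simp add: scaleC_minus_left)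
  have dif: "x *\<^sub>C e - y *\<^sub>C e = (x - y) *\<^sub>C e" for x y
    using scaleC_add_left[of x "- y" e] by (simp add: scaleC_minus_left)
  have row2: "(z * (z * u)) * M = - (of_real a * (u * (of_real (m powr \<gamma>) * M)))
      + of_real b * (w * (of_real (m powr \<alpha>) * M))"
    unfolding u_def w_def by (simp add: algebra_simps power2_eq_square)
  have m1: "complex_of_real (m powr 1) = of_real m" using m by simp
  \<comment> \<open>The extra factor \<open>z\<close> clears the denominator of the third coordinate
    \<open>w / z\<close>.\<close>
  have "z * ((z * w) * M + of_real b * ((z * u) * (of_real (m powr \<alpha>) * M))
      + (w / z) * (of_real m * M) + of_real k * (w * (of_real (m powr \<beta>) * M)))
      = char_fun (a * m powr \<gamma>) m (k * m powr \<beta>) (b\<^sup>2 * m powr (2 * \<alpha>)) z * M"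
    unfolding char_fun_def sq u_def w_def using z by (simp add: field_simps power2_eq_square)
  then have row4': "(z * w) * M + of_real b * ((z * u) * (of_real (m powr \<alpha>) * M))
      + (w / z) * (of_real m * M) + of_real k * (w * (of_real (m powr \<beta>) * M)) = 0"
    using char z by simp
  then have row4: "(z * w) * M = - (of_real b * ((z * u) * (of_real (m powr \<alpha>) * M)))
      - (w / z) * (of_real m * M) - of_real k * (w * (of_real (m powr \<beta>) * M))"
  proof -
    have "x = - y - v - w" if "x + y + v + w = 0" for x y v w :: complex
      using that by algebra
    from this[OF row4'] show ?thesis .
  qed
  have dom: "x *\<^sub>C e \<in> power_domain A s" if "s \<ge> 0" for x s
    by (rule pos_power_eigenvector(2)[OF e m that])
  have "neg_power A 2 ((z * (z * u)) *\<^sub>C e) =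
      - (a *\<^sub>R neg_power A (2 - \<gamma>) (u *\<^sub>C e)) + b *\<^sub>R neg_power A (2 - \<alpha>) (w *\<^sub>C e)"
    using exps
    by (simp only: np shift scaleR_conv_scaleC scaleC_scaleC neg scaleC_add_left[symmetric]
        M_def[symmetric] row2 diff_ge_0_iff_ge zero_le_numeral)
  moreover have "neg_power A 2 ((z * w) *\<^sub>C e) =
      - (b *\<^sub>R neg_power A (2 - \<alpha>) ((z * u) *\<^sub>C e)) - neg_power A (2 - 1) ((w / z) *\<^sub>C e)
      - k *\<^sub>R neg_power A (2 - \<beta>) (w *\<^sub>C e)"
  proof -
    have "(2::real) - 1 \<ge> 0" by simp
    note np1 = np[OF this, unfolded shift m1]
    show ?thesis using exps
      by (simp only: np1 np shift scaleR_conv_scaleC scaleC_scaleC neg dif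
          M_def[symmetric] row4 diff_ge_0_iff_ge zero_le_numeral)
  qed
  moreover have "z * (w / z) = w" using z by simp
  ultimately show ?thesis
    unfolding system_operator_def energy_space_def U_def scaleC_prod_def
    using exps by (simp add: dom scaleC_scaleC)
qed

lemma energy_norm_eigenvector:
  fixes a \<gamma> m :: real
  assumes e: "(e, m *\<^sub>R e) \<in> A" and m: "m > 0" and "a > 0" "0 \<le> \<gamma>"
  shows "energy_norm A a \<gamma> (u *\<^sub>C e, v *\<^sub>C e, y *\<^sub>C e, w *\<^sub>C e)
    \<le> (sqrt a * (cmod u * m powr (\<gamma> / 2)) + cmod v + cmod y * m powr (1 / 2) + cmod w) * norm e"
proof -
  have le: "sqrt (p\<^sup>2 + q\<^sup>2 + r\<^sup>2 + s\<^sup>2) \<le> p + q + r + s"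
    if "p \<ge> 0" "q \<ge> 0" "r \<ge> 0" "s \<ge> 0" for p q r s :: real
  proof (rule real_le_lsqrt)
    have "(p + q + r + s)\<^sup>2 = p\<^sup>2 + q\<^sup>2 + r\<^sup>2 + s\<^sup>2 + 2 * (p * q + p * r + p * s + q * r + q * s + r * s)"
      by (simp add: power2_eq_square algebra_simps)
    then show "p\<^sup>2 + q\<^sup>2 + r\<^sup>2 + s\<^sup>2 \<le> (p + q + r + s)\<^sup>2" using that by simp
  qed (use that in simp)
  have "a * (norm (pos_power A (\<gamma> / 2) (u *\<^sub>C e)))\<^sup>2 = (sqrt a * (cmod u * m powr (\<gamma> / 2)) * norm e)\<^sup>2"
    using assms by (simp add: pos_power_eigenvector(1)[OF e m] norm_scaleC norm_mult power_mult_distrib)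
  moreover have "norm (pos_power A (1 / 2) (y *\<^sub>C e)) = cmod y * m powr (1 / 2) * norm e"
    using pos_power_eigenvector(1)[OF e m, of "1/2" y] by (simp add: norm_scaleC norm_mult)
  ultimately have "energy_norm A a \<gamma> (u *\<^sub>C e, v *\<^sub>C e, y *\<^sub>C e, w *\<^sub>C e) =
      sqrt ((sqrt a * (cmod u * m powr (\<gamma> / 2)) * norm e)\<^sup>2 + (cmod v * norm e)\<^sup>2
        + (cmod y * m powr (1 / 2) * norm e)\<^sup>2 + (cmod w * norm e)\<^sup>2)"
    by (simp add: energy_norm_def norm_scaleC)
  also have "\<dots> \<le> sqrt a * (cmod u * m powr (\<gamma> / 2)) * norm e + cmod v * norm e
        + cmod y * m powr (1 / 2) * norm e + cmod w * norm e"
    using assms by (intro le) auto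
  finally show ?thesis by (simp add: algebra_simps)
qed

text \<open>The exponent 3 dominates every power of \<open>m\<close> in
  \<open>char_root_bound\<close>, the largest being \<open>2 * \<alpha>\<close>,
  \<open>\<gamma> + \<beta>\<close> and \<open>\<gamma> + 1\<close>.\<close>

lemma char_root_polynomial_bound:
  fixes a b k \<alpha> \<beta> \<gamma> m :: real
  assumes char: "char_fun (a * m powr \<gamma>) m (k * m powr \<beta>) (b\<^sup>2 * m powr (2 * \<alpha>)) z = 0"
    and "a > 0" "k > 0" "m \<ge> 1" and exps: "\<alpha> \<le> 3/2" "\<beta> \<le> 1" "\<gamma> \<le> 2"
  shows "cmod z \<le> (2 + k + 2 * a + b\<^sup>2 + a * k) * m ^ 3"
proof -
  have pw: "m powr s \<le> m ^ 3" if "s \<le> 3" for s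
    using powr_mono[OF that, of m] assms by (simp add: powr_numeral)
  have "cmod z \<le> 1 + k * m powr \<beta> + (m + a * m powr \<gamma> + b\<^sup>2 * m powr (2 * \<alpha>))
      + a * m powr \<gamma> * (k * m powr \<beta>) + a * m powr \<gamma> * m"
    using assms by (intro char_root_bound[OF char]) auto
  also have "\<dots> = m powr 0 + k * m powr \<beta> + (m powr 1 + a * m powr \<gamma> + b\<^sup>2 * m powr (2 * \<alpha>))
      + (a * k) * m powr (\<gamma> + \<beta>) + a * m powr (\<gamma> + 1)"
    using assms by (simp add: powr_add)
  also have "\<dots> \<le> m ^ 3 + k * m ^ 3 + (m ^ 3 + a * m ^ 3 + b\<^sup>2 * m ^ 3)
      + (a * k) * m ^ 3 + a * m ^ 3"
    using assms by (intro add_mono mult_left_mono pw) auto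
  finally show ?thesis by (simp add: algebra_simps)
qed

text \<open>The factor \<open>m\<^sup>7\<close> crudely bounds the energy norm of the eigenvector relative to the coordinate
  observed; any fixed power of \<open>m\<close> would do.\<close>

lemma gevrey_root_bound:
  fixes a b k \<alpha> \<beta> \<gamma> \<delta> :: real
  assumes "a > 0" "k > 0" "b \<noteq> 0"
    and exps: "0 \<le> \<alpha>" "\<alpha> \<le> 3/2" "\<beta> \<le> 1" "0 \<le> \<gamma>" "\<gamma> \<le> 2"
    and C0: "C0_semigroup (energy_space A \<gamma>) (energy_norm A a \<gamma>) T"
    and gen: "generator (energy_space A \<gamma>) (energy_norm A a \<gamma>) T = system_operator A a b k \<alpha> \<beta> \<gamma>"
    and gevrey: "gevrey_class (energy_space A \<gamma>) (energy_norm A a \<gamma>) T \<delta>"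
  shows "\<exists>K. \<forall>m e z n. (e, m *\<^sub>R e) \<in> A \<longrightarrow> e \<noteq> 0 \<longrightarrow> 1 \<le> m \<longrightarrow> 1 \<le> cmod z \<longrightarrow>
    char_fun (a * m powr \<gamma>) m (k * m powr \<beta>) (b\<^sup>2 * m powr (2 * \<alpha>)) z = 0 \<longrightarrow>
    cmod z ^ n * exp (Re z) \<le> K * fact n powr \<delta> * m ^ 7"
proof -
  interpret observed_semigroup "energy_space A \<gamma>" "energy_norm A a \<gamma>" T "\<lambda>x. fst (snd x)"
    using gevrey by (intro system_observed_semigroup[OF assms(1) C0 gen]) (simp add: gevrey_class_def)
  obtain C where C: "\<And>U z n. (U, z *\<^sub>C U) \<in> system_operator A a b k \<alpha> \<beta> \<gamma> \<Longrightarrow>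
      cmod z ^ n * exp (Re z) * norm (fst (snd U)) \<le> C * fact n powr \<delta> * energy_norm A a \<gamma> U"
    using gevrey_eigenvalue_bound[OF gevrey] unfolding gen by blast
  define D where "D = 2 + k + 2 * a + b\<^sup>2 + a * k"
  have D0: "D \<ge> 0" using assms by (simp add: D_def)
  \<comment> \<open>The sum of the coefficients in the bounds \<open>t1\<close> to \<open>t4\<close>
    for the four coordinates.\<close>
  define E where "E = sqrt a * \<bar>b\<bar> + D * \<bar>b\<bar> + 2 * (D\<^sup>2 + a)"
  have "cmod z ^ n * exp (Re z) \<le> (\<bar>C\<bar> * E / \<bar>b\<bar>) * fact n powr \<delta> * m ^ 7"
    if e: "(e, m *\<^sub>R e) \<in> A" and e0: "e \<noteq> 0" and m: "1 \<le> m" and z: "1 \<le> cmod z"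
      and char: "char_fun (a * m powr \<gamma>) m (k * m powr \<beta>) (b\<^sup>2 * m powr (2 * \<alpha>)) z = 0"
    for m e z n
  proof -
    let ?u = "complex_of_real (b * m powr \<alpha>)" and ?w = "z\<^sup>2 + of_real (a * m powr \<gamma>)"
    let ?U = "(?u *\<^sub>C e, (z * ?u) *\<^sub>C e, (?w / z) *\<^sub>C e, ?w *\<^sub>C e)"
    have m0: "m > 0" using m by simp
    have pw: "m powr s \<le> m ^ 7" if "s \<le> 7" for s
      using powr_mono[OF that m] m by (simp add: powr_numeral)
    have z_le: "cmod z \<le> D * m ^ 3"
      unfolding D_def by (rule char_root_polynomial_bound[OF char]) (use assms m in auto)
    have w_le: "cmod ?w \<le> (D\<^sup>2 + a) * m ^ 6"
    proof -
      have "cmod ?w \<le> (cmod z)\<^sup>2 + a * m powr \<gamma>"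
        using norm_triangle_ineq[of "z\<^sup>2" "of_real (a * m powr \<gamma>)"] assms(1)
        by (simp add: norm_power norm_mult)
      moreover have "(cmod z)\<^sup>2 \<le> (D * m ^ 3)\<^sup>2" by (rule power_mono[OF z_le]) simp
      moreover have "m powr \<gamma> \<le> m ^ 6"
        using powr_mono[of \<gamma> 6 m] m exps by (simp add: powr_numeral)
      then have "a * m powr \<gamma> \<le> a * m ^ 6" using assms(1) by simp
      ultimately show ?thesis by (simp add: power_mult_distrib power_mult[symmetric] algebra_simps)
    qed
    have t1: "sqrt a * (cmod ?u * m powr (\<gamma> / 2)) \<le> (sqrt a * \<bar>b\<bar>) * m ^ 7"
    proof -
      have "sqrt a * (cmod ?u * m powr (\<gamma> / 2)) = (sqrt a * \<bar>b\<bar>) * m powr (\<alpha> + \<gamma> / 2)"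
        by (simp add: norm_mult powr_add abs_mult)
      also have "\<dots> \<le> (sqrt a * \<bar>b\<bar>) * m ^ 7" using assms by (intro mult_left_mono pw) auto
      finally show ?thesis .
    qed
    have t2: "cmod (z * ?u) \<le> (D * \<bar>b\<bar>) * m ^ 7"
    proof -
      have "cmod (z * ?u) = cmod z * (\<bar>b\<bar> * m powr \<alpha>)" by (simp add: norm_mult abs_mult)
      also have "\<dots> \<le> (D * m ^ 3) * (\<bar>b\<bar> * m ^ 4)"
        using powr_mono[of \<alpha> 4 m] m exps z_le by (intro mult_mono mult_left_mono) (auto simp: powr_numeral D0)
      also have "\<dots> = (D * \<bar>b\<bar>) * m ^ 7" by (simp add: eval_nat_numeral)
      finally show ?thesis .
    qed
    have t3: "cmod (?w / z) * m powr (1 / 2) \<le> (D\<^sup>2 + a) * m ^ 7"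
    proof -
      have "cmod (?w / z) \<le> cmod ?w" using z by (simp add: norm_divide divide_le_eq mult_le_cancel_left1)
      then have "cmod (?w / z) \<le> (D\<^sup>2 + a) * m ^ 6" using w_le by simp
      moreover have "m powr (1 / 2) \<le> m" using powr_mono[of "1/2" 1 m] m by simp
      ultimately have "cmod (?w / z) * m powr (1 / 2) \<le> ((D\<^sup>2 + a) * m ^ 6) * m"
        using assms m by (intro mult_mono) auto
      then show ?thesis by (simp add: eval_nat_numeral mult_ac)
    qed
    have t4: "cmod ?w \<le> (D\<^sup>2 + a) * m ^ 7"
    proof -
      have "m ^ 6 \<le> m ^ 7" using m by (intro power_increasing) auto
      then have "(D\<^sup>2 + a) * m ^ 6 \<le> (D\<^sup>2 + a) * m ^ 7" using assms by (intro mult_left_mono) auto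
      then show ?thesis using w_le by simp
    qed
    have "sqrt a * (cmod ?u * m powr (\<gamma> / 2)) + cmod (z * ?u) + cmod (?w / z) * m powr (1 / 2) + cmod ?w
        \<le> E * m ^ 7"
    proof -
      have "E * m ^ 7 = (sqrt a * \<bar>b\<bar>) * m ^ 7 + (D * \<bar>b\<bar>) * m ^ 7 + (D\<^sup>2 + a) * m ^ 7 + (D\<^sup>2 + a) * m ^ 7"
        by (simp add: E_def algebra_simps)
      then show ?thesis using add_mono[OF add_mono[OF add_mono[OF t1 t2] t3] t4] by (simp only:)
    qed
    then have N: "energy_norm A a \<gamma> ?U \<le> E * m ^ 7 * norm e"
      using energy_norm_eigenvector[OF e m0 assms(1) exps(4), of ?u "z * ?u" "?w / z" ?w]
      by (meson mult_right_mono norm_ge_zero order_trans)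
    have "(?U, z *\<^sub>C ?U) \<in> system_operator A a b k \<alpha> \<beta> \<gamma>"
      by (rule system_eigenvector[OF e m0 _ _ _ _ _ char]) (use z exps in auto)
    from C[OF this, of n] have 1: "cmod z ^ n * exp (Re z) * (cmod (z * ?u) * norm e)
        \<le> C * fact n powr \<delta> * energy_norm A a \<gamma> ?U"
      by (simp only: fst_conv snd_conv norm_scaleC)
    also have "\<dots> \<le> \<bar>C\<bar> * fact n powr \<delta> * (E * m ^ 7 * norm e)"
      using N N_nonneg by (intro mult_mono) (auto intro: mult_right_mono)
    finally have 2: "cmod z ^ n * exp (Re z) * (cmod (z * ?u) * norm e)
        \<le> \<bar>C\<bar> * fact n powr \<delta> * (E * m ^ 7 * norm e)" .
    \<comment> \<open>The observed coordinate must not degenerate: \<open>cmod z \<ge> 1\<close>,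
      \<open>m \<ge> 1\<close> and \<open>\<alpha> \<ge> 0\<close> keep its coefficient at least
      \<open>\<bar>b\<bar>\<close>.\<close>
    have "1 * (\<bar>b\<bar> * 1) \<le> cmod z * (\<bar>b\<bar> * m powr \<alpha>)"
      using z m exps by (intro mult_mono mult_left_mono) (auto simp: ge_one_powr_ge_zero)
    then have "\<bar>b\<bar> \<le> cmod (z * ?u)" by (simp add: norm_mult abs_mult)
    then have "cmod z ^ n * exp (Re z) * (\<bar>b\<bar> * norm e) \<le> cmod z ^ n * exp (Re z) * (cmod (z * ?u) * norm e)"
      by (intro mult_left_mono mult_right_mono) auto
    with 2 have "norm e * (cmod z ^ n * exp (Re z) * \<bar>b\<bar>) \<le> norm e * (\<bar>C\<bar> * fact n powr \<delta> * (E * m ^ 7))"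
      by (simp add: mult_ac)
    then have "cmod z ^ n * exp (Re z) * \<bar>b\<bar> \<le> \<bar>C\<bar> * fact n powr \<delta> * (E * m ^ 7)"
      using e0 by (subst (asm) mult_le_cancel_left_pos) auto
    then show ?thesis using assms(3) by (simp add: field_simps)
  qed
  then show ?thesis by blast
qed

end

text \<open>Choose \<open>n\<close> to be the integer part of \<open>(\<rho> / e)\<^sup>\<sigma>\<close>; then \<open>(n!)\<^bsup>1/\<sigma>\<^esup> \<le> (\<rho> / e)\<^sup>n\<close>.\<close>

lemma power_over_fact_large:
  fixes \<rho> \<sigma> :: real
  assumes "\<rho> > 0" "\<sigma> > 0"
  shows "\<exists>n. exp ((\<rho> / exp 1) powr \<sigma> - 1) * fact n powr (1 / \<sigma>) \<le> \<rho> ^ n"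
proof -
  let ?x = "\<rho> / exp 1"
  define n where "n = nat \<lfloor>?x powr \<sigma>\<rfloor>"
  have n: "real n \<le> ?x powr \<sigma>" "?x powr \<sigma> - 1 \<le> real n"
  proof -
    have "real n = of_int \<lfloor>?x powr \<sigma>\<rfloor>" unfolding n_def by (simp add: of_nat_nat)
    then show "real n \<le> ?x powr \<sigma>" "?x powr \<sigma> - 1 \<le> real n" by linarith+
  qed
  have "(fact n :: real) \<le> real n ^ n" using fact_le_power[of n] by simp
  then have "fact n powr (1 / \<sigma>) \<le> (real n ^ n) powr (1 / \<sigma>)"
    using assms by (intro powr_mono2) auto
  also have "\<dots> \<le> ((?x powr \<sigma>) ^ n) powr (1 / \<sigma>)"
    using n assms by (intro powr_mono2 power_mono) auto
  also have "\<dots> = ?x ^ n"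
  proof -
    have "(?x powr \<sigma>) ^ n = (?x ^ n) powr \<sigma>"
      using assms by (simp add: powr_power powr_realpow[symmetric] powr_powr mult.commute)
    then show ?thesis using assms by (simp add: powr_powr)
  qed
  \<comment> \<open>The lower bound on \<open>n\<close> converts the exponential gain into
    \<open>exp (real n)\<close>, which restores the factor lost in dividing \<open>\<rho>\<close> by
    \<open>exp 1\<close>.\<close>
  finally have "exp ((\<rho> / exp 1) powr \<sigma> - 1) * fact n powr (1 / \<sigma>) \<le> exp (real n) * ?x ^ n"
    using n by (intro mult_mono) auto
  also have "\<dots> = \<rho> ^ n" by (simp add: power_divide exp_of_nat_mult[symmetric])
  finally show ?thesis by blast
qed

text \<open>In logarithms, the best \<open>n\<close> gains at least
  \<open>d * m powr (p * \<sigma>) - 1\<close>, while the prefactor costs a constant plus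
  \<open>7 * ln m\<close> and the decay at most \<open>C * m powr q\<close>. The gain wins because
  \<open>q < p * \<sigma>\<close>.\<close>

lemma eventually_growth:
  fixes c C K p q \<sigma> :: real
  assumes "c > 0" "p > 0" "\<sigma> > 0" "q < p * \<sigma>"
  shows "\<forall>\<^sub>F m in at_top. \<forall>z. c * m powr p \<le> cmod z \<longrightarrow> \<bar>Re z\<bar> \<le> C * m powr q \<longrightarrow>
    (\<exists>n. K * fact n powr (1 / \<sigma>) * m ^ 7 < cmod z ^ n * exp (Re z))"
proof -
  define s where "s = p * \<sigma>"
  define d where "d = (c / exp 1) powr \<sigma>"
  \<comment> \<open>The maximum with 1 covers a constant \<open>K\<close> that is small or
    negative.\<close>
  define L where "L = ln (max K 1)"
  have s: "s > 0" "q < s" using assms by (simp_all add: s_def)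
  have d: "d > 0" using assms by (simp add: d_def)
  have "((\<lambda>m. (1 + L) * m powr (- s) + 7 * (ln m * m powr (- s)) + C * m powr (q - s))
      \<longlongrightarrow> (1 + L) * 0 + 7 * 0 + C * 0) at_top"
  proof (intro tendsto_intros tendsto_mult)
    show "((\<lambda>m::real. m powr (- s)) \<longlongrightarrow> 0) at_top" using s by real_asymp
    show "((\<lambda>m::real. ln m * m powr (- s)) \<longlongrightarrow> 0) at_top" using s by real_asymp
    have "q - s < 0" using s by simp
    then show "((\<lambda>m::real. m powr (q - s)) \<longlongrightarrow> 0) at_top" by real_asymp
  qed
  then have "\<forall>\<^sub>F m in at_top. (1 + L) * m powr (- s) + 7 * (ln m * m powr (- s)) + C * m powr (q - s) < d"
    using d by (simp add: order_tendsto_iff)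
  moreover have "\<forall>\<^sub>F m::real in at_top. m \<ge> 1" by (rule eventually_ge_at_top)
  ultimately show ?thesis
  proof eventually_elim
    case (elim m)
    then have m: "m > 0" by simp
    have ms: "m powr (- s) * m powr s = 1" using m by (simp add: powr_add[symmetric])
    have mq: "m powr (q - s) * m powr s = m powr q" using m by (simp add: powr_add[symmetric])
    have "((1 + L) * m powr (- s) + 7 * (ln m * m powr (- s)) + C * m powr (q - s)) * m powr s < d * m powr s"
      using elim m by (intro mult_strict_right_mono) auto
    moreover have "((1 + L) * m powr (- s) + 7 * (ln m * m powr (- s)) + C * m powr (q - s)) * m powr s
        = (1 + L) * (m powr (- s) * m powr s) + 7 * (ln m * (m powr (- s) * m powr s))
          + C * (m powr (q - s) * m powr s)" by (simp add: algebra_simps)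
    ultimately have key: "1 + L + 7 * ln m + C * m powr q < d * m powr s" by (simp only: ms mq) simp
    show ?case
    proof (intro allI impI)
      fix z assume z: "c * m powr p \<le> cmod z" and Re: "\<bar>Re z\<bar> \<le> C * m powr q"
      have c0: "c * m powr p > 0" using assms m by simp
      obtain n where n: "exp ((cmod z / exp 1) powr \<sigma> - 1) * fact n powr (1 / \<sigma>) \<le> cmod z ^ n"
        using power_over_fact_large[of "cmod z" \<sigma>, OF less_le_trans[OF c0 z] assms(3)] by blast
      have "d * m powr s = (c * m powr p / exp 1) powr \<sigma>"
        using assms m by (simp add: d_def s_def powr_mult powr_divide powr_powr)
      also have "\<dots> \<le> (cmod z / exp 1) powr \<sigma>"
        using assms z c0 by (intro powr_mono2 divide_right_mono) auto
      finally have "L + 7 * ln m < ((cmod z / exp 1) powr \<sigma> - 1) + Re z"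
        using key Re by linarith
      then have "exp (L + 7 * ln m) < exp ((cmod z / exp 1) powr \<sigma> - 1) * exp (Re z)"
        by (simp add: exp_add[symmetric])
      moreover have "K * m ^ 7 \<le> exp (L + 7 * ln m)"
      proof -
        have "exp (7 * ln m) = m ^ 7"
          using m exp_of_nat_mult[of 7 "ln m"] by simp
        then have "exp (L + 7 * ln m) = max K 1 * m ^ 7" by (simp add: L_def exp_add)
        then show ?thesis using m by (simp add: mult_right_mono)
      qed
      ultimately have "K * m ^ 7 < exp ((cmod z / exp 1) powr \<sigma> - 1) * exp (Re z)" by simp
      then have "(K * m ^ 7) * fact n powr (1 / \<sigma>)
          < (exp ((cmod z / exp 1) powr \<sigma> - 1) * exp (Re z)) * fact n powr (1 / \<sigma>)"
        by (intro mult_strict_right_mono) auto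
      also have "\<dots> \<le> cmod z ^ n * exp (Re z)"
        using mult_right_mono[OF n, of "exp (Re z)"] by (simp add: mult_ac)
      finally show "\<exists>n. K * fact n powr (1 / \<sigma>) * m ^ 7 < cmod z ^ n * exp (Re z)"
        by (intro exI[of _ n]) (simp add: mult_ac)
    qed
  qed
qed

text \<open>The decay rate \<open>m\<^sup>q\<close> of a branch against its frequency \<open>m\<^sup>p\<close> gives the exponent \<open>\<mu> = q / p\<close>.\<close>

definition slow_branch :: "real \<Rightarrow> real \<Rightarrow> real \<Rightarrow> real \<Rightarrow> real \<Rightarrow> real \<Rightarrow> real \<Rightarrow> real \<Rightarrow> bool" where
  "slow_branch a b k \<alpha> \<beta> \<gamma> p q \<longleftrightarrow> (\<exists>c>0. \<exists>C. \<forall>\<^sub>F m in at_top. \<exists>r \<omega>.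
     char_fun (a * m powr \<gamma>) m (k * m powr \<beta>) (b\<^sup>2 * m powr (2 * \<alpha>)) r = 0 \<and>
     c * m powr p \<le> \<omega> \<and> cmod (r - \<i> * complex_of_real \<omega>) \<le> C * m powr q)"

text \<open>For \<open>q < p\<close> the displacement is negligible against the frequency, which
  costs half of \<open>c\<close>. The centre is purely imaginary, so the displacement also bounds
  the real part.\<close>

lemma slow_branchD:
  assumes "slow_branch a b k \<alpha> \<beta> \<gamma> p q" "q < p"
  shows "\<exists>c>0. \<exists>C. \<forall>\<^sub>F m in at_top. \<exists>r.
     char_fun (a * m powr \<gamma>) m (k * m powr \<beta>) (b\<^sup>2 * m powr (2 * \<alpha>)) r = 0 \<and>
     c * m powr p \<le> cmod r \<and> \<bar>Re r\<bar> \<le> C * m powr q"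
proof -
  obtain c C where c: "c > 0" and ev: "\<forall>\<^sub>F m in at_top. \<exists>r \<omega>.
     char_fun (a * m powr \<gamma>) m (k * m powr \<beta>) (b\<^sup>2 * m powr (2 * \<alpha>)) r = 0 \<and>
     c * m powr p \<le> \<omega> \<and> cmod (r - \<i> * complex_of_real \<omega>) \<le> C * m powr q"
    using assms(1) unfolding slow_branch_def by blast
  have "((\<lambda>m::real. C * m powr (q - p)) \<longlongrightarrow> C * 0) at_top"
    using assms(2) by (intro tendsto_mult tendsto_const tendsto_neg_powr filterlim_ident) simp
  then have "\<forall>\<^sub>F m in at_top. C * m powr (q - p) < c / 2" by (rule order_tendstoD(2)) (use c in simp)
  moreover have "\<forall>\<^sub>F m::real in at_top. m > 0" by (rule eventually_gt_at_top)
  ultimately have "\<forall>\<^sub>F m in at_top. \<exists>r.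
     char_fun (a * m powr \<gamma>) m (k * m powr \<beta>) (b\<^sup>2 * m powr (2 * \<alpha>)) r = 0 \<and>
     (c / 2) * m powr p \<le> cmod r \<and> \<bar>Re r\<bar> \<le> C * m powr q"
    using ev
  proof eventually_elim
    case (elim m)
    then obtain r \<omega> where r: "char_fun (a * m powr \<gamma>) m (k * m powr \<beta>) (b\<^sup>2 * m powr (2 * \<alpha>)) r = 0"
      and \<omega>: "c * m powr p \<le> \<omega>" and le: "cmod (r - \<i> * complex_of_real \<omega>) \<le> C * m powr q" by blast
    have "C * m powr q = (C * m powr (q - p)) * m powr p"
      using elim by (simp add: powr_add[symmetric])
    also have "\<dots> \<le> (c / 2) * m powr p" using elim by (intro mult_right_mono) auto
    finally have "C * m powr q \<le> (c / 2) * m powr p" .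
    moreover have "\<omega> \<le> cmod (\<i> * complex_of_real \<omega>)" by (simp add: norm_mult)
    moreover have "cmod (\<i> * complex_of_real \<omega>) \<le> cmod r + cmod (r - \<i> * complex_of_real \<omega>)"
      using norm_triangle_ineq4[of r "r - \<i> * complex_of_real \<omega>"] by simp
    ultimately have "(c / 2) * m powr p \<le> cmod r" using \<omega> le by linarith
    moreover have "\<bar>Re r\<bar> \<le> C * m powr q"
      using abs_Re_le_cmod[of "r - \<i> * complex_of_real \<omega>"] le by simp
    ultimately show ?case using r by blast
  qed
  then show ?thesis using c by (intro exI[of _ "c / 2"]) auto
qed

text \<open>For all large \<open>m\<close> the root outgrows the bound of
  \<open>gevrey_root_bound\<close>. A single eigenvalue beyond the threshold gives the
  contradiction, so their spacing is irrelevant.\<close>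

theorem (in coercive_self_adjoint) slow_branch_not_gevrey:
  fixes ev :: "nat \<Rightarrow> real" and a b k \<alpha> \<beta> \<gamma> \<sigma> :: real
  assumes ev: "\<And>n. eigenvalue A (complex_of_real (ev n))" "filterlim ev at_top sequentially"
    and abk: "a > 0" "k > 0" "b \<noteq> 0"
    and exps: "0 \<le> \<alpha>" "\<alpha> \<le> 3/2" "\<beta> \<le> 1" "0 \<le> \<gamma>" "\<gamma> \<le> 2"
    and C0: "C0_semigroup (energy_space A \<gamma>) (energy_norm A a \<gamma>) T"
    and gen: "generator (energy_space A \<gamma>) (energy_norm A a \<gamma>) T = system_operator A a b k \<alpha> \<beta> \<gamma>"
    and branch: "slow_branch a b k \<alpha> \<beta> \<gamma> p q" and pq: "0 < p" "q < p" "0 < \<sigma>" "q < p * \<sigma>"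
  shows "\<not> gevrey_class (energy_space A \<gamma>) (energy_norm A a \<gamma>) T (1 / \<sigma>)"
proof
  assume gevrey: "gevrey_class (energy_space A \<gamma>) (energy_norm A a \<gamma>) T (1 / \<sigma>)"
  obtain K where K: "\<And>m e z n. (e, m *\<^sub>R e) \<in> A \<Longrightarrow> e \<noteq> 0 \<Longrightarrow> 1 \<le> m \<Longrightarrow> 1 \<le> cmod z \<Longrightarrow>
    char_fun (a * m powr \<gamma>) m (k * m powr \<beta>) (b\<^sup>2 * m powr (2 * \<alpha>)) z = 0 \<Longrightarrow>
    cmod z ^ n * exp (Re z) \<le> K * fact n powr (1 / \<sigma>) * m ^ 7"
    using gevrey_root_bound[OF abk exps C0 gen gevrey] by blast
  obtain c C where c: "c > 0" and roots: "\<forall>\<^sub>F m in at_top. \<exists>r.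
     char_fun (a * m powr \<gamma>) m (k * m powr \<beta>) (b\<^sup>2 * m powr (2 * \<alpha>)) r = 0 \<and>
     c * m powr p \<le> cmod r \<and> \<bar>Re r\<bar> \<le> C * m powr q"
    using slow_branchD[OF branch pq(2)] by blast
  have "filterlim (\<lambda>m::real. c * m powr p) at_top at_top" using c pq by real_asymp
  then have "\<forall>\<^sub>F m::real in at_top. 1 \<le> c * m powr p" by (simp add: filterlim_at_top)
  moreover note roots eventually_growth[OF c pq(1,3,4), of C K]
  moreover have "\<forall>\<^sub>F m::real in at_top. m \<ge> 1" by (rule eventually_ge_at_top)
  ultimately have "\<forall>\<^sub>F m in at_top. 1 \<le> m \<and> (\<exists>r n. 1 \<le> cmod r \<and>
     char_fun (a * m powr \<gamma>) m (k * m powr \<beta>) (b\<^sup>2 * m powr (2 * \<alpha>)) r = 0 \<and>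
     K * fact n powr (1 / \<sigma>) * m ^ 7 < cmod r ^ n * exp (Re r))"
  proof eventually_elim
    case (elim m)
    then obtain r where r: "char_fun (a * m powr \<gamma>) m (k * m powr \<beta>) (b\<^sup>2 * m powr (2 * \<alpha>)) r = 0"
     "c * m powr p \<le> cmod r" "\<bar>Re r\<bar> \<le> C * m powr q" by blast
    then obtain n where "K * fact n powr (1 / \<sigma>) * m ^ 7 < cmod r ^ n * exp (Re r)" using elim by blast
    moreover have "1 \<le> cmod r" using r elim by simp
    ultimately show ?case using r elim by blast
  qed
  from eventually_compose_filterlim[OF this ev(2)] obtain n r l
    where m: "1 \<le> ev n" and r: "1 \<le> cmod r"
     "char_fun (a * ev n powr \<gamma>) (ev n) (k * ev n powr \<beta>) (b\<^sup>2 * ev n powr (2 * \<alpha>)) r = 0"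
     and gt: "K * fact l powr (1 / \<sigma>) * ev n ^ 7 < cmod r ^ l * exp (Re r)"
    using eventually_happens[of _ sequentially] by fastforce
  obtain e where "e \<noteq> 0" "(e, ev n *\<^sub>R e) \<in> A"
    using ev(1)[of n] by (auto simp: eigenvalue_def scaleC_of_real)
  from K[OF this(2,1) m r, of l] gt show False by simp
qed

section \<open>Asymptotics of slow branches\<close>

lemma slow_branchI:
  assumes "c > 0" and "\<forall>\<^sub>F m in at_top. \<exists>r \<omega>.
     char_fun (a * m powr \<gamma>) m (k * m powr \<beta>) (b\<^sup>2 * m powr (2 * \<alpha>)) r = 0 \<and>
     c * m powr (2 * p) \<le> \<omega>\<^sup>2 \<and> \<omega> \<ge> 0 \<and> cmod (r - \<i> * complex_of_real \<omega>) \<le> C * m powr q"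
  shows "slow_branch a b k \<alpha> \<beta> \<gamma> p q"
  unfolding slow_branch_def
proof (intro exI conjI)
  show "sqrt c > 0" using assms(1) by simp
  show "\<forall>\<^sub>F m in at_top. \<exists>r \<omega>.
     char_fun (a * m powr \<gamma>) m (k * m powr \<beta>) (b\<^sup>2 * m powr (2 * \<alpha>)) r = 0 \<and>
     sqrt c * m powr p \<le> \<omega> \<and> cmod (r - \<i> * complex_of_real \<omega>) \<le> C * m powr q"
    using assms(2)
  proof eventually_elim
    case (elim m)
    have "sqrt c * m powr p \<le> \<omega>" if "c * m powr (2 * p) \<le> \<omega>\<^sup>2" "\<omega> \<ge> 0" for \<omega>
    proof (rule power2_le_imp_le[OF _ that(2)])
      have "(m powr p)\<^sup>2 = m powr (2 * p)" by (simp add: power2_eq_square flip: powr_add)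
      then show "(sqrt c * m powr p)\<^sup>2 \<le> \<omega>\<^sup>2" using that assms(1) by (simp add: power_mult_distrib)
    qed
    then show ?case using elim by blast
  qed
qed

section \<open>Asymptotic branches and the parameter regions\<close>

context
  fixes a b k :: real
  assumes abk: "a > 0" "b \<noteq> 0" "k > 0"
begin

lemma slow_branch_damped: "slow_branch a b k \<alpha> \<beta> \<gamma> (\<gamma> / 2) (2 * \<alpha> - \<beta>)"
proof (rule slow_branchI[where c = a and C = "2 * b\<^sup>2 / k"])
  show "\<forall>\<^sub>F m in at_top. \<exists>r \<omega>.
     char_fun (a * m powr \<gamma>) m (k * m powr \<beta>) (b\<^sup>2 * m powr (2 * \<alpha>)) r = 0 \<and>
     a * m powr (2 * (\<gamma> / 2)) \<le> \<omega>\<^sup>2 \<and> \<omega> \<ge> 0 \<and>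
     cmod (r - \<i> * complex_of_real \<omega>) \<le> 2 * b\<^sup>2 / k * m powr (2 * \<alpha> - \<beta>)"
    using eventually_gt_at_top[of 0]
  proof eventually_elim
    case (elim m)
    have "2 * (b\<^sup>2 * m powr (2 * \<alpha>)) / (k * m powr \<beta>) = 2 * b\<^sup>2 / k * m powr (2 * \<alpha> - \<beta>)"
      by (simp add: powr_diff)
    then show ?case
      using char_root_near_damped[of "a * m powr \<gamma>" "k * m powr \<beta>" "b\<^sup>2 * m powr (2 * \<alpha>)" m] elim abk
      by (auto intro!: exI[of _ "sqrt (a * m powr \<gamma>)"])
  qed
qed (use abk in simp)

text \<open>The same root is measured in two ways: in the lower bound for the squared frequency
  either the coupling term or the term \<open>m\<close> is kept.\<close>

lemma slow_branch_high:
  shows "slow_branch a b k \<alpha> \<beta> \<gamma> \<alpha> \<beta>" and "slow_branch a b k \<alpha> \<beta> \<gamma> (1 / 2) \<beta>"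
proof -
  have ev: "\<forall>\<^sub>F m in at_top. \<exists>r \<omega>.
     char_fun (a * m powr \<gamma>) m (k * m powr \<beta>) (b\<^sup>2 * m powr (2 * \<alpha>)) r = 0 \<and>
     b\<^sup>2 / 2 * m powr (2 * \<alpha>) \<le> \<omega>\<^sup>2 \<and> 1 / 2 * m powr (2 * (1 / 2)) \<le> \<omega>\<^sup>2 \<and> \<omega> \<ge> 0 \<and>
     cmod (r - \<i> * complex_of_real \<omega>) \<le> 2 * k * m powr \<beta>"
    using eventually_gt_at_top[of 0]
  proof eventually_elim
    case (elim m)
    have "0 \<le> a * m powr \<gamma>" "0 \<le> b\<^sup>2 * m powr (2 * \<alpha>)" using abk by auto
    then have "b\<^sup>2 / 2 * m powr (2 * \<alpha>) \<le> (m + a * m powr \<gamma> + b\<^sup>2 * m powr (2 * \<alpha>)) / 2"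
      "1 / 2 * m powr (2 * (1 / 2)) \<le> (m + a * m powr \<gamma> + b\<^sup>2 * m powr (2 * \<alpha>)) / 2"
      using elim by (simp_all del: zero_le_mult_iff)
    moreover obtain r \<omega> where
      "char_fun (a * m powr \<gamma>) m (k * m powr \<beta>) (b\<^sup>2 * m powr (2 * \<alpha>)) r = 0"
      "(m + a * m powr \<gamma> + b\<^sup>2 * m powr (2 * \<alpha>)) / 2 \<le> \<omega>\<^sup>2" "\<omega> \<ge> 0"
      "cmod (r - \<i> * complex_of_real \<omega>) \<le> 2 * (k * m powr \<beta>)"
      using char_root_high[of "a * m powr \<gamma>" m "k * m powr \<beta>" "b\<^sup>2 * m powr (2 * \<alpha>)"] elim abk by auto
    ultimately show ?case
      by (intro exI[of _ r] exI[of _ \<omega>]) (auto simp only: mult.assoc intro: order_trans)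
  qed
  show "slow_branch a b k \<alpha> \<beta> \<gamma> \<alpha> \<beta>"
    by (rule slow_branchI[where c = "b\<^sup>2 / 2" and C = "2 * k"])
      (use abk in simp, rule eventually_mono[OF ev], blast)
  show "slow_branch a b k \<alpha> \<beta> \<gamma> (1 / 2) \<beta>"
    by (rule slow_branchI[where c = "1 / 2" and C = "2 * k"])
      (simp, rule eventually_mono[OF ev], blast)
qed

text \<open>\<open>s\<close> is an exponent dominating all three summands of the denominator:
  \<open>2 * \<alpha>\<close> when the coupling is strong, and 1 when the second equation
  dominates.\<close>

lemma low_frequency_lower:
  assumes "m \<ge> 1" "1 \<le> s" "\<gamma> \<le> s" "2 * \<alpha> \<le> s"
  shows "a / (1 + a + b\<^sup>2) * m powr (\<gamma> + 1 - s)
    \<le> a * m powr \<gamma> * m / (m + a * m powr \<gamma> + b\<^sup>2 * m powr (2 * \<alpha>))"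
proof -
  have pw: "m powr t \<le> m powr s" if "t \<le> s" for t using powr_mono[OF that] assms by simp
  have le: "m + a * m powr \<gamma> + b\<^sup>2 * m powr (2 * \<alpha>) \<le> (1 + a + b\<^sup>2) * m powr s"
  proof -
    have "m + a * m powr \<gamma> + b\<^sup>2 * m powr (2 * \<alpha>) \<le> m powr s + a * m powr s + b\<^sup>2 * m powr s"
      using pw[OF assms(2)] pw[OF assms(3)] pw[OF assms(4)] assms abk
      by (intro add_mono mult_left_mono) auto
    then show ?thesis by (simp add: algebra_simps)
  qed
  have "a / (1 + a + b\<^sup>2) * m powr (\<gamma> + 1 - s) = a * m powr \<gamma> * m / ((1 + a + b\<^sup>2) * m powr s)"
    using assms by (simp add: powr_diff powr_add)
  also have "\<dots> \<le> a * m powr \<gamma> * m / (m + a * m powr \<gamma> + b\<^sup>2 * m powr (2 * \<alpha>))"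
    using le assms abk by (intro divide_left_mono) (auto intro!: mult_pos_pos add_pos_nonneg)
  finally show ?thesis .
qed

text \<open>The assumptions let the coupling dominate \<open>m\<close> and \<open>g\<close> up to
  constants, so the smaller squared frequency is at least of order
  \<open>m powr (\<gamma> + 1 - 2 * \<alpha>)\<close>.\<close>

lemma slow_branch_low:
  assumes "1 \<le> 2 * \<alpha>" "\<gamma> \<le> 2 * \<alpha>"
  shows "slow_branch a b k \<alpha> \<beta> \<gamma> ((\<gamma> + 1 - 2 * \<alpha>) / 2) (\<beta> + \<gamma> - 2 * \<alpha>)"
proof (rule slow_branchI[where c = "a / (1 + a + b\<^sup>2)" and C = "2 * k * a / b\<^sup>2"])
  show "\<forall>\<^sub>F m in at_top. \<exists>r \<omega>.
     char_fun (a * m powr \<gamma>) m (k * m powr \<beta>) (b\<^sup>2 * m powr (2 * \<alpha>)) r = 0 \<and>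
     a / (1 + a + b\<^sup>2) * m powr (2 * ((\<gamma> + 1 - 2 * \<alpha>) / 2)) \<le> \<omega>\<^sup>2 \<and> \<omega> \<ge> 0 \<and>
     cmod (r - \<i> * complex_of_real \<omega>) \<le> 2 * k * a / b\<^sup>2 * m powr (\<beta> + \<gamma> - 2 * \<alpha>)"
    using eventually_ge_at_top[of 1]
  proof eventually_elim
    case (elim m)
    have "2 * (k * m powr \<beta>) * (a * m powr \<gamma>) / (b\<^sup>2 * m powr (2 * \<alpha>))
        = 2 * k * a / b\<^sup>2 * m powr (\<beta> + \<gamma> - 2 * \<alpha>)"
      by (simp add: powr_diff powr_add)
    moreover obtain r \<omega> where
      "char_fun (a * m powr \<gamma>) m (k * m powr \<beta>) (b\<^sup>2 * m powr (2 * \<alpha>)) r = 0"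
      "a * m powr \<gamma> * m / (m + a * m powr \<gamma> + b\<^sup>2 * m powr (2 * \<alpha>)) \<le> \<omega>\<^sup>2" "\<omega> \<ge> 0"
      "cmod (r - \<i> * complex_of_real \<omega>)
        \<le> 2 * (k * m powr \<beta>) * (a * m powr \<gamma>) / (b\<^sup>2 * m powr (2 * \<alpha>))"
      using char_root_low[of "a * m powr \<gamma>" m "k * m powr \<beta>" "b\<^sup>2 * m powr (2 * \<alpha>)"] elim abk by auto
    moreover have "2 * ((\<gamma> + 1 - 2 * \<alpha>) / 2) = \<gamma> + 1 - 2 * \<alpha>" by simp
    ultimately show ?case using order_trans[OF low_frequency_lower[OF elim assms order_refl]]
      by (intro exI[of _ r] exI[of _ \<omega>]) (simp only: simp_thms)
  qed
qed (use abk in \<open>auto intro!: divide_pos_pos add_pos_nonneg\<close>)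

lemma slow_branch_first_dominant:
  assumes \<theta>: "0 \<le> \<theta>" "\<theta> < 1" "\<forall>\<^sub>F m in at_top. m \<le> \<theta> * (a * m powr \<gamma>)"
  shows "slow_branch a b k \<alpha> \<beta> \<gamma> (\<gamma> / 2) (2 * \<alpha> + \<beta> - \<gamma>)"
proof (rule slow_branchI[where c = a and C = "2 * k * b\<^sup>2 / ((1 - \<theta>)\<^sup>2 * a)"])
  show "\<forall>\<^sub>F m in at_top. \<exists>r \<omega>.
     char_fun (a * m powr \<gamma>) m (k * m powr \<beta>) (b\<^sup>2 * m powr (2 * \<alpha>)) r = 0 \<and>
     a * m powr (2 * (\<gamma> / 2)) \<le> \<omega>\<^sup>2 \<and> \<omega> \<ge> 0 \<and>
     cmod (r - \<i> * complex_of_real \<omega>)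
       \<le> 2 * k * b\<^sup>2 / ((1 - \<theta>)\<^sup>2 * a) * m powr (2 * \<alpha> + \<beta> - \<gamma>)"
    using eventually_ge_at_top[of 1] \<theta>(3)
  proof eventually_elim
    case (elim m)
    have "2 * (k * m powr \<beta>) * (b\<^sup>2 * m powr (2 * \<alpha>)) / ((1 - \<theta>)\<^sup>2 * (a * m powr \<gamma>))
        = 2 * k * b\<^sup>2 / ((1 - \<theta>)\<^sup>2 * a) * m powr (2 * \<alpha> + \<beta> - \<gamma>)"
      by (simp add: powr_diff powr_add mult_ac)
    then show ?case
      using char_root_first_dominant[of "a * m powr \<gamma>" m "k * m powr \<beta>" "b\<^sup>2 * m powr (2 * \<alpha>)" \<theta>]
        elim abk \<theta> by auto
  qed
qed (use abk in simp)

lemma slow_branch_second_dominant: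
  assumes \<theta>: "\<theta> < 1" "\<forall>\<^sub>F m in at_top. a * m powr \<gamma> \<le> \<theta> * m" and exps: "2 * \<alpha> \<le> 1" "\<gamma> \<le> 1"
  shows "slow_branch a b k \<alpha> \<beta> \<gamma> (\<gamma> / 2) (2 * \<alpha> + \<beta> + \<gamma> - 2)"
proof (rule slow_branchI[where c = "a / (1 + a + b\<^sup>2)" and C = "2 * k * b\<^sup>2 * a / (1 - \<theta>)\<^sup>2"])
  show "\<forall>\<^sub>F m in at_top. \<exists>r \<omega>.
     char_fun (a * m powr \<gamma>) m (k * m powr \<beta>) (b\<^sup>2 * m powr (2 * \<alpha>)) r = 0 \<and>
     a / (1 + a + b\<^sup>2) * m powr (2 * (\<gamma> / 2)) \<le> \<omega>\<^sup>2 \<and> \<omega> \<ge> 0 \<and>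
     cmod (r - \<i> * complex_of_real \<omega>)
       \<le> 2 * k * b\<^sup>2 * a / (1 - \<theta>)\<^sup>2 * m powr (2 * \<alpha> + \<beta> + \<gamma> - 2)"
    using eventually_ge_at_top[of 1] \<theta>(2)
  proof eventually_elim
    case (elim m)
    have "m powr (2 * \<alpha> + \<beta> + \<gamma> - 2) = m powr (2 * \<alpha>) * m powr \<beta> * m powr \<gamma> / m\<^sup>2"
      using elim by (simp add: powr_diff powr_add powr_numeral)
    then have "2 * (k * m powr \<beta>) * (b\<^sup>2 * m powr (2 * \<alpha>)) * (a * m powr \<gamma>) / ((1 - \<theta>)\<^sup>2 * m\<^sup>2)
        = 2 * k * b\<^sup>2 * a / (1 - \<theta>)\<^sup>2 * m powr (2 * \<alpha> + \<beta> + \<gamma> - 2)" by simp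
    moreover obtain r \<omega> where
      "char_fun (a * m powr \<gamma>) m (k * m powr \<beta>) (b\<^sup>2 * m powr (2 * \<alpha>)) r = 0"
      "a * m powr \<gamma> * m / (m + a * m powr \<gamma> + b\<^sup>2 * m powr (2 * \<alpha>)) \<le> \<omega>\<^sup>2" "\<omega> \<ge> 0"
      "cmod (r - \<i> * complex_of_real \<omega>)
        \<le> 2 * (k * m powr \<beta>) * (b\<^sup>2 * m powr (2 * \<alpha>)) * (a * m powr \<gamma>) / ((1 - \<theta>)\<^sup>2 * m\<^sup>2)"
      using char_root_second_dominant[of "a * m powr \<gamma>" m "k * m powr \<beta>" "b\<^sup>2 * m powr (2 * \<alpha>)" \<theta>]
        elim abk \<theta> by auto
    ultimately show ?case using low_frequency_lower[OF elim(1) order_refl exps(2,1)]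
      by (intro exI[of _ r] exI[of _ \<omega>]) auto
  qed
qed (use abk in \<open>auto intro!: divide_pos_pos add_pos_nonneg\<close>)

text \<open>Excluding equal speeds leaves either \<open>m \<le> \<theta> * g\<close> or
  \<open>g \<le> \<theta> * m\<close> eventually, for some \<open>\<theta> < 1\<close>. The exponent
  with \<open>max \<gamma> 1\<close> merges the two resulting rates.\<close>

lemma slow_branch_intermediate:
  assumes "(a, \<gamma>) \<noteq> (1, 1)" "\<alpha> \<le> max 1 \<gamma> / 2"
  shows "slow_branch a b k \<alpha> \<beta> \<gamma> (\<gamma> / 2) (2 * \<alpha> + \<beta> + \<gamma> - 2 * max \<gamma> 1)"
proof -
  have first: "2 * \<alpha> + \<beta> + \<gamma> - 2 * max \<gamma> 1 = 2 * \<alpha> + \<beta> - \<gamma>" if "1 \<le> \<gamma>" using that by simp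
  have second: "2 * \<alpha> + \<beta> + \<gamma> - 2 * max \<gamma> 1 = 2 * \<alpha> + \<beta> + \<gamma> - 2" "2 * \<alpha> \<le> 1" if "\<gamma> \<le> 1"
    using that assms(2) by auto
  \<comment> \<open>For \<open>\<gamma> \<noteq> 1\<close> the powers differ and
    \<open>\<theta> = 1/2\<close> works eventually; for \<open>\<gamma> = 1\<close> the ratio is
    constant and \<open>\<theta>\<close> is \<open>1 / a\<close> or \<open>a\<close>.\<close>
  consider "1 < \<gamma>" | "\<gamma> < 1" | "\<gamma> = 1" "a > 1" | "\<gamma> = 1" "a < 1" using assms by fastforce
  then show ?thesis
  proof cases
    case 1
    have "\<forall>\<^sub>F m in at_top. m \<le> 1/2 * (a * m powr \<gamma>)" using 1 abk by real_asymp
    from slow_branch_first_dominant[OF _ _ this] first 1 show ?thesis by simp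
  next
    case 2
    have "\<forall>\<^sub>F m in at_top. a * m powr \<gamma> \<le> 1/2 * m" using 2 abk by real_asymp
    from slow_branch_second_dominant[OF _ this] second 2 show ?thesis by simp
  next
    case 3
    have "\<forall>\<^sub>F m in at_top. m \<le> 1 / a * (a * m powr \<gamma>)"
      using eventually_ge_at_top[of 1] by eventually_elim (use 3 in simp)
    from slow_branch_first_dominant[OF _ _ this] first 3 show ?thesis by simp
  next
    case 4
    have "\<forall>\<^sub>F m in at_top. a * m powr \<gamma> \<le> a * m"
      using eventually_ge_at_top[of 1] by eventually_elim (use 4 in simp)
    from slow_branch_second_dominant[OF _ this] second 4 show ?thesis by simp
  qed
qed

lemma region_slow_branch:
  assumes "(a, \<gamma>) \<noteq> (1, 1)" "1/2 \<le> \<gamma>" "\<gamma> \<le> 2"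
    and "(\<alpha>, \<beta>, \<gamma>) \<in> region_R2 \<gamma> \<and> \<mu> = 2 * (2*\<alpha> - \<beta>) / \<gamma> \<or>
         (\<alpha>, \<beta>, \<gamma>) \<in> region_R3 \<gamma> \<and> \<mu> = 2 * (2*\<alpha> + \<beta> - max \<gamma> (2 - \<gamma>)) / \<gamma> \<or>
         (\<alpha>, \<beta>, \<gamma>) \<in> region_R4 \<gamma> \<and> \<mu> = \<beta> / \<alpha> \<or>
         (\<alpha>, \<beta>, \<gamma>) \<in> region_R5 \<gamma> \<and> \<mu> = 2 * (- 2*\<alpha> + \<beta> + \<gamma>) / (- 2*\<alpha> + \<gamma> + 1)"
  shows "\<exists>p q. slow_branch a b k \<alpha> \<beta> \<gamma> p q \<and> 0 < q \<and> q < p \<and> \<mu> = q / p"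
  using assms(4)
proof (elim disjE conjE)
  assume r: "(\<alpha>, \<beta>, \<gamma>) \<in> region_R2 \<gamma>" and \<mu>: "\<mu> = 2 * (2*\<alpha> - \<beta>) / \<gamma>"
  from r have "0 < 2 * \<alpha> - \<beta>" "2 * \<alpha> - \<beta> < \<gamma> / 2" by (auto simp: region_R2_def)
  then show ?thesis using \<mu> slow_branch_damped assms(2)
    by (intro exI[of _ "\<gamma> / 2"] exI[of _ "2 * \<alpha> - \<beta>"]) (auto simp: mult.commute)
next
  assume r: "(\<alpha>, \<beta>, \<gamma>) \<in> region_R3 \<gamma>" and \<mu>: "\<mu> = 2 * (2*\<alpha> + \<beta> - max \<gamma> (2 - \<gamma>)) / \<gamma>"
  have q: "2 * \<alpha> + \<beta> + \<gamma> - 2 * max \<gamma> 1 = 2*\<alpha> + \<beta> - max \<gamma> (2 - \<gamma>)" by (auto simp: max_def)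
  \<comment> \<open>The last inequality is \<open>q < p\<close>: the bound on \<alpha> reduces it to
    the strict upper bound on \<beta>, separately for each value of the maxima.\<close>
  from r have "0 < 2*\<alpha> + \<beta> - max \<gamma> (2 - \<gamma>)" "\<alpha> \<le> max 1 \<gamma> / 2"
    "2*\<alpha> + \<beta> - max \<gamma> (2 - \<gamma>) < \<gamma> / 2" by (auto simp: region_R3_def max_def split: if_splits)
  then show ?thesis using \<mu> slow_branch_intermediate[OF assms(1), of \<alpha> \<beta>, unfolded q] assms(2)
    by (intro exI[of _ "\<gamma> / 2"] exI[of _ "2*\<alpha> + \<beta> - max \<gamma> (2 - \<gamma>)"]) (auto simp: mult.commute)
next
  assume r: "(\<alpha>, \<beta>, \<gamma>) \<in> region_R4 \<gamma>" and \<mu>: "\<mu> = \<beta> / \<alpha>"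
  from r have "0 < \<beta>" "\<beta> < \<alpha>" by (auto simp: region_R4_def region_R_def split: if_splits)
  then show ?thesis using \<mu> slow_branch_high(1) by blast
next
  assume r: "(\<alpha>, \<beta>, \<gamma>) \<in> region_R5 \<gamma>" and \<mu>: "\<mu> = 2 * (- 2*\<alpha> + \<beta> + \<gamma>) / (- 2*\<alpha> + \<gamma> + 1)"
  \<comment> \<open>The first two inequalities are the assumptions of
    \<open>slow_branch_low\<close>, the third is \<open>0 < q\<close> and the fourth is
    \<open>q < p\<close> cleared of denominators.\<close>
  have "1 \<le> 2 * \<alpha> \<and> \<gamma> \<le> 2 * \<alpha> \<and> 2 * \<alpha> < \<beta> + \<gamma> \<and> 2 * \<beta> < 1 - \<gamma> + 2 * \<alpha>"
  proof (cases "1 < \<gamma>")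
    case True
    then have *: "2*\<alpha> - \<beta> - \<gamma> < 0" "\<alpha> > \<gamma>/2" "\<beta> \<le> (4*\<alpha>\<^sup>2 - 2*\<gamma>*\<alpha>) / (4*\<alpha> - \<gamma> - 1)" "\<beta> \<le> 1"
      using r by (auto simp: region_R5_def region_R_def split: if_splits)
    define d where "d = 4*\<alpha> - \<gamma> - 1"
    have d: "d > 0" using * True by (simp add: d_def)
    have "\<beta> * d \<le> 4*\<alpha>\<^sup>2 - 2*\<gamma>*\<alpha>" using *(3) d by (simp add: d_def pos_le_divide_eq)
    \<comment> \<open>The boundary curve of the region lies strictly below the line where
      \<open>q = p\<close>; this identity measures the distance, positive for
      \<open>\<gamma> > 1\<close> and \<open>2 * \<alpha> < \<gamma> + 1\<close>.\<close>
    moreover have "(1 - \<gamma> + 2 * \<alpha>) * d - 2 * (4*\<alpha>\<^sup>2 - 2*\<gamma>*\<alpha>) = (\<gamma> - 1) * (\<gamma> + 1 - 2 * \<alpha>)"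
      by (simp add: d_def power2_eq_square algebra_simps)
    moreover have "(\<gamma> - 1) * (\<gamma> + 1 - 2 * \<alpha>) > 0" using True * by (intro mult_pos_pos) auto
    ultimately have "(2 * \<beta>) * d < (1 - \<gamma> + 2 * \<alpha>) * d" by simp
    then have "2 * \<beta> < 1 - \<gamma> + 2 * \<alpha>" using d by (subst (asm) mult_less_cancel_right_pos) auto
    then show ?thesis using * True by simp
  next
    case False
    then show ?thesis using r by (auto simp: region_R5_def)
  qed
  then show ?thesis using \<mu> slow_branch_low[of \<alpha> \<gamma> \<beta>] assms(3)
    by (intro exI[of _ "(\<gamma> + 1 - 2 * \<alpha>) / 2"] exI[of _ "\<beta> + \<gamma> - 2 * \<alpha>"]) (auto simp: algebra_simps)
qed

lemma region_slow_branch_equal_speeds: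
  assumes "(\<alpha>, \<beta>) \<in> region_Rt2 \<and> \<mu> = 2 * (2*\<alpha> - \<beta>) \<or>
         (\<alpha>, \<beta>) \<in> region_Rt3 \<and> \<mu> = 2 * \<beta> \<or>
         (\<alpha>, \<beta>) \<in> region_Rt4 \<and> \<mu> = (- 2*\<alpha> + \<beta> + 1) / (1 - \<alpha>)"
  shows "\<exists>p q. slow_branch a b k \<alpha> \<beta> 1 p q \<and> 0 < q \<and> q < p \<and> \<mu> = q / p"
  using assms
proof (elim disjE conjE)
  assume r: "(\<alpha>, \<beta>) \<in> region_Rt2" and \<mu>: "\<mu> = 2 * (2*\<alpha> - \<beta>)"
  from r have "0 < 2 * \<alpha> - \<beta>" "2 * \<alpha> - \<beta> < 1 / 2" by (auto simp: region_Rt2_def)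
  then show ?thesis using \<mu> slow_branch_damped[of \<alpha> \<beta> 1]
    by (intro exI[of _ "1 / 2"] exI[of _ "2 * \<alpha> - \<beta>"]) auto
next
  assume r: "(\<alpha>, \<beta>) \<in> region_Rt3" and \<mu>: "\<mu> = 2 * \<beta>"
  from r have "0 < \<beta>" "\<beta> < 1 / 2" by (auto simp: region_Rt3_def region_Rt_def)
  then show ?thesis using \<mu> slow_branch_high(2)[of \<alpha> \<beta> 1]
    by (intro exI[of _ "1 / 2"] exI[of _ \<beta>]) auto
next
  assume r: "(\<alpha>, \<beta>) \<in> region_Rt4" and \<mu>: "\<mu> = (- 2*\<alpha> + \<beta> + 1) / (1 - \<alpha>)"
  from r have "1 / 2 < \<alpha>" "\<beta> < \<alpha>" "2 * \<alpha> - \<beta> < 1" "\<alpha> < 1"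
    by (auto simp: region_Rt4_def region_Rt_def)
  moreover have p: "(1 + 1 - 2 * \<alpha>) / 2 = 1 - \<alpha>" by simp
  have "slow_branch a b k \<alpha> \<beta> 1 (1 - \<alpha>) (\<beta> + 1 - 2 * \<alpha>)"
    using slow_branch_low[of \<alpha> 1 \<beta>] calculation unfolding p by simp
  ultimately show ?thesis using \<mu>
    by (intro exI[of _ "1 - \<alpha>"] exI[of _ "\<beta> + 1 - 2 * \<alpha>"]) simp
qed

end

theorem theorem5p5:
  fixes A :: "('h::complex_hilbert \<times> 'h) set"
    and ev :: "nat \<Rightarrow> real"
    and a b k :: real
  assumes "self_adjoint A" and "positive_definite A"
    and "\<And>n. eigenvalue A (complex_of_real (ev n))"
    and "filterlim ev at_top sequentially"
    and "a > 0" and "k > 0" and "b \<noteq> 0"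
  shows
    "(\<forall>\<alpha> \<beta> \<gamma> \<mu> :: real. \<forall>T :: real \<Rightarrow> 'h state \<Rightarrow> 'h state.
        (a, \<gamma>) \<noteq> (1, 1) \<longrightarrow> 1/2 \<le> \<gamma> \<longrightarrow> \<gamma> \<le> 2 \<longrightarrow>
        ((\<alpha>, \<beta>, \<gamma>) \<in> region_R2 \<gamma> \<and> \<mu> = 2 * (2*\<alpha> - \<beta>) / \<gamma> \<or>
         (\<alpha>, \<beta>, \<gamma>) \<in> region_R3 \<gamma> \<and> \<mu> = 2 * (2*\<alpha> + \<beta> - max \<gamma> (2 - \<gamma>)) / \<gamma> \<or>
         (\<alpha>, \<beta>, \<gamma>) \<in> region_R4 \<gamma> \<and> \<mu> = \<beta> / \<alpha> \<or>
         (\<alpha>, \<beta>, \<gamma>) \<in> region_R5 \<gamma> \<and> \<mu> = 2 * (- 2*\<alpha> + \<beta> + \<gamma>) / (- 2*\<alpha> + \<gamma> + 1)) \<longrightarrow>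
        C0_semigroup (energy_space A \<gamma>) (energy_norm A a \<gamma>) T \<longrightarrow>
        generator (energy_space A \<gamma>) (energy_norm A a \<gamma>) T = system_operator A a b k \<alpha> \<beta> \<gamma> \<longrightarrow>
        (\<forall>\<epsilon>>0. \<not> gevrey_class (energy_space A \<gamma>) (energy_norm A a \<gamma>) T (1 / (\<mu> + \<epsilon>))))
     \<and>
     (\<forall>\<alpha> \<beta> \<mu> :: real. \<forall>T :: real \<Rightarrow> 'h state \<Rightarrow> 'h state.
        a = 1 \<longrightarrow>
        ((\<alpha>, \<beta>) \<in> region_Rt2 \<and> \<mu> = 2 * (2*\<alpha> - \<beta>) \<or>
         (\<alpha>, \<beta>) \<in> region_Rt3 \<and> \<mu> = 2 * \<beta> \<or>
         (\<alpha>, \<beta>) \<in> region_Rt4 \<and> \<mu> = (- 2*\<alpha> + \<beta> + 1) / (1 - \<alpha>)) \<longrightarrow>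
        C0_semigroup (energy_space A 1) (energy_norm A a 1) T \<longrightarrow>
        generator (energy_space A 1) (energy_norm A a 1) T = system_operator A a b k \<alpha> \<beta> 1 \<longrightarrow>
        (\<forall>\<epsilon>>0. \<not> gevrey_class (energy_space A 1) (energy_norm A a 1) T (1 / (\<mu> + \<epsilon>))))"
proof -
  obtain c where "c > 0" "\<And>x y. (x, y) \<in> A \<Longrightarrow> c * (norm x)\<^sup>2 \<le> Re (cinner y x)"
    using assms(2) unfolding positive_definite_def by blast
  then interpret coercive_self_adjoint A c using assms(1) by unfold_locales
  have main: "\<not> gevrey_class (energy_space A \<gamma>) (energy_norm A a \<gamma>) T (1 / (\<mu> + \<epsilon>))"
    if branch: "\<exists>p q. slow_branch a b k \<alpha> \<beta> \<gamma> p q \<and> 0 < q \<and> q < p \<and> \<mu> = q / p"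
      and exps: "0 \<le> \<alpha>" "\<alpha> \<le> 3/2" "\<beta> \<le> 1" "0 \<le> \<gamma>" "\<gamma> \<le> 2"
      and C0: "C0_semigroup (energy_space A \<gamma>) (energy_norm A a \<gamma>) T"
      and gen: "generator (energy_space A \<gamma>) (energy_norm A a \<gamma>) T = system_operator A a b k \<alpha> \<beta> \<gamma>"
      and \<epsilon>: "\<epsilon> > 0" for \<alpha> \<beta> \<gamma> \<mu> \<epsilon> T
  proof -
    obtain p q where pq: "slow_branch a b k \<alpha> \<beta> \<gamma> p q" "0 < q" "q < p" "\<mu> = q / p"
      using branch by blast
    then have p: "p > 0" by simp
    have "\<mu> + \<epsilon> > 0" using pq p \<epsilon> by (simp add: add_pos_pos)
    \<comment> \<open>Since \<open>p * \<mu> = q\<close>, this is where the strict excess \<epsilon>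
      enters.\<close>
    moreover have "q < p * (\<mu> + \<epsilon>)" using pq p \<epsilon> by (simp add: distrib_left)
    ultimately show ?thesis
      by (intro slow_branch_not_gevrey[OF assms(3-7) exps C0 gen pq(1) p pq(3)])
  qed
  have E: "0 \<le> \<alpha> \<and> \<alpha> \<le> 3/2 \<and> \<beta> \<le> 1" if "(\<alpha>, \<beta>, \<gamma>) \<in> region_R \<gamma>" "1/2 \<le> \<gamma>" "\<gamma> \<le> 2" for \<alpha> \<beta> \<gamma>
    using that by (auto simp: region_R_def region_E_def split: if_splits)
  have sub: "region_R2 \<gamma> \<subseteq> region_R \<gamma>" "region_R3 \<gamma> \<subseteq> region_R \<gamma>" "region_R4 \<gamma> \<subseteq> region_R \<gamma>"
    "region_R5 \<gamma> \<subseteq> region_R \<gamma>" for \<gamma>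
    by (auto simp: region_R2_def region_R3_def region_R4_def region_R5_def)
  have sub': "region_Rt2 \<subseteq> region_Rt" "region_Rt3 \<subseteq> region_Rt" "region_Rt4 \<subseteq> region_Rt"
    by (auto simp: region_Rt2_def region_Rt3_def region_Rt4_def)
  have Et: "0 \<le> \<alpha> \<and> \<alpha> \<le> 3/2 \<and> \<beta> \<le> 1" if "(\<alpha>, \<beta>) \<in> region_Rt" for \<alpha> \<beta>
    using that by (auto simp: region_Rt_def)
  show ?thesis
  proof (intro conjI allI impI, goal_cases)
    case (1 \<alpha> \<beta> \<gamma> \<mu> T \<epsilon>)
    have "(\<alpha>, \<beta>, \<gamma>) \<in> region_R \<gamma>" using 1(4) sub by blast
    from E[OF this 1(2,3)] show ?case
      using 1 by (intro main region_slow_branch[OF assms(5,7,6)]) auto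
  next
    case (2 \<alpha> \<beta> \<mu> T \<epsilon>)
    have "(\<alpha>, \<beta>) \<in> region_Rt" using 2(2) sub' by blast
    from Et[OF this] show ?case
      using 2 by (intro main region_slow_branch_equal_speeds[OF assms(5,7,6)]) auto
  qed
qed

end
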